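(* Let $c\in[1,16/15)$, $h\in\mathcal{F}_c$, let $\varphi$ be the inverse function of $h$, and let $\gamma=1/c$. Let $q\in\mathbb{N}$ and $0\le a\le q-1$ with $(a,q)=1$. If $\chi>0$ satisfies $16(1-\gamma)+28\chi<1$, then there exists $\chi'>0$ such that for every $N\in\mathbb{N}$ and every $\xi\in[0,1]$ $$\sum_{\substack{p\in\mathbf{P}_{h,N}\\ p\equiv a\,(\mathrm{mod}\,q)}}\varphi'(p)^{-1}\log p\ e^{2\pi i\xi p}=\sum_{\substack{p\in\mathbf{P}_{N}\\ p\equiv a\,(\mathrm{mod}\,q)}}\log p\ e^{2\pi i\xi p}+O\big(N^{1-\chi-\chi'}\big),$$ where the implied constant is independent of $\xi$ and $N$.
   Context: $\mathbf{P}$ is the set of primes, $\mathbf{P}_N=\mathbf{P}\cap[1,N]$. For $c\in[1,2)$, $\mathcal{F}_c$ is the family of all functions $h:[x_0,\infty)\to[1,\infty)$ (for some $x_0\ge1$) satisfying: (i) $h\in\mathcal{C}^3([x_0,\infty))$ and $h'(x)>0$, $h''(x)>0$ for every $x\ge x_0$; (ii) there exist a real-valued function $\vartheta\in\mathcal{C}^2([x_0,\infty))$ and a constant $C_h>0$ such that $h(x)=C_hx^c\ell_h(x)$ with $\ell_h(x)=\exp\big(\int_{x_0}^x\frac{\vartheta(t)}{t}dt\big)$ for every $x\ge x_0$, and if $c>1$, then $\lim_{x\to\infty}\vartheta(x)=\lim_{x\to\infty}x\vartheta'(x)=\lim_{x\to\infty}x^2\vartheta''(x)=0$; (iii) if $c=1$,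 then $\vartheta$ is positive, decreasing, for every $\varepsilon>0$ one has $\frac1{\vartheta(x)}\lesssim_\varepsilon x^\varepsilon$, $\lim_{x\to\infty}\frac{x}{h(x)}=0$, and $\lim_{x\to\infty}\vartheta(x)=\lim_{x\to\infty}\frac{x\vartheta'(x)}{\vartheta(x)}=\lim_{x\to\infty}\frac{x^2\vartheta''(x)}{\vartheta(x)}=0$. $\mathbf{P}_h=\{p\in\mathbf{P}:\ \exists_{n\in\mathbb{N}}\ p=\lfloor h(n)\rfloor\}$ ($n$ ranging over positive integers in the domain of $h$) and $\mathbf{P}_{h,N}=\mathbf{P}_h\cap[1,N]$. The inverse $\varphi$ is defined on $[h(x_0),\infty)$; the finitely many terms with $p<h(x_0)$ in the sum involving $\varphi'(p)$ are disregarded. *)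

theory Defs
  imports "HOL-Analysis.Analysis" "HOL-Number_Theory.Number_Theory"
begin

(* The derivative relative to S: one-sided at an endpoint of an interval S. *)
definition deriv_on :: "real set \<Rightarrow> (real \<Rightarrow> real) \<Rightarrow> real \<Rightarrow> real" where
  "deriv_on S f = (\<lambda>x. vector_derivative f (at x within S))"

definition C_diff_on :: "nat \<Rightarrow> real set \<Rightarrow> (real \<Rightarrow> real) \<Rightarrow> bool" where
  "C_diff_on k S f \<longleftrightarrow>
     (\<forall>j<k. (deriv_on S ^^ j) f differentiable_on S) \<and> continuous_on S ((deriv_on S ^^ k) f)"

(* A function h : [x0, \<infinity>) \<rightarrow> [1, \<infinity>) is represented by the left endpoint x0 together with
   a total function h whose values outside {x0..} are irrelevant. "Decreasing" is read in
   the weak sense, which gives the larger family. *)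
definition in_family :: "real \<Rightarrow> real \<Rightarrow> (real \<Rightarrow> real) \<Rightarrow> bool" where
  "in_family c x0 h \<longleftrightarrow>
     1 \<le> c \<and> c < 2 \<and> 1 \<le> x0 \<and> (\<forall>x\<ge>x0. 1 \<le> h x) \<and>
     C_diff_on 3 {x0..} h \<and>
     (\<forall>x\<ge>x0. deriv_on {x0..} h x > 0 \<and> (deriv_on {x0..} ^^ 2) h x > 0) \<and>
     (\<exists>\<theta> C. C_diff_on 2 {x0..} \<theta> \<and> C > 0 \<and>
        (\<forall>x\<ge>x0. h x = C * x powr c * exp (integral {x0..x} (\<lambda>t. \<theta> t / t))) \<and>
        (c > 1 \<longrightarrow>
           (\<theta> \<longlongrightarrow> 0) at_top \<and>
           ((\<lambda>x. x * deriv_on {x0..} \<theta> x) \<longlongrightarrow> 0) at_top \<and>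
           ((\<lambda>x. x\<^sup>2 * (deriv_on {x0..} ^^ 2) \<theta> x) \<longlongrightarrow> 0) at_top) \<and>
        (c = 1 \<longrightarrow>
           (\<forall>x\<ge>x0. \<theta> x > 0) \<and> antimono_on {x0..} \<theta> \<and>
           (\<forall>\<epsilon>>0. \<exists>K. \<forall>x\<ge>x0. 1 / \<theta> x \<le> K * x powr \<epsilon>) \<and>
           ((\<lambda>x. x / h x) \<longlongrightarrow> 0) at_top \<and>
           (\<theta> \<longlongrightarrow> 0) at_top \<and>
           ((\<lambda>x. x * deriv_on {x0..} \<theta> x / \<theta> x) \<longlongrightarrow> 0) at_top \<and>
           ((\<lambda>x. x\<^sup>2 * (deriv_on {x0..} ^^ 2) \<theta> x / \<theta> x) \<longlongrightarrow> 0) at_top))"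

definition primes_of :: "real \<Rightarrow> (real \<Rightarrow> real) \<Rightarrow> nat set" where
  "primes_of x0 h = {p. prime p \<and> (\<exists>n::nat. 1 \<le> n \<and> x0 \<le> real n \<and> int p = \<lfloor>h (real n)\<rfloor>)}"

definition e2pi :: "real \<Rightarrow> complex" where
  "e2pi t = exp (2 * of_real pi * \<i> * of_real t)"

end

theory Submission
  imports Defs "HOL-Computational_Algebra.Squarefree"
begin

text \<open>
  A prime \<open>p\<close> has the form \<open>\<lfloor>h(n)\<rfloor>\<close> exactly when an integer lies in \<open>[\<phi>(p), \<phi>(p+1))\<close>, so its indicator is
  \<open>\<phi>(p+1) - \<phi>(p)\<close>, which is \<open>\<phi>'(p)\<close> up to a negligible error, plus the difference of the fractional
  parts of \<open>-\<phi>(p+1)\<close> and \<open>-\<phi>(p)\<close>. Fejer means sandwich the sawtooth function between shifted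
  trigonometric polynomials; applied with the nonnegative weights \<open>1 + cos(2\<pi>(\<xi>p + \<beta>))\<close> this reduces
  everything to bounding the sums of \<open>\<Lambda>(n) e(\<xi>n + m\<phi>(n+s))\<close> for \<open>s\<close> equal to 0 or 1 by
  \<open>X\<close> to the power \<open>1 - (1-\<gamma>) - chi - \<epsilon>\<close>, uniformly in \<open>\<xi>\<close> and in \<open>m\<close> up to \<open>X\<close> to the power
  \<open>3((1-\<gamma>) + chi + \<epsilon>)\<close>. Vaughan's identity splits them into type I and type II sums. In the type II
  sums Cauchy-Schwarz is applied over short blocks of the inner variable, and in both cases the
  remaining sums fall to van der Corput's second derivative test, where the linear term \<open>\<xi>n\<close> disappears.
  The lower bounds for the second derivatives come from \<open>y\<^sup>2\<phi>''(y) = -E(\<phi>(y))\<close>, where \<open>E\<close> is explicit in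
  \<open>\<theta>\<close> and \<open>\<theta>'\<close> and has slowly decaying positive derivative, also for \<open>c = 1\<close>.
\<close>

section \<open>Exponential sums over intervals\<close>

text \<open>A budget of exponents shapes the proof. With A = 1 - \<gamma>, the weight 1/\<phi>' has
  size about X^A on [X, 2X), so an error below X^(1 - chi) requires a saving X^(-\<delta>) with
  \<delta> slightly above A + chi. Because the Fejer kernel decays only quadratically, shifted Fejer
  means with M frequencies bound the sawtooth with error about M^(-1/3). Hence M is about X^(3
  \<delta>), and this is why frequencies m of that size have to be handled. The approximation is a
  pair of inequalities, which can be summed only against nonnegative weights, while e(\<xi> p) is
  complex. The weights 1 and 1 + cos are both nonnegative and differ by the cosine, from which real
  and imaginary parts are recovered. As no bound depends on \<xi>, a residue class costs nothing:
  its additive characters shift \<xi> by j/q. The coefficient 16 of 1 - \<gamma> comes from the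
  off-diagonal terms of the type II sums, through the reciprocal square root of the curvature in the
  second derivative test. What the main exponents leave of 28 chi pays for the \<epsilon>
  losses.\<close>

lemma e2pi_cis: "e2pi t = cis (2 * pi * t)"
  by (simp add: e2pi_def cis_conv_exp mult_ac)

lemma norm_e2pi [simp]: "norm (e2pi t) = 1"
  by (simp add: e2pi_cis)

lemma e2pi_add: "e2pi (s + t) = e2pi s * e2pi t"
  by (simp add: e2pi_cis cis_mult distrib_left)

lemma e2pi_0 [simp]: "e2pi 0 = 1"
  by (simp add: e2pi_cis)

lemma e2pi_of_int [simp]: "e2pi (of_int j) = 1"
proof -
  have "2 * pi * of_int j = 2 * pi * j" by simp
  then show ?thesis unfolding e2pi_cis
    by (metis cis_multiple_2pi Ints_of_int)
qed

lemma e2pi_minus: "e2pi (- t) = cnj (e2pi t)"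
  by (simp add: e2pi_cis cis_cnj)

lemma e2pi_diff: "e2pi (s - t) = e2pi s * cnj (e2pi t)"
  using e2pi_add[of s "- t"] by (simp add: e2pi_minus)

lemma e2pi_diff_int: "e2pi (t - of_int j) = e2pi t"
  by (simp add: e2pi_diff)

text \<open>Jordan's inequality: the difference of the two sides is convex and vanishes at 0 and
  1/2, hence is nonpositive in between.\<close>

lemma sin_pi_ge:
  assumes "0 \<le> x" "x \<le> 1/2"
  shows "2 * x \<le> sin (pi * x)"
proof -
  let ?f = "\<lambda>x::real. 2 * x - sin (pi * x)"
  have "convex_on {0..1/2} ?f"
  proof (rule f''_ge0_imp_convex[where f' = "\<lambda>x. 2 - pi * cos (pi * x)" and f'' = "\<lambda>x. pi * pi * sin (pi * x)"])
    fix x :: real assume "x \<in> {0..1/2}"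
    then show "0 \<le> pi * pi * sin (pi * x)"
      by (intro mult_nonneg_nonneg sin_ge_zero) (auto simp: pi_ge_zero mult_le_cancel_left1)
  qed (auto intro!: derivative_eq_intros)
  from convex_onD[OF this, of "2 * x" 0 "1/2"] assms show ?thesis by simp
qed

lemma norm_e2pi_minus_1: "norm (e2pi t - 1) = 2 * \<bar>sin (pi * t)\<bar>"
proof -
  have "(norm (e2pi t - 1))\<^sup>2 = (2 * \<bar>sin (pi * t)\<bar>)\<^sup>2"
    using cos_double_sin[of "pi * t"] sin_cos_squared_add[of "2 * pi * t"]
    unfolding cmod_power2 e2pi_cis power_mult_distrib power2_abs
    by (simp add: power2_diff mult.assoc mult.left_commute[of pi 2])
  then show ?thesis by (metis abs_ge_zero norm_ge_zero power2_eq_imp_eq zero_le_mult_iff zero_le_numeral)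
qed

lemma norm_e2pi_minus_1_ge:
  assumes "\<bar>t\<bar> \<le> 1/2"
  shows "4 * \<bar>t\<bar> \<le> norm (e2pi t - 1)"
proof -
  have "2 * \<bar>t\<bar> \<le> sin (pi * \<bar>t\<bar>)" using assms by (intro sin_pi_ge) auto
  also have "\<dots> \<le> \<bar>sin (pi * t)\<bar>" by (cases "0 \<le> t") (simp_all add: abs_if)
  finally show ?thesis unfolding norm_e2pi_minus_1 by linarith
qed

text \<open>Kusmin-Landau inequality. Since e(f n) = (e(f(n+1)) - e(f n)) * G n with G n = 1/(e(D n)
  - 1), summation by parts leaves two boundary values of G and its total variation. Monotone
  differences make the variation telescope, and the distance \<theta> from the integers bounds G;
  the shares 1/4, 1/2 and 1/4 add up to 1/\<theta>.\<close>

lemma kusmin_landau: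
  fixes f :: "nat \<Rightarrow> real" and j :: int
  defines "D \<equiv> \<lambda>n. f (Suc n) - f n"
  assumes \<theta>: "0 < \<theta>"
    and bnd: "\<And>n. p \<le> n \<Longrightarrow> n < q \<Longrightarrow> of_int j + \<theta> \<le> D n \<and> D n \<le> of_int j + 1 - \<theta>"
    and mono: "\<And>n. p \<le> n \<Longrightarrow> Suc n < q \<Longrightarrow> D n \<le> D (Suc n)"
  shows "norm (\<Sum>n\<in>{p..<q}. e2pi (f n)) \<le> 1 / \<theta>"
proof (cases "p < q")
  case False
  then show ?thesis using \<theta> by simp
next
  case pq: True
  define d where "d = (\<lambda>n. D n - of_int j)"
  define C where "C = (\<lambda>n. cot (pi * d n))"
  \<comment> \<open>\<open>G n\<close> inverts \<open>e2pi (D n) - 1\<close>; its real part is constant, so its total variation telescopes through \<open>C\<close>.\<close>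
  define G where "G = (\<lambda>n. Complex (- 1/2) (- C n / 2))"
  have d: "\<theta> \<le> d n" "d n \<le> 1 - \<theta>" if "p \<le> n" "n < q" for n
    using bnd[OF that] by (auto simp: d_def)
  have sin_ge: "2 * \<theta> \<le> sin (pi * d n)" if "p \<le> n" "n < q" for n
  proof (cases "d n \<le> 1/2")
    case True
    then show ?thesis using sin_pi_ge[of "d n"] d[OF that] \<theta> by linarith
  next
    case False
    have "sin (pi * (1 - d n)) = sin (pi * d n)"
      using sin_pi_minus[of "pi * d n"] by (simp only: right_diff_distrib mult_1_right)
    then have "2 * (1 - d n) \<le> sin (pi * d n)"
      using sin_pi_ge[of "1 - d n"] d[OF that] \<theta> False by simp
    moreover have "2 * \<theta> \<le> 2 * (1 - d n)" using d[OF that] by simp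
    ultimately show ?thesis by (rule order.trans[rotated])
  qed
  have G1: "e2pi (D n) * G n = 1 + G n" if "p \<le> n" "n < q" for n
  proof -
    have s: "sin (pi * d n) \<noteq> 0" using sin_ge[OF that] \<theta> by linarith
    have "e2pi (D n) = e2pi (d n)" unfolding d_def by (simp add: e2pi_diff_int)
    also have "(e2pi (d n) - 1) * G n = 1"
    proof -
      let ?s = "sin (pi * d n)" and ?c = "cos (pi * d n)"
      have "e2pi (d n) - 1 = Complex (- 2 * ?s\<^sup>2) (2 * ?s * ?c)"
        using cos_double_sin[of "pi * d n"] sin_double[of "pi * d n"]
        by (simp add: e2pi_cis complex_eq_iff mult_ac)
      moreover have "G n = Complex (- 1/2) (- (?c / ?s) / 2)"
        by (simp add: G_def C_def cot_def)
      moreover have "Complex (- 2 * ?s\<^sup>2) (2 * ?s * ?c) * Complex (- 1/2) (- (?c / ?s) / 2)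
          = Complex (?s\<^sup>2 + ?c\<^sup>2) 0"
        using s by (simp add: complex_eq_iff power2_eq_square)
      ultimately show ?thesis by (simp add: complex_eq_iff)
    qed
    ultimately show ?thesis by (simp add: algebra_simps)
  qed
  have C_mono: "C (Suc n) \<le> C n" if "p \<le> n" "Suc n < q" for n
  proof -
    let ?a = "pi * d n" and ?b = "pi * d (Suc n)"
    have sa: "sin ?a > 0" and sb: "sin ?b > 0"
      using sin_ge[of n] sin_ge[of "Suc n"] that \<theta> by auto
    have dd: "d n \<le> d (Suc n)" using mono[OF that] by (simp add: d_def)
    have "d (Suc n) - d n \<le> 1" using d[of n] d[of "Suc n"] that \<theta> by auto
    then have "sin (pi * (d (Suc n) - d n)) \<ge> 0"
      using dd by (intro sin_ge_zero) (auto simp: mult_le_cancel_left1)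
    then have "sin (?b - ?a) \<ge> 0" by (simp add: algebra_simps)
    then have "cot ?a - cot ?b \<ge> 0" using sa sb
      by (simp add: cot_def sin_diff field_simps)
    then show ?thesis by (simp add: C_def)
  qed
  have Cabs: "\<bar>C n\<bar> \<le> 1 / (2 * \<theta>)" if "p \<le> n" "n < q" for n
  proof -
    have "\<bar>C n\<bar> = \<bar>cos (pi * d n)\<bar> / sin (pi * d n)"
      using sin_ge[OF that] \<theta> by (simp add: C_def cot_def)
    also have "\<dots> \<le> 1 / (2 * \<theta>)"
      using sin_ge[OF that] \<theta> by (intro frac_le) auto
    finally show ?thesis .
  qed
  have Gnorm: "norm (G n) \<le> 1 / (4 * \<theta>)" if "p \<le> n" "n < q" for n
  proof -
    let ?s = "sin (pi * d n)" and ?c = "cos (pi * d n)"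
    have s: "?s > 0" using sin_ge[OF that] \<theta> by linarith
    have "(norm (G n))\<^sup>2 = 1/4 + (?c/?s)\<^sup>2 / 4"
      by (simp add: cmod_power2 G_def C_def cot_def power_divide)
    also have "\<dots> = (1 / (2 * ?s))\<^sup>2"
      using s sin_cos_squared_add3[of "pi * d n"] by (simp add: field_simps power2_eq_square)
    finally have "norm (G n) = 1 / (2 * ?s)" using s by (simp add: power2_eq_iff_nonneg)
    also have "\<dots> \<le> 1 / (4 * \<theta>)" using sin_ge[OF that] \<theta> by (intro divide_left_mono) auto
    finally show ?thesis .
  qed
  \<comment> \<open>The subtracted term is the boundary term of summation by parts at the right end.
    Once it is removed, each further index costs only the change of \<open>G\<close>, which is half
    a difference of consecutive cotangents.\<close>
  have step: "norm ((\<Sum>n\<in>{p..<Suc (p + m)}. e2pi (f n)) - e2pi (f (Suc (p + m))) * G (p + m))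
      \<le> norm (G p) + (C p - C (p + m)) / 2" if "p + m < q" for m
    using that
  proof (induction m)
    case 0
    have "e2pi (f (Suc p)) = e2pi (f p) * e2pi (D p)"
      by (simp add: e2pi_add[symmetric] D_def)
    then have "e2pi (f (Suc p)) * G p = e2pi (f p) * (1 + G p)"
      using G1[of p] pq by (simp add: mult.assoc)
    then have "e2pi (f p) - e2pi (f (Suc p)) * G p = - e2pi (f p) * G p"
      by (simp add: distrib_left)
    then show ?case by (simp add: norm_mult)
  next
    case (Suc m)
    let ?n = "Suc (p + m)"
    let ?S = "(\<Sum>n\<in>{p..<?n}. e2pi (f n)) - e2pi (f ?n) * G (p + m)"
    have "e2pi (f (Suc ?n)) = e2pi (f ?n) * e2pi (D ?n)"
      by (simp add: e2pi_add[symmetric] D_def)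
    then have "e2pi (f (Suc ?n)) * G ?n = e2pi (f ?n) * (1 + G ?n)"
      using G1[of ?n] Suc.prems by (simp add: mult.assoc)
    then have "(\<Sum>n\<in>{p..<Suc (p + Suc m)}. e2pi (f n)) - e2pi (f (Suc (p + Suc m))) * G (p + Suc m)
        = ?S + e2pi (f ?n) * (G (p + m) - G ?n)"
      by (simp add: algebra_simps)
    also have "norm \<dots> \<le> norm ?S + norm (G (p + m) - G ?n)"
      by (rule order.trans[OF norm_triangle_ineq]) (simp add: norm_mult)
    also have "norm (G (p + m) - G ?n) = (C (p + m) - C ?n) / 2"
    proof -
      have "G (p + m) - G ?n = Complex 0 (- (C (p + m) - C ?n) / 2)"
        by (simp add: G_def complex_eq_iff field_simps)
      then show ?thesis using C_mono[of "p + m"] Suc.prems by (simp add: complex_norm)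
    qed
    finally show ?case using Suc.IH Suc.prems by (simp add: diff_divide_distrib)
  qed
  define m where "m = q - 1 - p"
  have m: "p + m < q" "Suc (p + m) = q" using pq by (auto simp: m_def)
  let ?S = "\<Sum>n\<in>{p..<q}. e2pi (f n)"
  have "norm ?S \<le> norm (?S - e2pi (f q) * G (p + m)) + norm (e2pi (f q) * G (p + m))"
    by (metis add.commute norm_triangle_sub)
  also have "\<dots> \<le> norm (G p) + (C p - C (p + m)) / 2 + norm (G (p + m))"
    using step[OF m(1)] m(2) by (simp add: norm_mult)
  also have "\<dots> \<le> 1 / (4 * \<theta>) + (1 / (2 * \<theta>) + 1 / (2 * \<theta>)) / 2 + 1 / (4 * \<theta>)"
    using Gnorm[of p] Gnorm[of "p + m"] Cabs[of p] Cabs[of "p + m"] m pq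
    by (intro add_mono divide_right_mono) auto
  also have "\<dots> = 1 / \<theta>" using \<theta> by (simp add: field_simps)
  finally show ?thesis .
qed

lemma convex_nat_set:
  fixes S :: "nat set"
  assumes "finite S" "\<And>x y z. x \<in> S \<Longrightarrow> z \<in> S \<Longrightarrow> x \<le> y \<Longrightarrow> y \<le> z \<Longrightarrow> y \<in> S"
  shows "\<exists>p q. S = {p..<q}"
proof (cases "S = {}")
  case True
  then have "S = {0..<0}" by simp
  then show ?thesis by blast
next
  case False
  have "S = {Min S..<Suc (Max S)}"
  proof (intro equalityI subsetI)
    fix x assume "x \<in> S"
    then show "x \<in> {Min S..<Suc (Max S)}" using assms(1) by (simp add: less_Suc_eq_le)
  next
    fix x assume "x \<in> {Min S..<Suc (Max S)}"
    then show "x \<in> S" using assms(2)[of "Min S" "Max S" x] assms(1) False by (simp add: less_Suc_eq_le)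
  qed
  then show ?thesis by blast
qed

text \<open>The differences increase by at least \<open>lam\<close> per step, so few of them lie
  within \<theta> of an integer, and those well inside a unit interval are handled by
  \<open>kusmin_landau\<close>. Values spread over a length V meet at most V + 2 intervals [j, j +
  1).\<close>

lemma vdc_discrete:
  fixes f :: "nat \<Rightarrow> real"
  defines "D \<equiv> \<lambda>n. f (Suc n) - f n"
  assumes L: "0 < lam"
    and inc: "\<And>n. p \<le> n \<Longrightarrow> Suc n < q \<Longrightarrow> lam \<le> D (Suc n) - D n"
    and V: "\<And>m n. p \<le> m \<Longrightarrow> m \<le> n \<Longrightarrow> n < q \<Longrightarrow> D n - D m \<le> V" and V0: "0 \<le> V"
  shows "norm (\<Sum>n\<in>{p..<q}. e2pi (f n)) \<le> (V + 2) * (3 / sqrt lam + 4)"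
proof (cases "p < q")
  case False
  then show ?thesis using L V0 by simp
next
  case pq: True
  \<comment> \<open>\<open>sqrt lam\<close> balances the count \<open>\<theta> / lam\<close> near
    integers against the Kusmin-Landau bound \<open>1 / \<theta>\<close>. The cap 1/2 keeps the
    ranges near j and near j + 1 disjoint and costs only an additive constant when
    \<open>lam\<close> is large.\<close>
  define \<theta> where "\<theta> = min (sqrt lam) (1/2)"
  have \<theta>: "0 < \<theta>" "\<theta> \<le> sqrt lam" "\<theta> \<le> 1/2" using L by (auto simp: \<theta>_def)
  let ?T = "{p..<q}"
  have D_diff: "lam * real k \<le> D (n + k) - D n" if "p \<le> n" "n + k < q" for n k
    using that
  proof (induction k)
    case (Suc k)
    have "lam \<le> D (Suc (n + k)) - D (n + k)" using Suc.prems by (intro inc) auto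
    then show ?case using Suc by (simp add: algebra_simps)
  qed simp
  have D_mono: "D m \<le> D n" if "p \<le> m" "m \<le> n" "n < q" for m n
    using D_diff[of m "n - m"] that L
    by (smt (verit) le_add_diff_inverse mult_nonneg_nonneg of_nat_0_le_iff)
  have card_le: "real (card A) \<le> \<theta> / lam + 1"
    if A: "A \<subseteq> ?T" "\<And>m n. m \<in> A \<Longrightarrow> n \<in> A \<Longrightarrow> D n - D m \<le> \<theta>" for A
  proof (cases "A = {}")
    case True
    then show ?thesis using \<theta> L by simp
  next
    case False
    have fin: "finite A" using A(1) finite_subset by blast
    let ?m = "Min A" and ?M = "Max A"
    have mM: "?m \<in> A" "?M \<in> A" "?m \<le> ?M" using fin False by auto
    have "lam * real (?M - ?m) \<le> D (?m + (?M - ?m)) - D ?m"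
      using mM A(1) by (intro D_diff) auto
    also have "\<dots> \<le> \<theta>" using A(2)[of ?m ?M] mM by simp
    finally have "real (?M - ?m) \<le> \<theta> / lam" using L by (simp add: field_simps)
    moreover have "card A \<le> card {?m..?M}" using fin by (intro card_mono) auto
    then have "real (card A) \<le> real (?M - ?m) + 1" using mM(3) by (simp add: of_nat_diff)
    ultimately show ?thesis by linarith
  qed
  have small: "norm (\<Sum>n\<in>A. e2pi (f n)) \<le> \<theta> / lam + 1"
    if A: "A \<subseteq> ?T" "\<And>m n. m \<in> A \<Longrightarrow> n \<in> A \<Longrightarrow> D n - D m \<le> \<theta>" for A
  proof -
    have "norm (\<Sum>n\<in>A. e2pi (f n)) \<le> (\<Sum>n\<in>A. 1)"
      by (rule order.trans[OF norm_sum]) simp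
    with card_le[OF A] show ?thesis by simp
  qed
  have piece: "norm (\<Sum>n\<in>{n\<in>?T. \<lfloor>D n\<rfloor> = j}. e2pi (f n)) \<le> 3 / sqrt lam + 4" for j
  proof -
    define A where "A = {n\<in>?T. of_int j \<le> D n \<and> D n < of_int j + \<theta>}"
    define B where "B = {n\<in>?T. of_int j + \<theta> \<le> D n \<and> D n \<le> of_int j + 1 - \<theta>}"
    define C where "C = {n\<in>?T. of_int j + 1 - \<theta> < D n \<and> D n < of_int j + 1}"
    have U: "{n\<in>?T. \<lfloor>D n\<rfloor> = j} = A \<union> (B \<union> C)"
      unfolding A_def B_def C_def floor_eq_iff using \<theta> by auto
    have disj: "A \<inter> (B \<union> C) = {}" "B \<inter> C = {}"
      unfolding A_def B_def C_def using \<theta> by auto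
    have fin: "finite A" "finite B" "finite C" by (simp_all add: A_def B_def C_def)
    have nA: "norm (\<Sum>n\<in>A. e2pi (f n)) \<le> \<theta> / lam + 1"
      by (rule small) (auto simp: A_def)
    have nC: "norm (\<Sum>n\<in>C. e2pi (f n)) \<le> \<theta> / lam + 1"
      by (rule small) (auto simp: C_def)
    \<comment> \<open>Monotonicity of the differences makes the middle range a block of consecutive
      indices.\<close>
    have "\<exists>p' q'. B = {p'..<q'}"
    proof (rule convex_nat_set[OF fin(2)])
      fix x y z assume "x \<in> B" "z \<in> B" "x \<le> y" "y \<le> z"
      then show "y \<in> B" using D_mono[of x y] D_mono[of y z] by (auto simp: B_def)
    qed
    then obtain p' q' where B: "B = {p'..<q'}" by blast
    have nB: "norm (\<Sum>n\<in>B. e2pi (f n)) \<le> 1 / \<theta>"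
      unfolding B
    proof (rule kusmin_landau[where j = j])
      fix n assume "p' \<le> n" "n < q'"
      then have "n \<in> B" by (simp add: B)
      then show "of_int j + \<theta> \<le> f (Suc n) - f n \<and> f (Suc n) - f n \<le> of_int j + 1 - \<theta>"
        by (auto simp: B_def D_def)
    next
      fix n assume "p' \<le> n" "Suc n < q'"
      then have "n \<in> B" "Suc n \<in> B" by (auto simp: B)
      then show "f (Suc n) - f n \<le> f (Suc (Suc n)) - f (Suc n)"
        using D_mono[of n "Suc n"] by (auto simp: B_def D_def)
    qed (use \<theta> in auto)
    have "(\<Sum>n\<in>{n\<in>?T. \<lfloor>D n\<rfloor> = j}. e2pi (f n)) =
        (\<Sum>n\<in>A. e2pi (f n)) + ((\<Sum>n\<in>B. e2pi (f n)) + (\<Sum>n\<in>C. e2pi (f n)))"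
      unfolding U using disj fin by (simp add: sum.union_disjoint)
    also have "norm \<dots> \<le> (\<theta> / lam + 1) + (1 / \<theta> + (\<theta> / lam + 1))"
      by (intro norm_triangle_le add_mono nA nB nC)
    also have "\<dots> \<le> 3 / sqrt lam + 4"
    proof -
      have "\<theta> / lam \<le> sqrt lam / lam" using \<theta> L by (intro divide_right_mono) auto
      also have "\<dots> = 1 / sqrt lam" using L by (simp add: real_div_sqrt field_simps)
      finally have 1: "\<theta> / lam \<le> 1 / sqrt lam" .
      have 2: "1 / \<theta> \<le> 1 / sqrt lam + 2"
        using L by (auto simp: \<theta>_def min_def)
      have 3: "3 / sqrt lam = 1 / sqrt lam + 1 / sqrt lam + 1 / sqrt lam" by simp
      from 1 2 show ?thesis unfolding 3 by linarith
    qed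
    finally show ?thesis .
  qed
  let ?J = "(\<lambda>n. \<lfloor>D n\<rfloor>) ` ?T"
  have "(\<Sum>n\<in>?T. e2pi (f n)) = (\<Sum>j\<in>?J. \<Sum>n\<in>{n\<in>?T. \<lfloor>D n\<rfloor> = j}. e2pi (f n))"
    by (rule sum.image_gen) simp
  also have "norm \<dots> \<le> (\<Sum>j\<in>?J. 3 / sqrt lam + 4)"
    by (intro sum_norm_le piece)
  also have "\<dots> = real (card ?J) * (3 / sqrt lam + 4)" by simp
  also have "\<dots> \<le> (V + 2) * (3 / sqrt lam + 4)"
  proof (rule mult_right_mono)
    have "card ?J \<le> card {\<lfloor>D p\<rfloor>..\<lfloor>D (q - 1)\<rfloor>}"
      by (rule card_mono) (auto intro!: floor_mono D_mono)
    also have "\<dots> = nat (\<lfloor>D (q - 1)\<rfloor> - \<lfloor>D p\<rfloor> + 1)" by simp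
    finally have "real (card ?J) \<le> real (nat (\<lfloor>D (q - 1)\<rfloor> - \<lfloor>D p\<rfloor> + 1))"
      using of_nat_le_iff by blast
    also have "\<dots> \<le> V + 2"
    proof -
      have "D (q - 1) - D p \<le> V" using pq by (intro V) auto
      moreover have "D p \<le> D (q - 1)" using pq by (intro D_mono) auto
      then have "\<lfloor>D p\<rfloor> \<le> \<lfloor>D (q - 1)\<rfloor>" by (rule floor_mono)
      then have "real (nat (\<lfloor>D (q - 1)\<rfloor> - \<lfloor>D p\<rfloor> + 1)) = of_int \<lfloor>D (q - 1)\<rfloor> - of_int \<lfloor>D p\<rfloor> + 1"
        by simp
      moreover have "of_int \<lfloor>D (q - 1)\<rfloor> \<le> D (q - 1)" "D p < of_int \<lfloor>D p\<rfloor> + 1"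
        by (auto simp: floor_less_iff)
      ultimately show ?thesis by linarith
    qed
    finally show "real (card ?J) \<le> V + 2" .
  qed (use L in auto)
  finally show ?thesis .
qed

text \<open>The mean value theorem turns bounds on the derivatives of \<open>g\<close> into bounds
  on the first and second differences of its values at integers.\<close>

lemma vdc_second_derivative:
  fixes g g1 g2 :: "real \<Rightarrow> real" and S :: "nat set"
  assumes fin: "finite S"
    and conv: "\<And>x y z. x \<in> S \<Longrightarrow> z \<in> S \<Longrightarrow> x \<le> y \<Longrightarrow> y \<le> z \<Longrightarrow> y \<in> S"
    and ivl: "is_interval I" and S: "\<And>n. n \<in> S \<Longrightarrow> real n \<in> I"
    and g: "\<And>t. t \<in> I \<Longrightarrow> (g has_real_derivative g1 t) (at t)"
    and g1: "\<And>t. t \<in> I \<Longrightarrow> (g1 has_real_derivative g2 t) (at t)"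
    and L: "0 < lam" "\<And>t. t \<in> I \<Longrightarrow> lam \<le> g2 t"
    and V: "\<And>s t. s \<in> I \<Longrightarrow> t \<in> I \<Longrightarrow> g1 t - g1 s \<le> V" and V0: "0 \<le> V"
  shows "norm (\<Sum>n\<in>S. e2pi (g (real n))) \<le> (V + 2) * (3 / sqrt lam + 5)"
proof -
  have "\<exists>p q. S = {p..<q}" by (rule convex_nat_set[OF fin]) (rule conv)
  then obtain p q where pq: "S = {p..<q}" by blast
  show ?thesis
  proof (cases "p < q")
    case False
    then show ?thesis using pq V0 L by simp
  next
    case True
    \<comment> \<open>The last point is split off because the difference at n evaluates
      \<open>g\<close> at n + 1; for n < r this stays inside \<open>I\<close>. The single term
      accounts for the constant 5 in place of the 4 of \<open>vdc_discrete\<close>.\<close>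
    define r where "r = q - 1"
    have r: "q = Suc r" "p \<le> r" "S = insert r {p..<r}" using True pq by (auto simp: r_def)
    have "real p \<in> I" "real r \<in> I" using r by (auto intro!: S simp: pq)
    then have I: "t \<in> I" if "real p \<le> t" "t \<le> real r" for t
      using ivl that unfolding is_interval_1 by blast
    have mvt: "\<exists>z. real n < z \<and> z < real n + 1 \<and> g (real n + 1) - g (real n) = g1 z"
      if "p \<le> n" "n < r" for n
    proof -
      have "\<exists>z>real n. z < real n + 1 \<and> g (real n + 1) - g (real n) = (real n + 1 - real n) * g1 z"
        using that by (intro MVT2 g I) auto
      then show ?thesis by auto
    qed
    have main: "norm (\<Sum>n\<in>{p..<r}. e2pi (g (real n))) \<le> (V + 2) * (3 / sqrt lam + 4)"
    proof (rule vdc_discrete[OF L(1)])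
      fix n assume n: "p \<le> n" "Suc n < r"
      have "\<exists>z>real n. z < real n + 1 \<and>
          (g (real n + 1 + 1) - g (real n + 1)) - (g (real n + 1) - g (real n)) =
            (real n + 1 - real n) * (g1 (z + 1) - g1 z)"
        using n
        by (intro MVT2[where f = "\<lambda>t. g (t + 1) - g t"])
           (auto intro!: derivative_eq_intros DERIV_chain2[OF g] I)
      then obtain z where z: "real n < z" "z < real n + 1"
        "(g (real n + 1 + 1) - g (real n + 1)) - (g (real n + 1) - g (real n)) = g1 (z + 1) - g1 z"
        by auto
      have "\<exists>w>z. w < z + 1 \<and> g1 (z + 1) - g1 z = (z + 1 - z) * g2 w"
        using n z by (intro MVT2 g1 I) auto
      then obtain w where w: "z < w" "w < z + 1" "g1 (z + 1) - g1 z = g2 w" by auto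
      have "lam \<le> g2 w" using n z w by (intro L I) auto
      then show "lam \<le> g (real (Suc (Suc n))) - g (real (Suc n)) - (g (real (Suc n)) - g (real n))"
        using z w by (simp add: add.commute add.left_commute)
    next
      fix m n assume mn: "p \<le> m" "m \<le> n" "n < r"
      obtain z where z: "real n < z" "z < real n + 1" "g (real n + 1) - g (real n) = g1 z"
        using mvt[of n] mn by auto
      obtain w where w: "real m < w" "w < real m + 1" "g (real m + 1) - g (real m) = g1 w"
        using mvt[of m] mn by auto
      have "g1 z - g1 w \<le> V" using mn z w by (intro V I) auto
      then show "g (real (Suc n)) - g (real n) - (g (real (Suc m)) - g (real m)) \<le> V"
        using z w by (simp add: add.commute)
    qed (use V0 in simp)
    have "(\<Sum>n\<in>S. e2pi (g (real n))) = e2pi (g (real r)) + (\<Sum>n\<in>{p..<r}. e2pi (g (real n)))"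
      using r(3) by simp
    also have "norm \<dots> \<le> 1 + (V + 2) * (3 / sqrt lam + 4)"
      by (intro norm_triangle_le add_mono main) simp
    also have "\<dots> \<le> (V + 2) * (3 / sqrt lam + 5)" using V0 by (simp add: algebra_simps)
    finally show ?thesis .
  qed
qed

section \<open>Arithmetic functions and Vaughan's identity\<close>

definition moebius :: "nat \<Rightarrow> real" where
  "moebius n = (if squarefree n then (- 1) ^ card (prime_factors n) else 0)"

lemma abs_moebius_le: "\<bar>moebius n\<bar> \<le> 1"
  by (simp add: moebius_def power_abs)

lemma moebius_prime_mult:
  assumes p: "prime p" and d: "\<not> p dvd d" "d > 0"
  shows "moebius (p * d) = - moebius d"
proof -
  have cop: "coprime p d" using p d by (simp add: prime_imp_coprime)
  have "squarefree p" using p by (simp add: squarefree_prime)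
  then have "squarefree (p * d) \<longleftrightarrow> squarefree d"
    using cop by (auto intro: squarefree_mult_coprime dest: squarefree_multD)
  moreover have "prime_factors (p * d) = insert p (prime_factors d)"
    using p d by (auto simp: prime_factors_product prime_prime_factors)
  moreover have "p \<notin> prime_factors d" using d by auto
  ultimately show ?thesis by (simp add: moebius_def)
qed

text \<open>Multiplication by a fixed prime p dividing n pairs the squarefree divisors prime to p
  with those divisible by p, and paired values of \<open>moebius\<close> cancel.\<close>

lemma sum_moebius:
  assumes n: "n > 0"
  shows "(\<Sum>d | d dvd n. moebius d) = (if n = 1 then 1 else 0)"
proof (cases "n = 1")
  case True
  then show ?thesis by (simp add: moebius_def)
next
  case False
  then obtain p where p: "prime p" "p dvd n" using prime_factor_nat by blast
  define A where "A = {d. d dvd n \<and> squarefree d \<and> \<not> p dvd d}"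
  define B where "B = {d. d dvd n \<and> squarefree d \<and> p dvd d}"
  have fin: "finite A" "finite B" using n by (auto simp: A_def B_def intro: finite_subset[OF _ finite_divisors_nat[of n]])
  have "bij_betw (\<lambda>d. p * d) A B"
  proof (rule bij_betwI')
    fix x y show "(p * x = p * y) = (x = y)" using p prime_gt_0_nat[of p] by simp
  next
    fix x assume x: "x \<in> A"
    then have c: "coprime p x" using p by (auto simp: A_def intro: prime_imp_coprime)
    then have "p * x dvd n" using x p by (auto simp: A_def intro: divides_mult)
    moreover have "squarefree (p * x)" using x p c by (auto simp: A_def intro: squarefree_mult_coprime squarefree_prime)
    ultimately show "p * x \<in> B" by (simp add: B_def)
  next
    fix y assume y: "y \<in> B"
    then obtain x where x: "y = p * x" by (auto simp: B_def)
    have "squarefree x" using y x by (auto simp: B_def dest: squarefree_multD)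
    moreover have "\<not> p dvd x"
    proof
      assume "p dvd x"
      then have "p\<^sup>2 dvd y" by (auto simp: x power2_eq_square)
      then have "p dvd 1" using y by (auto simp: B_def squarefree_def)
      then show False using p by auto
    qed
    moreover have "x dvd n" using y x by (auto simp: B_def dest: dvd_mult_right)
    ultimately show "\<exists>x\<in>A. y = p * x" using x by (auto simp: A_def)
  qed
  then have "(\<Sum>d\<in>B. moebius d) = (\<Sum>d\<in>A. moebius (p * d))"
    by (intro sum.reindex_bij_betw[symmetric])
  also have "\<dots> = (\<Sum>d\<in>A. - moebius d)"
    using p n by (intro sum.cong refl moebius_prime_mult) (auto simp: A_def intro: Nat.gr0I)
  finally have BA: "(\<Sum>d\<in>B. moebius d) = - (\<Sum>d\<in>A. moebius d)" by (simp add: sum_negf)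
  have "(\<Sum>d | d dvd n. moebius d) = (\<Sum>d\<in>A \<union> B. moebius d)"
    using n by (intro sum.mono_neutral_right) (auto simp: A_def B_def moebius_def)
  also have "\<dots> = (\<Sum>d\<in>A. moebius d) + (\<Sum>d\<in>B. moebius d)"
    by (intro sum.union_disjoint fin) (auto simp: A_def B_def)
  finally show ?thesis using BA False by simp
qed

section \<open>Dirichlet convolution\<close>

definition dconv :: "(nat \<Rightarrow> real) \<Rightarrow> (nat \<Rightarrow> real) \<Rightarrow> nat \<Rightarrow> real" where
  "dconv f g n = (\<Sum>d | d dvd n. f d * g (n div d))"

lemma dconv_cong:
  assumes "n > 0" "\<And>d. d > 0 \<Longrightarrow> f d = f' d" "\<And>d. d > 0 \<Longrightarrow> g d = g' d"
  shows "dconv f g n = dconv f' g' n"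
  unfolding dconv_def using assms
  by (intro sum.cong refl arg_cong2[where f = "(*)"] assms)
     (auto intro: dvd_pos_nat elim!: dvdE)

lemma dconv_commute:
  assumes n: "n > 0"
  shows "dconv f g n = dconv g f n"
  unfolding dconv_def
  by (rule sum.reindex_bij_witness[of _ "\<lambda>d. n div d" "\<lambda>d. n div d"])
     (use n in \<open>auto simp: mult.commute\<close>)

lemma dconv_assoc:
  assumes n: "n > 0"
  shows "dconv (dconv f g) h n = dconv f (dconv g h) n"
proof -
  have fin: "finite {d. d dvd m}" if "m dvd n" for m
    using that n by (intro finite_divisors_nat) (auto intro: dvd_pos_nat)
  have "dconv (dconv f g) h n = (\<Sum>m | m dvd n. \<Sum>d | d dvd m. f d * g (m div d) * h (n div m))"
    by (simp add: dconv_def sum_distrib_right)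
  also have "\<dots> = (\<Sum>(m, d)\<in>(SIGMA m:{m. m dvd n}. {d. d dvd m}). f d * g (m div d) * h (n div m))"
    by (intro sum.Sigma) (use fin in auto)
  also have "\<dots> = (\<Sum>(d, e)\<in>(SIGMA d:{d. d dvd n}. {e. e dvd n div d}). f d * (g e * h (n div d div e)))"
  proof (rule sum.reindex_bij_witness[of _ "\<lambda>(d, e). (d * e, d)" "\<lambda>(m, d). (d, m div d)"])
    fix a assume "a \<in> (SIGMA m:{m. m dvd n}. {d. d dvd m})"
    then obtain m d where a: "a = (m, d)" "m dvd n" "d dvd m" by auto
    then have m: "m > 0" "d > 0" using n by (auto intro: Nat.gr0I)
    obtain e where e: "m = d * e" using a by auto
    obtain k where k: "n = m * k" using a by auto
    show "(case case a of (m, d) \<Rightarrow> (d, m div d) of (d, e) \<Rightarrow> (d * e, d)) = a"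
      using a m e by simp
    show "(case a of (m, d) \<Rightarrow> (d, m div d)) \<in> (SIGMA d:{d. d dvd n}. {e. e dvd n div d})"
      using a m e k by (auto simp: mult.assoc)
    show "(case case a of (m, d) \<Rightarrow> (d, m div d) of (d, e) \<Rightarrow> f d * (g e * h (n div d div e))) =
        (case a of (m, d) \<Rightarrow> f d * g (m div d) * h (n div m))"
      using a m e by (simp add: div_mult2_eq)
  next
    fix b assume "b \<in> (SIGMA d:{d. d dvd n}. {e. e dvd n div d})"
    then obtain d e where b: "b = (d, e)" "d dvd n" "e dvd n div d" by auto
    then have d: "d > 0" using n by (auto intro: Nat.gr0I)
    obtain k where k: "n = d * k" using b by auto
    show "(case case b of (d, e) \<Rightarrow> (d * e, d) of (m, d) \<Rightarrow> (d, m div d)) = b"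
      using b d by simp
    show "(case b of (d, e) \<Rightarrow> (d * e, d)) \<in> (SIGMA m:{m. m dvd n}. {d. d dvd m})"
      using b d k by auto
  qed
  also have "\<dots> = (\<Sum>d | d dvd n. \<Sum>e | e dvd n div d. f d * (g e * h (n div d div e)))"
    by (intro sum.Sigma[symmetric]) (use fin n in \<open>auto simp: div_dvd_iff_mult\<close>)
  also have "\<dots> = dconv f (dconv g h) n"
    by (simp add: dconv_def sum_distrib_left)
  finally show ?thesis .
qed

lemma dconv_add_left: "dconv (\<lambda>d. f d + g d) h n = dconv f h n + dconv g h n"
  by (simp add: dconv_def distrib_right sum.distrib)

lemma dconv_add_right: "dconv h (\<lambda>d. f d + g d) n = dconv h f n + dconv h g n"
  by (simp add: dconv_def distrib_left sum.distrib)

lemma dconv_mangoldt_one: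
  assumes "n > 0" shows "dconv mangoldt (\<lambda>_. 1) n = ln (real n)"
  using mangoldt_sum[of n, where 'a = real] assms by (simp add: dconv_def)

lemma dconv_unit:
  assumes n: "n > 0" shows "dconv (\<lambda>d. if d = 1 then 1 else 0) f n = f n"
proof -
  have "dconv (\<lambda>d. if d = 1 then 1 else 0) f n = (\<Sum>d\<in>{1}. (if d = 1 then 1 else 0) * f (n div d))"
    unfolding dconv_def using n by (intro sum.mono_neutral_right finite_divisors_nat) auto
  then show ?thesis by simp
qed

text \<open>Write * for convolution; both cutoffs are U. Convolving ln = (L1 + L2) * 1 with m1 gives
  m1 * ln = m1 * L1 * 1 + m1 * 1 * L2. Since (m1 + m2) * 1 is the convolution unit, the last term
  equals L2 - m2 * 1 * L2. For n > U the left side is the von Mangoldt function itself.\<close>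

lemma vaughan_identity:
  fixes U :: nat
  defines "m1 \<equiv> \<lambda>d. if d \<le> U then moebius d else 0" and "m2 \<equiv> \<lambda>d. if d \<le> U then 0 else moebius d"
    and "L1 \<equiv> \<lambda>d. if d \<le> U then mangoldt d else 0" and "L2 \<equiv> \<lambda>d. if d \<le> U then 0 else mangoldt d"
  assumes n: "n > 0"
  shows "L2 n = dconv m1 (\<lambda>d. ln (real d)) n - dconv (dconv m1 L1) (\<lambda>_. 1) n
           + dconv (dconv m2 (\<lambda>_. 1)) L2 n"
proof -
  let ?one = "\<lambda>_::nat. 1 :: real"
  have ln: "dconv L1 ?one d + dconv L2 ?one d = ln (real d)" if "d > 0" for d
  proof -
    have "(\<lambda>d. L1 d + L2 d) = mangoldt" by (auto simp: L1_def L2_def)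
    then show ?thesis using dconv_mangoldt_one[OF that] by (simp add: dconv_add_left[symmetric])
  qed
  have "dconv m1 (\<lambda>d. ln (real d)) n = dconv m1 (\<lambda>d. dconv L1 ?one d + dconv L2 ?one d) n"
    by (rule dconv_cong[OF n]) (use ln in auto)
  also have "\<dots> = dconv (dconv m1 L1) ?one n + dconv m1 (dconv L2 ?one) n"
    by (simp add: dconv_add_right dconv_assoc[OF n])
  also have "dconv m1 (dconv L2 ?one) n = dconv (dconv m1 ?one) L2 n"
  proof -
    have "dconv m1 (dconv L2 ?one) n = dconv m1 (dconv ?one L2) n"
      by (rule dconv_cong[OF n]) (auto intro: dconv_commute)
    then show ?thesis by (simp add: dconv_assoc[OF n])
  qed
  finally have 1: "dconv m1 (\<lambda>d. ln (real d)) n =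
      dconv (dconv m1 L1) ?one n + dconv (dconv m1 ?one) L2 n" .
  have "dconv (dconv m1 ?one) L2 n + dconv (dconv m2 ?one) L2 n =
      dconv (\<lambda>d. dconv m1 ?one d + dconv m2 ?one d) L2 n"
    by (simp add: dconv_add_left)
  also have "\<dots> = dconv (\<lambda>d. if d = 1 then 1 else 0) L2 n"
  proof (rule dconv_cong[OF n])
    fix d :: nat assume d: "d > 0"
    have "(\<lambda>d. m1 d + m2 d) = moebius" by (auto simp: m1_def m2_def)
    then have "dconv m1 ?one d + dconv m2 ?one d = dconv moebius ?one d"
      by (simp add: dconv_add_left[symmetric])
    then show "dconv m1 ?one d + dconv m2 ?one d = (if d = 1 then 1 else 0)"
      using sum_moebius[OF d] by (simp add: dconv_def)
  qed simp
  also have "\<dots> = L2 n" by (rule dconv_unit[OF n])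
  finally show ?thesis using 1 by simp
qed

lemma sum_divisors_swap:
  fixes g :: "nat \<Rightarrow> nat \<Rightarrow> 'a :: comm_monoid_add"
  assumes X: "1 \<le> X"
  shows "(\<Sum>n\<in>{X..<Y}. \<Sum>d | d dvd n. g d (n div d)) =
         (\<Sum>d\<in>{1..<Y}. \<Sum>l | X \<le> d * l \<and> d * l < Y. g d l)"
proof -
  have fin: "finite {l. X \<le> d * l \<and> d * l < Y}" if "1 \<le> d" for d
  proof (rule finite_subset)
    show "{l. X \<le> d * l \<and> d * l < Y} \<subseteq> {..<Y}"
      using that by (auto intro: le_less_trans[rotated])
  qed simp
  have "(\<Sum>n\<in>{X..<Y}. \<Sum>d | d dvd n. g d (n div d)) =
      (\<Sum>(n, d)\<in>(SIGMA n:{X..<Y}. {d. d dvd n}). g d (n div d))"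
    using X by (intro sum.Sigma) (auto intro!: finite_divisors_nat)
  also have "\<dots> = (\<Sum>(d, l)\<in>(SIGMA d:{1..<Y}. {l. X \<le> d * l \<and> d * l < Y}). g d l)"
  proof (rule sum.reindex_bij_witness[of _ "\<lambda>(d, l). (d * l, d)" "\<lambda>(n, d). (d, n div d)"])
    fix a assume "a \<in> (SIGMA n:{X..<Y}. {d. d dvd n})"
    then obtain n d where a: "a = (n, d)" "X \<le> n" "n < Y" "d dvd n" by auto
    then have d: "0 < d" "d < Y" using X by (auto intro: Nat.gr0I dest: dvd_imp_le)
    then show "(case case a of (n, d) \<Rightarrow> (d, n div d) of (d, l) \<Rightarrow> (d * l, d)) = a"
       "(case a of (n, d) \<Rightarrow> (d, n div d)) \<in> (SIGMA d:{1..<Y}. {l. X \<le> d * l \<and> d * l < Y})"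
       "(case case a of (n, d) \<Rightarrow> (d, n div d) of (d, l) \<Rightarrow> g d l) = (case a of (n, d) \<Rightarrow> g d (n div d))"
      using a by auto
  qed auto
  also have "\<dots> = (\<Sum>d\<in>{1..<Y}. \<Sum>l | X \<le> d * l \<and> d * l < Y. g d l)"
    by (intro sum.Sigma[symmetric]) (use fin in auto)
  finally show ?thesis .
qed

section \<open>Mean square of the divisor function\<close>

abbreviation divisor_count :: "nat \<Rightarrow> nat" where
  "divisor_count n \<equiv> card {d. d dvd n}"

lemma divisor_count_mult_le:
  assumes "0 < m" "0 < n"
  shows "divisor_count (m * n) \<le> divisor_count m * divisor_count n"
proof -
  have "{d. d dvd m * n} \<subseteq> (\<lambda>(a, b). a * b) ` ({d. d dvd m} \<times> {d. d dvd n})"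
    by (force dest: division_decomp)
  then have "card {d. d dvd m * n} \<le> card ({d. d dvd m} \<times> {d. d dvd n})"
    using assms by (intro surj_card_le finite_cartesian_product finite_divisors_nat)
  then show ?thesis by (simp add: card_cartesian_product)
qed

lemma sum_inverse_le: "1 \<le> K \<Longrightarrow> (\<Sum>k\<in>{1..K}. 1 / real k) \<le> 1 + ln (real K)"
proof (induction K rule: dec_induct)
  case (step K)
  have "ln (real K) - ln (real (Suc K)) \<le> (real K - real (Suc K)) / real (Suc K)"
    using step by (intro ln_diff_le) auto
  then show ?case using step by simp
qed simp

lemma sum_divisors_swap_upto:
  fixes g :: "nat \<Rightarrow> nat \<Rightarrow> 'a :: comm_monoid_add"
  shows "(\<Sum>n\<in>{1..K}. \<Sum>d | d dvd n. g d (n div d)) = (\<Sum>d\<in>{1..K}. \<Sum>l\<in>{1..K div d}. g d l)"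
proof -
  have "{l. 1 \<le> d * l \<and> d * l < Suc K} = {1..K div d}" if "d \<in> {1..K}" for d
    using that by (auto simp: less_Suc_eq_le less_eq_div_iff_mult_less_eq mult.commute Suc_le_eq)
  then show ?thesis
    using sum_divisors_swap[of 1 g "Suc K"] by (simp add: atLeastLessThanSuc_atLeastAtMost)
qed

text \<open>One factor of the square is expanded as a sum over divisors d, and submultiplicativity
  splits the other. The sum over the cofactor then gives one harmonic sum and the remaining sum over
  d two more, whence the cube. This bounds the type II coefficients in mean square.\<close>

lemma sum_divisor_count_sq_le:
  assumes K: "1 \<le> K"
  shows "(\<Sum>k\<in>{1..K}. (real (divisor_count k))\<^sup>2) \<le> real K * (1 + ln (real K)) ^ 3"
proof -
  let ?\<tau> = "\<lambda>n. real (divisor_count n)" and ?H = "\<Sum>k\<in>{1..K}. 1 / real k"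
  have mono: "(\<Sum>k\<in>{1..M}. 1 / real k) \<le> ?H" if "M \<le> K" for M
    using that by (intro sum_mono2) auto
  have H0: "0 \<le> ?H" by (intro sum_nonneg) auto
  have \<tau>1: "(\<Sum>m\<in>{1..M}. ?\<tau> m) \<le> real M * ?H" if "M \<le> K" for M
  proof -
    have "(\<Sum>m\<in>{1..M}. ?\<tau> m) = (\<Sum>m\<in>{1..M}. \<Sum>d | d dvd m. 1)" by simp
    also have "\<dots> = (\<Sum>d\<in>{1..M}. real (M div d))"
      by (subst sum_divisors_swap_upto[of "\<lambda>d l. 1"]) simp
    also have "\<dots> \<le> (\<Sum>d\<in>{1..M}. real M * (1 / real d))"
      by (intro sum_mono) (simp add: of_nat_div_le_of_nat)
    also have "\<dots> = real M * (\<Sum>d\<in>{1..M}. 1 / real d)" by (simp add: sum_distrib_left)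
    also have "\<dots> \<le> real M * ?H" using mono[OF that] by (intro mult_left_mono) auto
    finally show ?thesis .
  qed
  have \<tau>2: "(\<Sum>m\<in>{1..K}. ?\<tau> m / real m) \<le> ?H * ?H"
  proof -
    have "(\<Sum>m\<in>{1..K}. ?\<tau> m / real m) = (\<Sum>m\<in>{1..K}. \<Sum>d | d dvd m. 1 / real (d * (m div d)))"
      by (intro sum.cong refl) (simp add: sum_divide_distrib)
    also have "\<dots> = (\<Sum>d\<in>{1..K}. \<Sum>l\<in>{1..K div d}. 1 / real (d * l))"
      by (rule sum_divisors_swap_upto[of "\<lambda>d l. 1 / real (d * l)"])
    also have "\<dots> = (\<Sum>d\<in>{1..K}. 1 / real d * (\<Sum>l\<in>{1..K div d}. 1 / real l))"
      by (simp add: sum_distrib_left)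
    also have "\<dots> \<le> (\<Sum>d\<in>{1..K}. 1 / real d * ?H)"
      by (intro sum_mono mult_left_mono mono) auto
    also have "\<dots> = ?H * ?H" by (simp add: sum_distrib_right)
    finally show ?thesis .
  qed
  have "(\<Sum>k\<in>{1..K}. (?\<tau> k)\<^sup>2) = (\<Sum>k\<in>{1..K}. \<Sum>d | d dvd k. ?\<tau> (d * (k div d)))"
    by (intro sum.cong refl) (simp add: power2_eq_square)
  also have "\<dots> = (\<Sum>d\<in>{1..K}. \<Sum>l\<in>{1..K div d}. ?\<tau> (d * l))"
    by (rule sum_divisors_swap_upto[of "\<lambda>d l. ?\<tau> (d * l)"])
  also have "\<dots> \<le> (\<Sum>d\<in>{1..K}. \<Sum>l\<in>{1..K div d}. ?\<tau> d * ?\<tau> l)"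
    by (intro sum_mono) (auto simp flip: of_nat_mult intro!: divisor_count_mult_le)
  also have "\<dots> = (\<Sum>d\<in>{1..K}. ?\<tau> d * (\<Sum>l\<in>{1..K div d}. ?\<tau> l))"
    by (simp add: sum_distrib_left)
  also have "\<dots> \<le> (\<Sum>d\<in>{1..K}. ?\<tau> d * (real (K div d) * ?H))"
    by (intro sum_mono mult_left_mono \<tau>1) auto
  also have "\<dots> \<le> (\<Sum>d\<in>{1..K}. ?\<tau> d * (real K / real d * ?H))"
    using H0 by (intro sum_mono mult_left_mono mult_right_mono) (auto simp: of_nat_div_le_of_nat)
  also have "\<dots> = real K * ?H * (\<Sum>d\<in>{1..K}. ?\<tau> d / real d)"
    by (simp add: sum_distrib_left mult_ac)
  also have "\<dots> \<le> real K * ?H * (?H * ?H)"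
    using H0 \<tau>2 by (intro mult_left_mono) auto
  also have "\<dots> = real K * ?H ^ 3" by (simp add: power3_eq_cube)
  also have "\<dots> \<le> real K * (1 + ln (real K)) ^ 3"
    using H0 sum_inverse_le[OF K] by (intro mult_left_mono power_mono) auto
  finally show ?thesis .
qed

section \<open>Type I and type II sums\<close>

lemma norm_sum_e2pi_minus: "norm (\<Sum>n\<in>S. e2pi (- f n)) = norm (\<Sum>n\<in>S. e2pi (f n))"
  by (simp add: e2pi_minus flip: cnj_sum)

text \<open>
  For the phase \<open>k \<mapsto> f (k l)\<close> the second derivative is \<open>g (k l) / k\<^sup>2\<close> with \<open>g y = y\<^sup>2 f''(y)\<close>. The second
  clause therefore bounds below the second derivative of the differences \<open>f (k l) - f (k l')\<close> that
  arise in type II sums, and the bound on \<open>f1 y + y * f2 y\<close> controls the range of their first derivative.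
\<close>

definition local_phase :: "real \<Rightarrow> real \<Rightarrow> real \<Rightarrow> (real \<Rightarrow> real) \<Rightarrow> bool" where
  "local_phase X V \<kappa> f \<longleftrightarrow> (\<exists>f1 f2.
     (\<forall>y\<in>{X..2*X}. (f has_real_derivative f1 y) (at y) \<and> (f1 has_real_derivative f2 y) (at y) \<and>
        \<bar>f1 y\<bar> \<le> V \<and> \<bar>f1 y + y * f2 y\<bar> \<le> V \<and> f2 y \<le> - \<kappa>) \<and>
     (\<forall>a\<in>{X..2*X}. \<forall>b\<in>{X..2*X}. a \<le> b \<longrightarrow> b\<^sup>2 * f2 b - a\<^sup>2 * f2 a \<le> - ((b - a) * X * \<kappa>)))"

lemma convex_nat_dilate:
  fixes k X Y :: nat
  assumes "X \<le> k * x" "k * z < Y" "x \<le> y" "y \<le> z"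
  shows "X \<le> k * y \<and> k * y < Y"
  using assms by (meson le_less_trans le_trans mult_le_mono2)

lemma DERIV_dilate:
  fixes k :: real
  assumes "(f has_real_derivative D) (at (k * t))"
  shows "((\<lambda>t. f (k * t)) has_real_derivative D * k) (at t)"
proof -
  have "((\<lambda>t. k * t) has_real_derivative k) (at t)" by (auto intro!: derivative_eq_intros)
  from DERIV_chain2[OF assms this] show ?thesis .
qed

lemma DERIV_dilate':
  fixes k :: real
  assumes "(f has_real_derivative D) (at (t * k))"
  shows "((\<lambda>t. f (t * k)) has_real_derivative D * k) (at t)"
  using DERIV_dilate[of f D k t] assms by (simp add: mult.commute)

text \<open>Along l the second derivative of the phase is m k^2 f''(k l), at most -m k^2 \<kappa>.
  Negating the phase makes it positive and only conjugates the sum. The test sees the first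
  derivative only through differences, so \<xi> drops out.\<close>

lemma type1_inner:
  fixes X Y k m :: nat and V \<kappa> \<xi> :: real
  assumes f: "local_phase X V \<kappa> f" and pos: "0 < X" "0 < k" "0 < m" "0 < \<kappa>" "0 \<le> V" and Y: "Y \<le> 2 * X"
  shows "norm (\<Sum>l | X \<le> k * l \<and> k * l < Y. e2pi (\<xi> * real (k * l) + real m * f (real (k * l))))
      \<le> (2 * m * k * V + 2) * (3 / (k * sqrt (m * \<kappa>)) + 5)"
proof -
  obtain f1 f2 where F: "\<forall>y\<in>{X..2*real X}. (f has_real_derivative f1 y) (at y) \<and> (f1 has_real_derivative f2 y) (at y) \<and>
        \<bar>f1 y\<bar> \<le> V \<and> \<bar>f1 y + y * f2 y\<bar> \<le> V \<and> f2 y \<le> - \<kappa>"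
     "\<forall>a\<in>{real X..2*X}. \<forall>b\<in>{real X..2*X}. a \<le> b \<longrightarrow> b\<^sup>2 * f2 b - a\<^sup>2 * f2 a \<le> - ((b - a) * X * \<kappa>)"
    using f unfolding local_phase_def by auto
  have f12: "\<And>y. y \<in> {X..2*real X} \<Longrightarrow> (f has_real_derivative f1 y) (at y)"
    "\<And>y. y \<in> {X..2*real X} \<Longrightarrow> (f1 has_real_derivative f2 y) (at y)"
    "\<And>y. y \<in> {X..2*real X} \<Longrightarrow> \<bar>f1 y\<bar> \<le> V" "\<And>y. y \<in> {X..2*real X} \<Longrightarrow> f2 y \<le> - \<kappa>"
    using F by auto
  let ?S = "{l. X \<le> k * l \<and> k * l < Y}"
  let ?I = "{X / k..2 * real X / k}"
  let ?g = "\<lambda>t::real. - (\<xi> * (k * t) + m * f (k * t))"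
  have I: "k * t \<in> {X..2*real X}" if "t \<in> ?I" for t :: real
    using that pos by (auto simp: field_simps)
  have "norm (\<Sum>l\<in>?S. e2pi (?g (real l))) \<le> (2 * m * k * V + 2) * (3 / sqrt (m * (real k)\<^sup>2 * \<kappa>) + 5)"
  proof (rule vdc_second_derivative[where I = ?I])
    show "finite ?S"
      by (rule finite_subset[of _ "{..<Y}"]) (use pos in \<open>auto intro: le_less_trans[rotated]\<close>)
  next
    fix x y z assume "x \<in> ?S" "z \<in> ?S" "x \<le> y" "y \<le> z"
    then show "y \<in> ?S" using convex_nat_dilate[of X k x z Y y] by simp
  next
    fix n assume "n \<in> ?S"
    then have "real X \<le> real (k * n)" "real (k * n) \<le> real (2 * X)" using Y by (auto simp del: of_nat_mult)
    then show "real n \<in> ?I" using pos by (simp add: field_simps)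
  next
    fix t :: real assume t: "t \<in> ?I"
    show "(?g has_real_derivative - (\<xi> * k + m * (f1 (k * t) * k))) (at t)"
      by (auto intro!: derivative_eq_intros DERIV_dilate[OF f12(1)[OF I[OF t]]])
    show "((\<lambda>t. - (\<xi> * k + m * (f1 (k * t) * k))) has_real_derivative - (m * (f2 (k * t) * k * k))) (at t)"
      by (auto intro!: derivative_eq_intros DERIV_dilate[OF f12(2)[OF I[OF t]]])
    have "m * (real k * k) * \<kappa> \<le> m * (real k * k) * (- f2 (k * t))"
      using f12(4)[OF I[OF t]] by (intro mult_left_mono) auto
    then show "m * (real k)\<^sup>2 * \<kappa> \<le> - (m * (f2 (k * t) * k * k))"
      by (simp add: power2_eq_square mult_ac)
  next
    fix s t :: real assume "s \<in> ?I" "t \<in> ?I"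
    then have "f1 (k * s) - f1 (k * t) \<le> 2 * V"
      using f12(3)[OF I, of s] f12(3)[OF I, of t] by linarith
    then have "(real m * k) * (f1 (k * s) - f1 (k * t)) \<le> (real m * k) * (2 * V)"
      by (intro mult_left_mono) auto
    then show "- (\<xi> * k + m * (f1 (k * t) * k)) - - (\<xi> * k + m * (f1 (k * s) * k)) \<le> 2 * m * k * V"
      by (simp add: algebra_simps)
  qed (use pos in \<open>auto simp: is_interval_cc\<close>)
  moreover have "sqrt (m * (real k)\<^sup>2 * \<kappa>) = k * sqrt (m * \<kappa>)"
    by (simp add: real_sqrt_mult)
  moreover have "norm (\<Sum>l\<in>?S. e2pi (?g (real l))) =
      norm (\<Sum>l\<in>?S. e2pi (\<xi> * real (k * l) + real m * f (real (k * l))))"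
    by (subst norm_sum_e2pi_minus) simp
  ultimately show ?thesis by simp
qed

lemma type2_inner:
  fixes X Y K l1 l2 m :: nat and V \<kappa> \<xi> r :: real
  assumes f: "local_phase X V \<kappa> f"
    and pos: "0 < X" "0 < K" "0 < l2" "l2 < l1" "0 < m" "0 < \<kappa>" "0 \<le> V" and Y: "Y \<le> 2 * X"
  defines "r \<equiv> real l1 - real l2"
  shows "norm (\<Sum>k | k \<in> {K..<4 * K} \<and> X \<le> k * l2 \<and> k * l1 < Y.
        e2pi ((\<xi> * real (k * l1) + real m * f (real (k * l1))) - (\<xi> * real (k * l2) + real m * f (real (k * l2)))))
      \<le> (2 * m * r * V + 2) * (3 / sqrt (m * r * X * \<kappa> / (4 * K)) + 5)"
proof -
  obtain f1 f2 where F: "\<forall>y\<in>{X..2*real X}. (f has_real_derivative f1 y) (at y) \<and> (f1 has_real_derivative f2 y) (at y) \<and>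
        \<bar>f1 y\<bar> \<le> V \<and> \<bar>f1 y + y * f2 y\<bar> \<le> V \<and> f2 y \<le> - \<kappa>"
     "\<forall>a\<in>{real X..2*X}. \<forall>b\<in>{real X..2*X}. a \<le> b \<longrightarrow> b\<^sup>2 * f2 b - a\<^sup>2 * f2 a \<le> - ((b - a) * X * \<kappa>)"
    using f unfolding local_phase_def by auto
  have f12: "\<And>y. y \<in> {X..2*real X} \<Longrightarrow> (f has_real_derivative f1 y) (at y)"
    "\<And>y. y \<in> {X..2*real X} \<Longrightarrow> (f1 has_real_derivative f2 y) (at y)"
    "\<And>y. y \<in> {X..2*real X} \<Longrightarrow> \<bar>f1 y + y * f2 y\<bar> \<le> V" 
    "\<And>a b :: real. a \<in> {real X..2*real X} \<Longrightarrow> b \<in> {real X..2*real X} \<Longrightarrow> a \<le> b \<Longrightarrow> b\<^sup>2 * f2 b - a\<^sup>2 * f2 a \<le> - ((b - a) * X * \<kappa>)"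
    using F by auto
  have r: "0 < r" using pos by (simp add: r_def)
  let ?S = "{k. k \<in> {K..<4 * K} \<and> X \<le> k * l2 \<and> k * l1 < Y}"
  let ?I = "{X / l2..2 * real X / l1} \<inter> {K..4 * real K}"
  let ?g = "\<lambda>t::real. - ((\<xi> * (t * l1) + m * f (t * l1)) - (\<xi> * (t * l2) + m * f (t * l2)))"
  let ?W = "\<lambda>t::real. f1 (t * l1) * l1 - f1 (t * l2) * l2"
  let ?g1 = "\<lambda>t::real. - (\<xi> * l1 + m * (f1 (t * l1) * l1) - (\<xi> * l2 + m * (f1 (t * l2) * l2)))"
  let ?g2 = "\<lambda>t::real. - (m * (f2 (t * l1) * l1 * l1) - m * (f2 (t * l2) * l2 * l2))"
  have I: "t * l1 \<in> {X..2*real X}" "t * l2 \<in> {X..2*real X}" "0 < t" "t * l2 \<le> t * l1" if "t \<in> ?I" for t :: real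
  proof -
    have t: "0 < t" "X \<le> t * l2" "t * l1 \<le> 2 * real X"
      using that pos by (auto simp: field_simps)
    moreover have "t * l2 \<le> t * l1" using t pos by (intro mult_left_mono) auto
    ultimately show "t * l1 \<in> {X..2*real X}" "t * l2 \<in> {X..2*real X}" "0 < t" "t * l2 \<le> t * l1"
      unfolding atLeastAtMost_iff by linarith+
  qed
  \<comment> \<open>Bounding the two terms of \<open>?W\<close> separately would cost a factor l1 +
    l2. The mean value theorem for y f1(y) between t l2 and t l1 extracts the factor r = l1 - l2
    instead.\<close>
  have W: "\<bar>?W t\<bar> \<le> r * V" if t: "t \<in> ?I" for t :: real
  proof -
    have "\<exists>z>t * l2. z < t * l1 \<and> t * l1 * f1 (t * l1) - t * l2 * f1 (t * l2) =
       (t * l1 - t * l2) * (f1 z + z * f2 z)"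
    proof (intro MVT2[where f = "\<lambda>y. y * f1 y"])
      show "t * l2 < t * l1" using I[OF t] pos by (intro mult_strict_left_mono) auto
      fix x assume "t * l2 \<le> x" "x \<le> t * l1"
      then have "x \<in> {X..2*real X}" using I[OF t] by auto
      then show "((\<lambda>y. y * f1 y) has_real_derivative f1 x + x * f2 x) (at x)"
        using f12(2) by (auto intro!: derivative_eq_intros)
    qed
    then obtain z where z: "t * l2 < z" "z < t * l1"
      "t * l1 * f1 (t * l1) - t * l2 * f1 (t * l2) = (t * l1 - t * l2) * (f1 z + z * f2 z)" by blast
    have "t * ?W t = t * (r * (f1 z + z * f2 z))" using z(3) by (simp add: r_def algebra_simps)
    then have "?W t = r * (f1 z + z * f2 z)" using I(3)[OF t] by simp
    moreover have "\<bar>f1 z + z * f2 z\<bar> \<le> V" using z I[OF t] by (intro f12(3)) auto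
    ultimately show ?thesis using r by (simp add: abs_mult)
  qed
  have "norm (\<Sum>k\<in>?S. e2pi (?g (real k))) \<le> (2 * m * r * V + 2) * (3 / sqrt (m * r * X * \<kappa> / (4 * K)) + 5)"
  proof (rule vdc_second_derivative[where I = ?I])
    fix x y z assume "x \<in> ?S" "z \<in> ?S" "x \<le> y" "y \<le> z"
    then show "y \<in> ?S"
      by (auto intro: order.trans[OF _ mult_le_mono1] le_less_trans[OF mult_le_mono1])
  next
    show "is_interval ?I" by (intro is_interval_Int is_interval_cc)
  next
    fix n assume n: "n \<in> ?S"
    then have "real X \<le> real (n * l2)" "real (n * l1) \<le> real (2 * X)" using Y by (auto simp del: of_nat_mult)
    then show "real n \<in> ?I" using n pos by (auto simp: field_simps)
  next
    fix t :: real assume t: "t \<in> ?I"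
    show "(?g has_real_derivative ?g1 t) (at t)"
      by (auto intro!: derivative_eq_intros DERIV_dilate'[OF f12(1)[OF I(1)[OF t]]] DERIV_dilate'[OF f12(1)[OF I(2)[OF t]]])
    show "(?g1 has_real_derivative ?g2 t) (at t)"
      by (auto intro!: derivative_eq_intros DERIV_dilate'[OF f12(2)[OF I(1)[OF t]]] DERIV_dilate'[OF f12(2)[OF I(2)[OF t]]])
    \<comment> \<open>Multiplied by t^2, the second derivative becomes an increment of y^2 f2(y)
      between t l2 and t l1, which \<open>local_phase\<close> controls; the range of k supplies t
      \<le> 4 K.\<close>
    have "m * r * X * \<kappa> / (4 * K) \<le> m * r * X * \<kappa> / t"
      using t pos r I(3)[OF t] by (intro divide_left_mono) auto
    also have "\<dots> = (m / t\<^sup>2) * ((t * l1 - t * l2) * X * \<kappa>)"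
      using I(3)[OF t] by (simp add: r_def field_simps power2_eq_square)
    also have "\<dots> \<le> (m / t\<^sup>2) * ((t * l2)\<^sup>2 * f2 (t * l2) - (t * l1)\<^sup>2 * f2 (t * l1))"
      using f12(4)[OF I(2)[OF t] I(1)[OF t] I(4)[OF t]] by (intro mult_left_mono) auto
    also have "\<dots> = ?g2 t"
      using I(3)[OF t] by (simp add: field_simps power2_eq_square)
    finally show "m * r * X * \<kappa> / (4 * K) \<le> ?g2 t" .
  next
    fix s t :: real assume "s \<in> ?I" "t \<in> ?I"
    then have "?W s - ?W t \<le> 2 * (r * V)" using W[of s] W[of t] by linarith
    then have "real m * (?W s - ?W t) \<le> real m * (2 * (r * V))"
      by (intro mult_left_mono) auto
    then show "?g1 t - ?g1 s \<le> 2 * m * r * V"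
      by (simp add: algebra_simps)
  qed (use pos r in auto)
  then show ?thesis
    by (subst (asm) norm_sum_e2pi_minus) simp
qed

text \<open>
  Only pairs in the same block \<open>\<beta> l\<^sub>1 = \<beta> l\<^sub>2\<close> have to be correlated: the blocks do the work of a Weyl shift.
\<close>

lemma bilinear_block:
  fixes a b :: "nat \<Rightarrow> complex" and c :: "nat \<Rightarrow> nat \<Rightarrow> complex" and \<beta> :: "nat \<Rightarrow> nat"
  assumes fin: "finite Ks" "finite Ls"
    and H: "\<And>l1. l1 \<in> Ls \<Longrightarrow> (\<Sum>l2 | l2 \<in> Ls \<and> \<beta> l2 = \<beta> l1. norm (\<Sum>k\<in>Ks. c k l1 * cnj (c k l2))) \<le> H"
  shows "(norm (\<Sum>k\<in>Ks. \<Sum>l\<in>Ls. a k * b l * c k l))\<^sup>2 \<le>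
     (\<Sum>k\<in>Ks. (norm (a k))\<^sup>2) * (real (card (\<beta> ` Ls)) * ((\<Sum>l\<in>Ls. (norm (b l))\<^sup>2) * H))"
proof -
  define B where "B = (\<lambda>j. {l \<in> Ls. \<beta> l = j})"
  define s where "s = (\<lambda>k j. \<Sum>l\<in>B j. b l * c k l)"
  let ?J = "\<beta> ` Ls"
  let ?N = "\<lambda>l1 l2. norm (\<Sum>k\<in>Ks. c k l1 * cnj (c k l2))"
  have split: "(\<Sum>l\<in>Ls. b l * c k l) = (\<Sum>j\<in>?J. s k j)" for k
    unfolding s_def B_def by (rule sum.image_gen[OF fin(2)])
  have block: "(\<Sum>k\<in>Ks. (norm (s k j))\<^sup>2) \<le> (\<Sum>l\<in>B j. (norm (b l))\<^sup>2) * H" for j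
  proof -
    have Nsym: "?N l1 l2 = ?N l2 l1" for l1 l2
    proof -
      have "(\<Sum>k\<in>Ks. c k l1 * cnj (c k l2)) = cnj (\<Sum>k\<in>Ks. c k l2 * cnj (c k l1))"
        by (simp add: mult.commute)
      then show ?thesis by (metis complex_mod_cnj)
    qed
    have "complex_of_real (\<Sum>k\<in>Ks. (norm (s k j))\<^sup>2) = (\<Sum>k\<in>Ks. s k j * cnj (s k j))"
      by (simp only: of_real_sum complex_norm_square)
    also have "\<dots> = (\<Sum>k\<in>Ks. \<Sum>l1\<in>B j. \<Sum>l2\<in>B j. b l1 * cnj (b l2) * (c k l1 * cnj (c k l2)))"
      by (simp add: s_def sum_product mult_ac)
    also have "\<dots> = (\<Sum>l1\<in>B j. \<Sum>l2\<in>B j. \<Sum>k\<in>Ks. b l1 * cnj (b l2) * (c k l1 * cnj (c k l2)))"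
      unfolding sum.swap[where A = Ks] ..
    also have "\<dots> = (\<Sum>l1\<in>B j. \<Sum>l2\<in>B j. b l1 * cnj (b l2) * (\<Sum>k\<in>Ks. c k l1 * cnj (c k l2)))"
      by (simp add: sum_distrib_left)
    finally have eq: "complex_of_real (\<Sum>k\<in>Ks. (norm (s k j))\<^sup>2) =
        (\<Sum>l1\<in>B j. \<Sum>l2\<in>B j. b l1 * cnj (b l2) * (\<Sum>k\<in>Ks. c k l1 * cnj (c k l2)))" .
    have "(\<Sum>k\<in>Ks. (norm (s k j))\<^sup>2) = norm (complex_of_real (\<Sum>k\<in>Ks. (norm (s k j))\<^sup>2))"
      unfolding norm_of_real by (simp add: sum_nonneg)
    also have "\<dots> =
        norm (\<Sum>l1\<in>B j. \<Sum>l2\<in>B j. b l1 * cnj (b l2) * (\<Sum>k\<in>Ks. c k l1 * cnj (c k l2)))"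
      unfolding eq ..
    also have "\<dots> \<le> (\<Sum>l1\<in>B j. \<Sum>l2\<in>B j. norm (b l1) * norm (b l2) * ?N l1 l2)"
      by (rule order.trans[OF norm_sum], intro sum_mono, rule order.trans[OF norm_sum])
         (simp add: norm_mult)
    \<comment> \<open>Schur's test: the arithmetic-geometric mean separates b l1 from b l2, and the
      symmetry of \<open>?N\<close> makes the two halves equal, so only the row sums bounded by H
      remain.\<close>
    also have "\<dots> \<le> (\<Sum>l1\<in>B j. \<Sum>l2\<in>B j. ((norm (b l1))\<^sup>2 / 2 + (norm (b l2))\<^sup>2 / 2) * ?N l1 l2)"
    proof (intro sum_mono mult_right_mono)
      fix l1 l2
      have "2 * norm (b l1) * norm (b l2) \<le> (norm (b l1))\<^sup>2 + (norm (b l2))\<^sup>2" by (rule sum_squares_bound)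
      then show "norm (b l1) * norm (b l2) \<le> (norm (b l1))\<^sup>2 / 2 + (norm (b l2))\<^sup>2 / 2" by simp
    qed simp
    also have "\<dots> = (\<Sum>l1\<in>B j. \<Sum>l2\<in>B j. (norm (b l1))\<^sup>2 / 2 * ?N l1 l2)
        + (\<Sum>l1\<in>B j. \<Sum>l2\<in>B j. (norm (b l2))\<^sup>2 / 2 * ?N l1 l2)"
      by (simp only: distrib_right sum.distrib)
    also have "(\<Sum>l1\<in>B j. \<Sum>l2\<in>B j. (norm (b l2))\<^sup>2 / 2 * ?N l1 l2) =
        (\<Sum>l1\<in>B j. \<Sum>l2\<in>B j. (norm (b l1))\<^sup>2 / 2 * ?N l1 l2)"
      by (subst sum.swap) (simp add: Nsym)
    also have "(\<Sum>l1\<in>B j. \<Sum>l2\<in>B j. (norm (b l1))\<^sup>2 / 2 * ?N l1 l2) +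
        (\<Sum>l1\<in>B j. \<Sum>l2\<in>B j. (norm (b l1))\<^sup>2 / 2 * ?N l1 l2) =
        (\<Sum>l1\<in>B j. (norm (b l1))\<^sup>2 * (\<Sum>l2\<in>B j. ?N l1 l2))"
      by (simp add: sum.distrib[symmetric] sum_distrib_left)
    also have "\<dots> \<le> (\<Sum>l1\<in>B j. (norm (b l1))\<^sup>2 * H)"
    proof (intro sum_mono mult_left_mono)
      fix l1 assume "l1 \<in> B j"
      then show "(\<Sum>l2\<in>B j. ?N l1 l2) \<le> H" using H[of l1] by (simp add: B_def)
    qed simp
    also have "\<dots> = (\<Sum>l\<in>B j. (norm (b l))\<^sup>2) * H" by (simp add: sum_distrib_right)
    finally show ?thesis .
  qed
  \<comment> \<open>Cauchy-Schwarz enters twice: over k, which removes the coefficients a, and over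
    the blocks, which costs their number.\<close>
  have "(norm (\<Sum>k\<in>Ks. \<Sum>l\<in>Ls. a k * b l * c k l))\<^sup>2 = (norm (\<Sum>k\<in>Ks. a k * (\<Sum>j\<in>?J. s k j)))\<^sup>2"
    by (simp add: split[symmetric] sum_distrib_left mult.assoc)
  also have "\<dots> \<le> (\<Sum>k\<in>Ks. norm (a k) * norm (\<Sum>j\<in>?J. s k j))\<^sup>2"
    by (intro power_mono order.trans[OF norm_sum]) (simp_all add: norm_mult)
  also have "\<dots> \<le> (\<Sum>k\<in>Ks. (norm (a k))\<^sup>2) * (\<Sum>k\<in>Ks. (norm (\<Sum>j\<in>?J. s k j))\<^sup>2)"
    by (rule Cauchy_Schwarz_ineq_sum)
  also have "\<dots> \<le> (\<Sum>k\<in>Ks. (norm (a k))\<^sup>2) * (\<Sum>k\<in>Ks. real (card ?J) * (\<Sum>j\<in>?J. (norm (s k j))\<^sup>2))"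
  proof (intro mult_left_mono sum_mono sum_nonneg)
    fix k
    have "(norm (\<Sum>j\<in>?J. s k j))\<^sup>2 \<le> (\<Sum>j\<in>?J. 1 * norm (s k j))\<^sup>2"
      by (intro power_mono order.trans[OF norm_sum]) simp_all
    also have "\<dots> \<le> (\<Sum>j\<in>?J. 1\<^sup>2) * (\<Sum>j\<in>?J. (norm (s k j))\<^sup>2)"
      by (rule Cauchy_Schwarz_ineq_sum)
    finally show "(norm (\<Sum>j\<in>?J. s k j))\<^sup>2 \<le> real (card ?J) * (\<Sum>j\<in>?J. (norm (s k j))\<^sup>2)" by simp
  qed simp
  also have "(\<Sum>k\<in>Ks. real (card ?J) * (\<Sum>j\<in>?J. (norm (s k j))\<^sup>2)) =
      real (card ?J) * (\<Sum>j\<in>?J. \<Sum>k\<in>Ks. (norm (s k j))\<^sup>2)"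
    by (subst sum.swap) (simp add: sum_distrib_left)
  also have "(\<Sum>k\<in>Ks. (norm (a k))\<^sup>2) * (real (card ?J) * (\<Sum>j\<in>?J. \<Sum>k\<in>Ks. (norm (s k j))\<^sup>2))
      \<le> (\<Sum>k\<in>Ks. (norm (a k))\<^sup>2) * (real (card ?J) * (\<Sum>j\<in>?J. (\<Sum>l\<in>B j. (norm (b l))\<^sup>2) * H))"
    by (intro mult_left_mono sum_mono block sum_nonneg) auto
  also have "(\<Sum>j\<in>?J. (\<Sum>l\<in>B j. (norm (b l))\<^sup>2) * H) = (\<Sum>l\<in>Ls. (norm (b l))\<^sup>2) * H"
    unfolding sum_distrib_right[symmetric] B_def by (subst sum.image_gen[OF fin(2), of _ \<beta>]) simp
  finally show ?thesis .
qed

text \<open>Blocks are the classes of l div Q, so two members differ by less than Q. The diagonal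
  pair contributes at most 3 K by counting, every other pair has the cancellation of
  \<open>type2_inner\<close>, and E is that bound made uniform over the difference r and the
  frequency m \<le> M.\<close>

lemma type2_box:
  fixes X Y K L Q m M :: nat and V \<kappa> \<xi> E :: real and a b :: "nat \<Rightarrow> complex"
  assumes f: "local_phase X V \<kappa> f"
    and pos: "0 < X" "0 < K" "0 < L" "0 < Q" "Q \<le> L" "0 < m" "m \<le> M" "0 < \<kappa>" "0 \<le> V" and Y: "Y \<le> 2 * X"
  defines "c \<equiv> \<lambda>k l. if X \<le> k * l \<and> k * l < Y
      then e2pi (\<xi> * real (k * l) + real m * f (real (k * l))) else 0"
    and "E \<equiv> 12 * (sqrt (real M * real Q) * V + 1) * sqrt (K / (X * \<kappa>)) + 10 * (real M * real Q * V + 1)"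
  shows "(norm (\<Sum>k\<in>{K..<4 * K}. \<Sum>l\<in>{L..<4 * L}. a k * b l * c k l))\<^sup>2 \<le>
     (\<Sum>k\<in>{K..<4 * K}. (norm (a k))\<^sup>2) *
     (5 * L / Q * ((\<Sum>l\<in>{L..<4 * L}. (norm (b l))\<^sup>2) * (3 * K + Q * E)))"
proof -
  let ?Ks = "{K..<4 * K}" and ?Ls = "{L..<4 * L}"
  let ?\<beta> = "\<lambda>l. l div Q"
  have E0: "0 \<le> E" using pos by (simp add: E_def)
  have inner: "norm (\<Sum>k\<in>?Ks. c k l1 * cnj (c k l2)) \<le> E"
    if l: "l1 \<in> ?Ls" "l2 \<in> ?Ls" "?\<beta> l2 = ?\<beta> l1" "l2 < l1" for l1 l2
  proof -
    define r where "r = real l1 - real l2"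
    have "l1 < l2 + Q"
    proof -
      have "l1 = l1 div Q * Q + l1 mod Q" by simp
      also have "\<dots> < l1 div Q * Q + Q" by (intro add_strict_left_mono mod_less_divisor pos)
      also have "l1 div Q * Q = l2 div Q * Q" using l(3) by simp
      also have "l2 div Q * Q + Q \<le> l2 + Q" by simp
      finally show ?thesis .
    qed
    then have r: "1 \<le> r" "r \<le> Q" using l by (auto simp: r_def)
    have "(\<Sum>k\<in>?Ks. c k l1 * cnj (c k l2)) = (\<Sum>k | k \<in> ?Ks \<and> X \<le> k * l2 \<and> k * l1 < Y.
        e2pi ((\<xi> * real (k * l1) + real m * f (real (k * l1))) - (\<xi> * real (k * l2) + real m * f (real (k * l2)))))"
    proof (rule sum.mono_neutral_cong_right)
      have *: "k * l2 \<le> k * l1" for k using l by simp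
      show "\<forall>i\<in>?Ks - {k \<in> ?Ks. X \<le> k * l2 \<and> k * l1 < Y}. c i l1 * cnj (c i l2) = 0"
        using * by (auto simp: c_def)
      fix k assume "k \<in> {k \<in> ?Ks. X \<le> k * l2 \<and> k * l1 < Y}"
      then have "X \<le> k * l1 \<and> k * l1 < Y" "X \<le> k * l2 \<and> k * l2 < Y"
        using *[of k] unfolding mem_Collect_eq by linarith+
      then show "c k l1 * cnj (c k l2) = e2pi ((\<xi> * real (k * l1) + real m * f (real (k * l1))) - (\<xi> * real (k * l2) + real m * f (real (k * l2))))"
        unfolding c_def e2pi_diff by simp
    qed auto
    also have "norm \<dots> \<le> (2 * m * r * V + 2) * (3 / sqrt (m * r * X * \<kappa> / (4 * K)) + 5)"
      unfolding r_def using l pos by (intro type2_inner[OF f]) (use Y in auto)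
    also have "\<dots> \<le> E"
    proof -
      define w where "w = sqrt (K / (X * \<kappa>))"
      define u where "u = sqrt (m * r)"
      have u1: "1 \<le> u" using pos r by (auto simp: u_def intro!: mult_ge1_I)
      have mr: "real m * r \<le> real M * real Q" using pos r by (intro mult_mono) auto
      then have uM: "u \<le> sqrt (real M * real Q)" by (simp add: u_def)
      have u2: "real m * r = u * u" using r by (simp add: u_def)
      have w0: "0 \<le> w" using pos by (simp add: w_def)
      have "3 / sqrt (m * r * X * \<kappa> / (4 * K)) = 6 * w / u"
      proof -
        have "sqrt (m * r * X * \<kappa> / (4 * K)) = u * sqrt (X * \<kappa> / K) / 2"
          using pos r by (simp add: u_def real_sqrt_mult real_sqrt_divide)
        moreover have "sqrt (X * \<kappa> / K) = 1 / w"
          by (simp add: w_def real_sqrt_divide)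
        ultimately show ?thesis by simp
      qed
      then have "(2 * m * r * V + 2) * (3 / sqrt (m * r * X * \<kappa> / (4 * K)) + 5)
          = (2 * (m * r) * V + 2) * (6 * w / u + 5)" by (simp add: mult.assoc)
      also have "\<dots> = 12 * u * V * w + 12 * w / u + 10 * (u * u) * V + 10"
        unfolding u2 using u1 by (simp add: field_simps)
      also have "\<dots> \<le> 12 * sqrt (real M * real Q) * V * w + 12 * w + 10 * (real M * real Q) * V + 10"
        using u1 uM w0 mr u2 pos
        by (intro add_mono mult_right_mono mult_left_mono) (auto simp: divide_le_eq mult_le_cancel_left1)
      also have "\<dots> = E" by (simp add: E_def w_def algebra_simps)
      finally show ?thesis .
    qed
    finally show ?thesis .
  qed
  have sym: "norm (\<Sum>k\<in>?Ks. c k l1 * cnj (c k l2)) = norm (\<Sum>k\<in>?Ks. c k l2 * cnj (c k l1))" for l1 l2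
  proof -
    have "(\<Sum>k\<in>?Ks. c k l1 * cnj (c k l2)) = cnj (\<Sum>k\<in>?Ks. c k l2 * cnj (c k l1))"
      by (simp add: mult.commute)
    then show ?thesis by (metis complex_mod_cnj)
  qed
  have H: "(\<Sum>l2 | l2 \<in> ?Ls \<and> ?\<beta> l2 = ?\<beta> l1. norm (\<Sum>k\<in>?Ks. c k l1 * cnj (c k l2))) \<le> 3 * K + Q * E"
    if l1: "l1 \<in> ?Ls" for l1
  proof -
    let ?B = "{l2. l2 \<in> ?Ls \<and> ?\<beta> l2 = ?\<beta> l1}"
    have B: "?B = insert l1 (?B - {l1})" using l1 by auto
    have "(\<Sum>l2\<in>?B. norm (\<Sum>k\<in>?Ks. c k l1 * cnj (c k l2))) =
       norm (\<Sum>k\<in>?Ks. c k l1 * cnj (c k l1)) + (\<Sum>l2\<in>?B - {l1}. norm (\<Sum>k\<in>?Ks. c k l1 * cnj (c k l2)))"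
      by (subst B) (subst sum.insert, auto)
    also have "norm (\<Sum>k\<in>?Ks. c k l1 * cnj (c k l1)) \<le> (\<Sum>k\<in>?Ks. 1)"
      by (rule sum_norm_le) (simp add: c_def norm_mult)
    also have "\<dots> = 3 * real K" by simp
    also have "(\<Sum>l2\<in>?B - {l1}. norm (\<Sum>k\<in>?Ks. c k l1 * cnj (c k l2))) \<le> (\<Sum>l2\<in>?B - {l1}. E)"
    proof (rule sum_mono)
      fix l2 assume l2: "l2 \<in> ?B - {l1}"
      then consider "l2 < l1" | "l1 < l2" by force
      then show "norm (\<Sum>k\<in>?Ks. c k l1 * cnj (c k l2)) \<le> E"
      proof cases
        case 1
        then show ?thesis using inner[of l1 l2] l1 l2 by auto
      next
        case 2
        then show ?thesis using inner[of l2 l1] l1 l2 by (subst sym) auto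
      qed
    qed
    also have "\<dots> \<le> Q * E"
    proof -
      have "?B \<subseteq> {l1 div Q * Q..<l1 div Q * Q + Q}"
      proof
        fix l assume "l \<in> ?B"
        then have "l = l1 div Q * Q + l mod Q" using div_mult_mod_eq[of l Q] by simp
        moreover have "l mod Q < Q" using pos by simp
        ultimately show "l \<in> {l1 div Q * Q..<l1 div Q * Q + Q}"
          by (metis atLeastLessThan_iff le_add1 nat_add_left_cancel_less)
      qed
      then have "card ?B \<le> card {l1 div Q * Q..<l1 div Q * Q + Q}" by (intro card_mono) auto
      moreover have "card (?B - {l1}) \<le> card ?B" by (intro card_mono) auto
      ultimately have "card (?B - {l1}) \<le> Q" by simp
      then have "real (card (?B - {l1})) * E \<le> Q * E" using E0 by (intro mult_right_mono) auto
      then show ?thesis by simp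
    qed
    finally show ?thesis by simp
  qed
  \<comment> \<open>At most 3 L / Q + 2 blocks meet [L, 4 L), and Q \<le> L absorbs the 2.\<close>
  have card: "real (card (?\<beta> ` ?Ls)) \<le> 5 * L / Q"
  proof -
    have "?\<beta> ` ?Ls \<subseteq> {L div Q..4 * L div Q}" by (auto intro!: div_le_mono)
    then have "card (?\<beta> ` ?Ls) \<le> card {L div Q..4 * L div Q}" by (intro card_mono) auto
    then have "card (?\<beta> ` ?Ls) \<le> Suc (4 * L div Q) - L div Q" by simp
    moreover have "L div Q \<le> 4 * L div Q" by (intro div_le_mono) simp
    ultimately have "real (card (?\<beta> ` ?Ls)) \<le> real (4 * L div Q) + 1 - real (L div Q)" by linarith
    moreover have "real (4 * L div Q) \<le> 4 * L / Q" using of_nat_div_le_of_nat[of "4 * L" Q] by simp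
    moreover have "real (L div Q) \<ge> L / Q - 1"
    proof -
      have "real L = real (L div Q) * Q + real (L mod Q)"
        by (metis div_mult_mod_eq of_nat_add of_nat_mult)
      moreover have "real (L mod Q) \<le> Q" using pos by simp
      ultimately have "real L \<le> (real (L div Q) + 1) * Q" by (simp add: algebra_simps)
      then show ?thesis using pos by (simp add: field_simps)
    qed
    ultimately have "real (card (?\<beta> ` ?Ls)) \<le> 4 * L / Q + 1 - (L / Q - 1)" by linarith
    also have "\<dots> \<le> 5 * L / Q" using pos by (simp add: field_simps)
    finally show ?thesis .
  qed
  have "(norm (\<Sum>k\<in>?Ks. \<Sum>l\<in>?Ls. a k * b l * c k l))\<^sup>2 \<le>
     (\<Sum>k\<in>?Ks. (norm (a k))\<^sup>2) *
     (real (card (?\<beta> ` ?Ls)) * ((\<Sum>l\<in>?Ls. (norm (b l))\<^sup>2) * (3 * K + Q * E)))"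
    by (rule bilinear_block[OF _ _ H]) auto
  also have "\<dots> \<le> (\<Sum>k\<in>?Ks. (norm (a k))\<^sup>2) *
     (5 * L / Q * ((\<Sum>l\<in>?Ls. (norm (b l))\<^sup>2) * (3 * K + Q * E)))"
    using E0 by (intro mult_left_mono mult_right_mono card mult_nonneg_nonneg sum_nonneg) auto
  finally show ?thesis .
qed

text \<open>Summation by parts: the increments of a monotone \<open>g\<close> with values in [0, G]
  add up to at most G, and the last value contributes another G. It serves for the weights ln l and
  1/\<phi>'.\<close>

lemma abel_bound:
  fixes g :: "nat \<Rightarrow> real" and z :: "nat \<Rightarrow> complex"
  assumes g: "\<And>i. a \<le> i \<Longrightarrow> i < b \<Longrightarrow> 0 \<le> g i \<and> g i \<le> G"
    and mono: "\<And>i. a \<le> i \<Longrightarrow> Suc i < b \<Longrightarrow> g i \<le> g (Suc i)"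
    and B: "\<And>n. a < n \<Longrightarrow> n \<le> b \<Longrightarrow> norm (\<Sum>i\<in>{a..<n}. z i) \<le> B"
    and G0: "0 \<le> G" and B0: "0 \<le> B"
  shows "norm (\<Sum>i\<in>{a..<b}. of_real (g i) * z i) \<le> 2 * G * B"
proof (cases "a < b")
  case False
  then show ?thesis using G0 B0 by simp
next
  case ab: True
  define Z where "Z = (\<lambda>n. \<Sum>i\<in>{a..<n}. z i)"
  have step: "norm ((\<Sum>i\<in>{a..<Suc (a + k)}. of_real (g i) * z i) - of_real (g (a + k)) * Z (Suc (a + k)))
      \<le> (g (a + k) - g a) * B" if "a + k < b" for k
    using that
  proof (induction k)
    case 0
    then show ?case by (simp add: Z_def)
  next
    case (Suc k)
    let ?n = "Suc (a + k)"
    let ?S = "\<Sum>i\<in>{a..<?n}. of_real (g i) * z i"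
    have ZS: "Z (Suc ?n) = Z ?n + z ?n" by (simp add: Z_def)
    have d: "g (a + k) \<le> g ?n" using mono[of "a + k"] Suc.prems by simp
    have "(\<Sum>i\<in>{a..<Suc (a + Suc k)}. of_real (g i) * z i) - of_real (g (a + Suc k)) * Z (Suc (a + Suc k))
       = (?S - of_real (g (a + k)) * Z ?n) - of_real (g ?n - g (a + k)) * Z ?n"
      by (simp add: ZS algebra_simps)
    also have "norm \<dots> \<le> norm (?S - of_real (g (a + k)) * Z ?n) + norm (of_real (g ?n - g (a + k)) * Z ?n)"
      by (rule norm_triangle_ineq4)
    also have "norm (of_real (g ?n - g (a + k)) * Z ?n) \<le> (g ?n - g (a + k)) * B"
      unfolding norm_mult norm_of_real using d B[of ?n] Suc.prems by (auto simp: Z_def intro!: mult_left_mono)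
    also have "norm (?S - of_real (g (a + k)) * Z ?n) \<le> (g (a + k) - g a) * B"
      using Suc by simp
    finally show ?case by (simp add: algebra_simps)
  qed
  define k where "k = b - 1 - a"
  have k: "a + k < b" "Suc (a + k) = b" using ab by (auto simp: k_def)
  let ?S = "\<Sum>i\<in>{a..<b}. of_real (g i) * z i"
  have "norm ?S \<le> norm (?S - of_real (g (a + k)) * Z b) + norm (of_real (g (a + k)) * Z b)"
    by (metis add.commute norm_triangle_sub)
  also have "\<dots> \<le> (g (a + k) - g a) * B + g (a + k) * B"
  proof (rule add_mono)
    show "norm (?S - of_real (g (a + k)) * Z b) \<le> (g (a + k) - g a) * B"
      using step[OF k(1)] by (simp only: k(2))
    show "norm (of_real (g (a + k)) * Z b) \<le> g (a + k) * B"
      unfolding norm_mult norm_of_real Z_def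
      using g[of "a + k"] k(1) B[OF ab order.refl] by (intro mult_mono) simp_all
  qed
  also have "\<dots> \<le> G * B + G * B"
  proof (intro add_mono mult_right_mono B0)
    show "g (a + k) \<le> G" using g[of "a + k"] k(1) by simp
    then show "g (a + k) - g a \<le> G" using g[of a] ab by simp
  qed
  finally show ?thesis by (simp add: mult_ac)
qed

lemma sum_dyadic:
  fixes F :: "nat \<Rightarrow> 'a :: comm_monoid_add"
  shows "(\<Sum>d\<in>{1..<2 ^ J}. F d) = (\<Sum>i<J. \<Sum>d\<in>{2 ^ i..<2 ^ Suc i}. F d)"
proof (induction J)
  case (Suc J)
  have "(\<Sum>d\<in>{1..<2 ^ Suc J}. F d) = (\<Sum>d\<in>{1..<2 ^ J}. F d) + (\<Sum>d\<in>{2 ^ J..<2 ^ Suc J}. F d)"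
    by (rule sum.atLeastLessThan_concat[symmetric]) auto
  then show ?case using Suc by simp
qed simp

section \<open>Vaughan's identity on one dyadic block\<close>

definition log_size :: "nat \<Rightarrow> real" where
  "log_size X = 1 + ln (4 * real X)"

text \<open>The bound of \<open>type1_inner\<close>, made uniform over frequencies m \<le> M and
  outer variables from 1 to U^2.\<close>

definition type1_const :: "nat \<Rightarrow> nat \<Rightarrow> real \<Rightarrow> real \<Rightarrow> real" where
  "type1_const M U V \<kappa> = 6 * (sqrt (real M) * V + 1) / sqrt \<kappa> + 10 * (real M * (real U)\<^sup>2 * V + 1)"

text \<open>Bounds E / K for the E of \<open>type2_box\<close> when k is the longer variable, so
  that \<open>sqrt X\<close> \<le> 2 K. It measures the off-diagonal pairs against the trivial
  bound.\<close>

definition type2_ratio :: "nat \<Rightarrow> nat \<Rightarrow> nat \<Rightarrow> real \<Rightarrow> real \<Rightarrow> real" where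
  "type2_ratio X M Q V \<kappa> = 24 * (sqrt (real M * real Q) * V + 1) / (real X powr (3/4) * sqrt \<kappa>)
     + 20 * (real M * real Q * V + 1) / sqrt X"

text \<open>Cauchy-Schwarz produces the square root. Inside, 2 / Q is the share of the diagonal and
  the other summand that of the remaining pairs. Of the five logarithms, three come from the divisor
  function and two from the von Mangoldt function.\<close>

definition type2_const :: "nat \<Rightarrow> nat \<Rightarrow> nat \<Rightarrow> real \<Rightarrow> real \<Rightarrow> real" where
  "type2_const X M Q V \<kappa> = X * sqrt (40 * log_size X ^ 5 * (2 / Q + type2_ratio X M Q V \<kappa>))"

context
  fixes X Y m M U Q x :: nat and V \<kappa> \<xi> :: real and f :: "real \<Rightarrow> real"
  assumes f: "local_phase X V \<kappa> f" and X: "X = 2 ^ x" and Y: "Y \<le> 2 * X"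
    and m: "0 < m" "m \<le> M" and \<kappa>: "0 < \<kappa>" and V: "0 \<le> V" and Q: "0 < Q" "4 * Q \<le> U" and U: "U < X"
begin

private abbreviation (input) "LL \<equiv> log_size X"
private abbreviation (input) "B1 \<equiv> type1_const M U V \<kappa>"
private abbreviation (input) "G2 \<equiv> type2_ratio X M Q V \<kappa>"
private abbreviation (input) "B2 \<equiv> type2_const X M Q V \<kappa>"
private abbreviation (input) "e \<equiv> \<lambda>n::nat. e2pi (\<xi> * real n + real m * f (real n))"

private lemma X1: "1 \<le> X" using X by simp

lemma log_size_ge_1: "1 \<le> LL" unfolding log_size_def using X1 by simp

private lemma ln_le_LL: "0 < n \<Longrightarrow> n \<le> 4 * X \<Longrightarrow> ln (real n) \<le> LL"
proof -
  assume n: "0 < n" "n \<le> 4 * X"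
  then have "real n \<le> real (4 * X)" by (simp only: of_nat_le_iff)
  then have "ln (real n) \<le> ln (4 * real X)" using n by simp
  then show "ln (real n) \<le> LL" by (simp add: log_size_def)
qed

lemma type1_const_nonneg: "0 \<le> B1" unfolding type1_const_def using V \<kappa> by simp

text \<open>The upper end Z is free because partial summation needs every initial piece of the
  sum.\<close>

lemma type1_bound:
  assumes d: "0 < d" "d \<le> U\<^sup>2" and Z: "Z \<le> 2 * X"
  shows "norm (\<Sum>l | X \<le> d * l \<and> d * l < Z. e (d * l)) \<le> B1"
proof -
  have "norm (\<Sum>l | X \<le> d * l \<and> d * l < Z. e (d * l)) \<le> (2 * m * d * V + 2) * (3 / (d * sqrt (m * \<kappa>)) + 5)"
    using type1_inner[OF f, of d m Z \<xi>] X1 d m \<kappa> V Z by simp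
  also have "\<dots> = 6 * (sqrt m * V) / sqrt \<kappa> + 6 / (d * sqrt m * sqrt \<kappa>) + 10 * (real m * real d * V) + 10"
  proof -
    have 1: "real m = sqrt m * sqrt m" by simp
    have s: "0 < sqrt (real m)" "0 < sqrt \<kappa>" using m \<kappa> by auto
    have "(2 * m * d * V + 2) * (3 / (d * sqrt (m * \<kappa>)) + 5) =
       6 * (real m / sqrt m) * V / sqrt \<kappa> + 6 / (d * sqrt m * sqrt \<kappa>) + 10 * (real m * real d * V) + 10"
      using d s by (simp add: real_sqrt_mult field_simps)
    also have "real m / sqrt m = sqrt m" by (simp add: real_div_sqrt)
    finally show ?thesis by simp
  qed
  also have "\<dots> \<le> 6 * (sqrt M * V) / sqrt \<kappa> + 6 / (1 * 1 * sqrt \<kappa>) + 10 * (M * (real U)\<^sup>2 * V) + 10"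
  proof (intro add_mono order.refl)
    have "real d \<le> real (U\<^sup>2)" using d by (simp only: of_nat_le_iff)
    then have dU: "real d \<le> (real U)\<^sup>2" by simp
    show "6 * (sqrt m * V) / sqrt \<kappa> \<le> 6 * (sqrt M * V) / sqrt \<kappa>"
      using m \<kappa> V by (intro divide_right_mono mult_left_mono mult_right_mono) auto
    have "1 * 1 * sqrt \<kappa> \<le> d * sqrt m * sqrt \<kappa>"
      using m d \<kappa> by (intro mult_mono mult_right_mono) auto
    then show "6 / (d * sqrt m * sqrt \<kappa>) \<le> 6 / (1 * 1 * sqrt \<kappa>)"
      using m d \<kappa> by (intro divide_left_mono) auto
    have "real m * real d * V \<le> real M * (real U)\<^sup>2 * V"
      using m dU V by (intro mult_mono mult_right_mono) auto
    then show "10 * (real m * real d * V) \<le> 10 * (real M * (real U)\<^sup>2 * V)" by simp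
  qed
  also have "\<dots> = B1" unfolding type1_const_def using \<kappa> by (simp add: field_simps)
  finally show ?thesis .
qed

lemma type1_log_bound:
  assumes d: "0 < d" "d \<le> U\<^sup>2"
  shows "norm (\<Sum>l | X \<le> d * l \<and> d * l < Y. of_real (ln (real l)) * e (d * l)) \<le> 2 * LL * B1"
proof -
  let ?S = "{l. X \<le> d * l \<and> d * l < Y}"
  have "finite ?S"
    by (rule finite_subset[of _ "{..<Y}"]) (use d in \<open>auto intro: le_less_trans[rotated]\<close>)
  then have "\<exists>p q. ?S = {p..<q}"
  proof (rule convex_nat_set)
    fix x' y z assume "x' \<in> ?S" "z \<in> ?S" "x' \<le> y" "y \<le> z"
    then show "y \<in> ?S" using convex_nat_dilate[of X d x' z Y y] by simp
  qed
  then obtain p q where pq: "?S = {p..<q}" by blast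
  have l: "1 \<le> i \<and> i \<le> 4 * X" if "p \<le> i" "i < q" for i
  proof -
    have "i \<in> ?S" unfolding pq using that by simp
    then have i: "X \<le> d * i" "d * i < Y" by simp_all
    then have "0 < i" using X1 by (auto intro: Nat.gr0I)
    moreover have "i \<le> d * i" using d by simp
    ultimately show ?thesis using i Y by linarith
  qed
  have "norm (\<Sum>l\<in>{p..<q}. of_real (ln (real l)) * e (d * l)) \<le> 2 * LL * B1"
  proof (rule abel_bound)
    fix i assume "p \<le> i" "i < q"
    then show "0 \<le> ln (real i) \<and> ln (real i) \<le> LL" using l[of i] ln_le_LL[of i] by auto
  next
    fix i assume "p \<le> i" "Suc i < q"
    then show "ln (real i) \<le> ln (real (Suc i))" using l[of i] by auto
  next
    fix n assume n: "p < n" "n \<le> q"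
    \<comment> \<open>Cutting at n in l is cutting at d n in d l, so an initial piece is again a sum
      covered by \<open>type1_bound\<close>.\<close>
    have "{p..<n} = {l. X \<le> d * l \<and> d * l < min Y (d * n)}"
    proof (rule Set.set_eqI)
      fix i
      have "i \<in> {p..<n} \<longleftrightarrow> i \<in> {p..<q} \<and> i < n" using n by auto
      also have "\<dots> \<longleftrightarrow> i \<in> ?S \<and> i < n" by (simp only: pq)
      also have "\<dots> \<longleftrightarrow> i \<in> {l. X \<le> d * l \<and> d * l < min Y (d * n)}" using d by auto
      finally show "i \<in> {p..<n} \<longleftrightarrow> i \<in> {l. X \<le> d * l \<and> d * l < min Y (d * n)}" .
    qed
    then show "norm (\<Sum>i\<in>{p..<n}. e (d * i)) \<le> B1"
      using type1_bound[OF d, of "min Y (d * n)"] Y by simp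
  qed (use log_size_ge_1 type1_const_nonneg in auto)
  then show ?thesis by (simp only: pq)
qed

lemma type2_ratio_nonneg: "0 \<le> G2" unfolding type2_ratio_def using V \<kappa> by simp

lemma type2_const_nonneg: "0 \<le> B2" unfolding type2_const_def using type2_ratio_nonneg log_size_ge_1 by simp

text \<open>X = 2 K L with L \<le> K makes K at least of order \<open>sqrt X\<close>, so the
  variable in which cancellation is sought is long. A condition on the product of A and B, not on
  each of them, lets either coefficient sequence of Vaughan's identity play the role of a.\<close>

lemma box_bound:
  fixes a b :: "nat \<Rightarrow> complex"
  assumes KL: "X = 2 * K * L" "L \<le> K" "Q \<le> L"
    and a: "(\<Sum>k\<in>{K..<4 * K}. (norm (a k))\<^sup>2) \<le> A" and b: "(\<Sum>l\<in>{L..<4 * L}. (norm (b l))\<^sup>2) \<le> B"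
    and AB: "0 \<le> A" "0 \<le> B" "A * B \<le> 16 * K * L * LL ^ 5"
  shows "norm (\<Sum>k\<in>{K..<4 * K}. \<Sum>l\<in>{L..<4 * L}. a k * b l * (if X \<le> k * l \<and> k * l < Y then e (k * l) else 0)) \<le> B2"
proof -
  define E where "E = 12 * (sqrt (real M * real Q) * V + 1) * sqrt (K / (X * \<kappa>)) + 10 * (real M * real Q * V + 1)"
  have K0: "0 < K" and L0: "0 < L" using KL X1 by (auto intro: Nat.gr0I)
  have E0: "0 \<le> E" using V \<kappa> by (simp add: E_def)
  have EK: "E / K \<le> G2"
  proof -
    have "real X = 2 * real K * real L" using KL by simp
    also have "\<dots> \<le> 2 * real K * real K" using KL by (intro mult_left_mono) auto
    finally have "real X \<le> 2 * (real K)\<^sup>2" by (simp add: power2_eq_square)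
    then have "real X \<le> (2 * real K)\<^sup>2" by (simp add: power_mult_distrib)
    then have K1: "sqrt X \<le> 2 * real K" by (rule real_le_lsqrt[rotated]) auto
    have X34: "real X powr (3/4) = sqrt X * sqrt (sqrt X)"
    proof -
      have "real X powr (3/4) = real X powr (1/2) * (real X powr (1/2)) powr (1/2)"
        using X1 by (simp add: powr_powr flip: powr_add)
      then show ?thesis using X1 by (simp add: powr_half_sqrt)
    qed
    have K2: "sqrt (sqrt X) \<le> 2 * sqrt K"
    proof -
      have "sqrt (sqrt X) \<le> sqrt (4 * real K)" using K1 K0 by (intro real_sqrt_le_mono) linarith
      then show ?thesis by (simp add: real_sqrt_mult)
    qed
    have "sqrt (K / (X * \<kappa>)) / K = 1 / (sqrt X * sqrt K * sqrt \<kappa>)"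
    proof -
      have "sqrt (K / (X * \<kappa>)) / K = (sqrt K / K) / (sqrt X * sqrt \<kappa>)"
        by (simp add: real_sqrt_divide real_sqrt_mult)
      then show ?thesis by (simp add: sqrt_divide_self_eq field_simps)
    qed
    also have "\<dots> \<le> 2 / (sqrt X * sqrt (sqrt X) * sqrt \<kappa>)"
    proof -
      have "sqrt X * sqrt (sqrt X) * sqrt \<kappa> \<le> sqrt X * (2 * sqrt K) * sqrt \<kappa>"
        using K2 \<kappa> by (intro mult_right_mono mult_left_mono) auto
      then show ?thesis using X1 K0 \<kappa> by (simp add: field_simps)
    qed
    finally have 1: "sqrt (K / (X * \<kappa>)) / K \<le> 2 / (real X powr (3/4) * sqrt \<kappa>)" by (simp add: X34)
    have 2: "1 / real K \<le> 2 / sqrt X" using K1 K0 X1 by (simp add: field_simps)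
    have "E / K = 12 * (sqrt (real M * real Q) * V + 1) * (sqrt (K / (X * \<kappa>)) / K)
        + 10 * (real M * real Q * V + 1) * (1 / K)"
      by (simp add: E_def add_divide_distrib)
    also have "\<dots> \<le> 12 * (sqrt (real M * real Q) * V + 1) * (2 / (real X powr (3/4) * sqrt \<kappa>))
        + 10 * (real M * real Q * V + 1) * (2 / sqrt X)"
      using V by (intro add_mono mult_left_mono 1 2) auto
    also have "\<dots> = G2" by (simp add: type2_ratio_def)
    finally show ?thesis .
  qed
  let ?S = "\<Sum>k\<in>{K..<4 * K}. \<Sum>l\<in>{L..<4 * L}. a k * b l * (if X \<le> k * l \<and> k * l < Y then e (k * l) else 0)"
  have "(norm ?S)\<^sup>2 \<le> (\<Sum>k\<in>{K..<4 * K}. (norm (a k))\<^sup>2) *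
     (5 * L / Q * ((\<Sum>l\<in>{L..<4 * L}. (norm (b l))\<^sup>2) * (3 * K + Q * E)))"
    unfolding E_def using X1 K0 L0 Q KL m \<kappa> V Y by (intro type2_box[OF f]) auto
  also have "\<dots> \<le> A * (5 * L / Q * (B * (3 * K + Q * E)))"
  proof (rule mult_mono[OF a])
    have "0 \<le> 3 * K + Q * E" using E0 by simp
    then have "(\<Sum>l\<in>{L..<4 * L}. (norm (b l))\<^sup>2) * (3 * K + Q * E) \<le> B * (3 * K + Q * E)"
      by (rule mult_right_mono[OF b])
    then show "5 * L / Q * ((\<Sum>l\<in>{L..<4 * L}. (norm (b l))\<^sup>2) * (3 * K + Q * E)) \<le> 5 * L / Q * (B * (3 * K + Q * E))"
      by (intro mult_left_mono) auto
    show "0 \<le> 5 * L / Q * ((\<Sum>l\<in>{L..<4 * L}. (norm (b l))\<^sup>2) * (3 * K + Q * E))"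
      using E0 by (intro mult_nonneg_nonneg sum_nonneg) auto
  qed (use AB in simp)
  also have "\<dots> = (A * B) * (5 * L / Q * (3 * K + Q * E))" by simp
  also have "\<dots> \<le> (16 * K * L * LL ^ 5) * (5 * L / Q * (3 * K + Q * E))"
    using AB E0 by (intro mult_right_mono) auto
  also have "\<dots> = 40 * LL ^ 5 * ((2 * real K * real L) * (2 * real K * real L)) * (3 / (2 * real Q) + (E / K) / 2)"
    using Q K0 by (simp add: field_simps)
  also have "(2 * real K * real L) * (2 * real K * real L) = (real X)\<^sup>2" using KL by (simp add: power2_eq_square)
  also have "40 * LL ^ 5 * (real X)\<^sup>2 * (3 / (2 * real Q) + (E / K) / 2) \<le> 40 * LL ^ 5 * (real X)\<^sup>2 * (2 / Q + G2)"
  proof (intro mult_left_mono add_mono)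
    show "3 / (2 * real Q) \<le> 2 / real Q" using Q by (simp add: field_simps)
    show "E / K / 2 \<le> G2" using EK type2_ratio_nonneg by simp
  qed (use log_size_ge_1 in auto)
  also have "\<dots> = B2\<^sup>2"
    using log_size_ge_1 type2_ratio_nonneg by (simp add: type2_const_def power_mult_distrib)
  finally show ?thesis by (rule power2_le_imp_le) (rule type2_const_nonneg)
qed

text \<open>Vaughan's identity leaves two type I sums, whose outer variable is at most U^2, and one
  type II sum. The latter is cut into dyadic boxes, whose number is logarithmic in X.\<close>

lemma mangoldt_exp_sum:
  "norm (\<Sum>n\<in>{X..<Y}. mangoldt n * e n) \<le> 3 * LL * (real U)\<^sup>2 * B1 + 2 * LL * B2"
proof -
  define m1 where "m1 = (\<lambda>d. if d \<le> U then moebius d else 0)"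
  define m2 where "m2 = (\<lambda>d. if d \<le> U then 0 else moebius d)"
  define L1 where "L1 = (\<lambda>d. if d \<le> U then mangoldt d else 0 :: real)"
  define L2 where "L2 = (\<lambda>d. if d \<le> U then 0 else mangoldt d :: real)"
  define cc where "cc = dconv m1 L1"
  define aa where "aa = dconv m2 (\<lambda>_. 1)"
  let ?D = "\<lambda>d. {l. X \<le> d * l \<and> d * l < Y}"
  have cc0: "cc d = 0" if "U\<^sup>2 < d" for d
  proof -
    have "m1 t * L1 (d div t) = 0" if "t dvd d" for t
    proof (rule ccontr)
      assume "m1 t * L1 (d div t) \<noteq> 0"
      then have "t \<le> U" "d div t \<le> U" by (auto simp: m1_def L1_def split: if_splits)
      then have "t * (d div t) \<le> U * U" by (intro mult_le_mono)
      then show False using that \<open>U\<^sup>2 < d\<close> by (simp add: power2_eq_square)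
    qed
    then show ?thesis unfolding cc_def dconv_def by (intro sum.neutral) blast
  qed
  have cc_le: "\<bar>cc d\<bar> \<le> ln (real d)" if d: "0 < d" for d
  proof -
    have "\<bar>cc d\<bar> \<le> (\<Sum>t | t dvd d. \<bar>m1 t * L1 (d div t)\<bar>)"
      unfolding cc_def dconv_def by (rule sum_abs)
    also have "\<dots> \<le> (\<Sum>t | t dvd d. 1 * mangoldt (d div t))"
      by (intro sum_mono) (auto simp: m1_def L1_def abs_mult mangoldt_nonneg intro!: mult_left_le_one_le abs_moebius_le)
    also have "\<dots> = dconv (\<lambda>_. 1) mangoldt d" by (simp add: dconv_def)
    also have "\<dots> = ln (real d)"
      using dconv_commute[OF d] dconv_mangoldt_one[OF d] by simp
    finally show ?thesis .
  qed
  have aa0: "aa d = 0" if "d \<le> U" "0 < d" for d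
    unfolding aa_def dconv_def using that
    by (intro sum.neutral) (auto simp: m2_def dest!: dvd_imp_le)
  have aa_le: "\<bar>aa d\<bar> \<le> real (divisor_count d)" for d
  proof -
    have "\<bar>aa d\<bar> \<le> (\<Sum>t | t dvd d. \<bar>m2 t * 1\<bar>)"
      unfolding aa_def dconv_def by (rule sum_abs)
    also have "\<dots> \<le> (\<Sum>t | t dvd d. 1)"
      by (intro sum_mono) (auto simp: m2_def abs_moebius_le)
    finally show ?thesis by simp
  qed
  have "(\<Sum>n\<in>{X..<Y}. mangoldt n * e n) =
     (\<Sum>n\<in>{X..<Y}. of_real (dconv m1 (\<lambda>d. ln (real d)) n - dconv cc (\<lambda>_. 1) n + dconv aa L2 n) * e n)"
  proof (intro sum.cong refl arg_cong2[where f = "(*)"])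
    fix n assume n: "n \<in> {X..<Y}"
    then have "dconv m1 (\<lambda>d. ln (real d)) n - dconv cc (\<lambda>_. 1) n + dconv aa L2 n = L2 n"
      using vaughan_identity[of n U] U unfolding m1_def m2_def L1_def L2_def cc_def aa_def by simp
    also have "\<dots> = mangoldt n" using n U by (simp add: L2_def)
    finally show "(mangoldt n :: complex) = of_real (dconv m1 (\<lambda>d. ln (real d)) n - dconv cc (\<lambda>_. 1) n + dconv aa L2 n)"
      by simp
  qed
  also have "\<dots> = (\<Sum>n\<in>{X..<Y}. of_real (dconv m1 (\<lambda>d. ln (real d)) n) * e n)
      - (\<Sum>n\<in>{X..<Y}. of_real (dconv cc (\<lambda>_. 1) n) * e n) + (\<Sum>n\<in>{X..<Y}. of_real (dconv aa L2 n) * e n)"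
    by (simp only: of_real_add of_real_diff distrib_right left_diff_distrib sum.distrib sum_subtractf)
  finally have split: "(\<Sum>n\<in>{X..<Y}. mangoldt n * e n) = (\<Sum>n\<in>{X..<Y}. of_real (dconv m1 (\<lambda>d. ln (real d)) n) * e n)
      - (\<Sum>n\<in>{X..<Y}. of_real (dconv cc (\<lambda>_. 1) n) * e n) + (\<Sum>n\<in>{X..<Y}. of_real (dconv aa L2 n) * e n)" .
  have swap: "(\<Sum>n\<in>{X..<Y}. of_real (dconv \<alpha> \<beta> n) * e n) =
      (\<Sum>d\<in>{1..<Y}. \<Sum>l\<in>?D d. of_real (\<alpha> d) * of_real (\<beta> l) * e (d * l))" for \<alpha> \<beta> :: "nat \<Rightarrow> real"
  proof -
    have "(\<Sum>n\<in>{X..<Y}. of_real (dconv \<alpha> \<beta> n) * e n) =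
       (\<Sum>n\<in>{X..<Y}. \<Sum>d | d dvd n. of_real (\<alpha> d) * of_real (\<beta> (n div d)) * e (d * (n div d)))"
      by (intro sum.cong refl) (simp add: dconv_def sum_distrib_right)
    then show ?thesis
      using sum_divisors_swap[OF X1, of "\<lambda>d l. of_real (\<alpha> d) * of_real (\<beta> l) * e (d * l)" Y] by simp
  qed
  have typeI: "norm (\<Sum>n\<in>{X..<Y}. of_real (dconv \<alpha> \<beta> n) * e n) \<le> (real U)\<^sup>2 * C"
    if C: "\<And>d. 0 < d \<Longrightarrow> d < Y \<Longrightarrow> d \<le> U\<^sup>2 \<Longrightarrow> norm (\<Sum>l\<in>?D d. of_real (\<alpha> d) * of_real (\<beta> l) * e (d * l)) \<le> C"
      and z: "\<And>d. U\<^sup>2 < d \<Longrightarrow> \<alpha> d = 0" and C0: "0 \<le> C" for \<alpha> \<beta> :: "nat \<Rightarrow> real" and C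
  proof -
    have "(\<Sum>n\<in>{X..<Y}. of_real (dconv \<alpha> \<beta> n) * e n) =
       (\<Sum>d\<in>{1..<Y} \<inter> {1..U\<^sup>2}. \<Sum>l\<in>?D d. of_real (\<alpha> d) * of_real (\<beta> l) * e (d * l))"
      unfolding swap
    proof (rule sum.mono_neutral_right)
      show "\<forall>d\<in>{1..<Y} - {1..<Y} \<inter> {1..U\<^sup>2}. (\<Sum>l\<in>?D d. of_real (\<alpha> d) * of_real (\<beta> l) * e (d * l)) = 0"
      proof
        fix d assume "d \<in> {1..<Y} - {1..<Y} \<inter> {1..U\<^sup>2}"
        then have "U\<^sup>2 < d" by auto
        then show "(\<Sum>l\<in>?D d. of_real (\<alpha> d) * of_real (\<beta> l) * e (d * l)) = 0" by (simp add: z)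
      qed
    qed auto
    also have "norm \<dots> \<le> (\<Sum>d\<in>{1..<Y} \<inter> {1..U\<^sup>2}. C)"
      by (intro sum_norm_le C) auto
    also have "\<dots> \<le> (\<Sum>d\<in>{1..U\<^sup>2}. C)" using C0 by (intro sum_mono2) auto
    finally show ?thesis by simp
  qed
  have I1: "norm (\<Sum>n\<in>{X..<Y}. of_real (dconv m1 (\<lambda>d. ln (real d)) n) * e n) \<le> (real U)\<^sup>2 * (2 * LL * B1)"
  proof (rule typeI)
    fix d assume d: "0 < d" "d < Y" "d \<le> U\<^sup>2"
    have "norm (\<Sum>l\<in>?D d. of_real (m1 d) * of_real (ln (real l)) * e (d * l)) =
       \<bar>m1 d\<bar> * norm (\<Sum>l\<in>?D d. of_real (ln (real l)) * e (d * l))"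
      by (simp add: mult.assoc norm_mult flip: sum_distrib_left)
    also have "\<dots> \<le> 1 * (2 * LL * B1)"
      using type1_log_bound[OF d(1,3)] by (intro mult_mono) (auto simp: m1_def abs_moebius_le)
    finally show "norm (\<Sum>l\<in>?D d. of_real (m1 d) * of_real (ln (real l)) * e (d * l)) \<le> 2 * LL * B1" by simp
  next
    fix d assume "U\<^sup>2 < d"
    moreover have "U \<le> U\<^sup>2" by (simp add: power2_eq_square)
    ultimately show "m1 d = 0" by (simp add: m1_def)
  qed (use log_size_ge_1 type1_const_nonneg in auto)
  have I2: "norm (\<Sum>n\<in>{X..<Y}. of_real (dconv cc (\<lambda>_. 1) n) * e n) \<le> (real U)\<^sup>2 * (LL * B1)"
  proof (rule typeI)
    fix d assume d: "0 < d" "d < Y" "d \<le> U\<^sup>2"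
    have "norm (\<Sum>l\<in>?D d. of_real (cc d) * of_real 1 * e (d * l)) =
       \<bar>cc d\<bar> * norm (\<Sum>l\<in>?D d. e (d * l))"
      by (simp add: norm_mult flip: sum_distrib_left)
    also have "\<dots> \<le> LL * B1"
      using type1_bound[OF d(1,3) Y] cc_le[OF d(1)] ln_le_LL[of d] d Y log_size_ge_1 by (intro mult_mono) auto
    finally show "norm (\<Sum>l\<in>?D d. of_real (cc d) * of_real 1 * e (d * l)) \<le> LL * B1" .
  qed (use log_size_ge_1 type1_const_nonneg cc0 in auto)
  have II: "norm (\<Sum>n\<in>{X..<Y}. of_real (dconv aa L2 n) * e n) \<le> 2 * LL * B2"
  proof -
    let ?T = "\<lambda>d. \<Sum>l\<in>?D d. of_real (aa d) * of_real (L2 l) * e (d * l)"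
    have "(\<Sum>n\<in>{X..<Y}. of_real (dconv aa L2 n) * e n) = (\<Sum>d\<in>{1..<2 ^ Suc x}. ?T d)"
      unfolding swap
    proof (rule sum.mono_neutral_left)
      show "{1..<Y} \<subseteq> {1..<2 ^ Suc x}" using Y X by auto
      show "\<forall>d\<in>{1..<2 ^ Suc x} - {1..<Y}. ?T d = 0"
      proof
        fix d :: nat assume d: "d \<in> {1..<2 ^ Suc x} - {1..<Y}"
        have "?D d = {}"
        proof (rule ccontr)
          assume "?D d \<noteq> {}"
          then obtain l where l: "X \<le> d * l" "d * l < Y" by blast
          then have "0 < l" using X1 by (auto intro: Nat.gr0I)
          then have "d \<le> d * l" by simp
          moreover have "Y \<le> d" using d by auto
          ultimately show False using l by linarith
        qed
        then show "?T d = 0" by (simp only: sum.empty)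
      qed
    qed simp
    also have "\<dots> = (\<Sum>i<Suc x. \<Sum>d\<in>{2 ^ i..<2 ^ Suc i}. ?T d)" by (rule sum_dyadic)
    finally have eq: "(\<Sum>n\<in>{X..<Y}. of_real (dconv aa L2 n) * e n) =
        (\<Sum>i<Suc x. \<Sum>d\<in>{2 ^ i..<2 ^ Suc i}. ?T d)" .
    have "norm (\<Sum>i<Suc x. \<Sum>d\<in>{2 ^ i..<2 ^ Suc i}. ?T d) \<le> (\<Sum>i<Suc x. B2)"
    proof (rule sum_norm_le)
      fix i assume i: "i \<in> {..<Suc x}"
      define D where "D = (2 ^ i :: nat)"
      have D0: "0 < D" by (simp add: D_def)
      show "norm (\<Sum>d\<in>{2 ^ i..<2 ^ Suc i}. ?T d) \<le> B2"
      \<comment> \<open>In the last dyadic range d \<ge> X, so d l < 2 X leaves only l \<le> 1,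
        where \<open>L2\<close> vanishes because U > 0.\<close>
      proof (cases "i = x")
        case True
        have "?T d = 0" if d: "d \<in> {2 ^ i..<2 ^ Suc i}" for d
        proof (rule sum.neutral, rule ballI)
          fix l assume l: "l \<in> ?D d"
          have "l \<le> 1"
          proof (rule ccontr)
            assume "\<not> l \<le> 1"
            then have "X * 2 \<le> d * l" using d True X by (intro mult_le_mono) auto
            then show False using l Y by simp
          qed
          then have "L2 l = 0" using Q by (simp add: L2_def)
          then show "complex_of_real (aa d) * complex_of_real (L2 l) * e (d * l) = 0" by simp
        qed
        then show ?thesis using type2_const_nonneg by simp
      next
        case False
        then have ix: "i < x" using i by simp
        define L where "L = (2 ^ (x - i - 1) :: nat)"
        have L0: "0 < L" by (simp add: L_def)
        have XDL: "X = 2 * D * L"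
        proof -
          have "x = 1 + i + (x - i - 1)" using ix by simp
          then show ?thesis unfolding X D_def L_def by (metis power_add power_one_right)
        qed
        \<comment> \<open>The dyadic range of d is [D, 2 D), whereas the box estimate sums over [D,
          4 D) so as to treat both variables alike; hence the cutoff at 2 D.\<close>
        define a' where "a' = (\<lambda>d. if d < 2 * D then complex_of_real (aa d) else 0)"
        define b' where "b' = (\<lambda>l. complex_of_real (L2 l))"
        define c where "c = (\<lambda>n. if X \<le> n \<and> n < Y then e n else 0)"
        have T: "(\<Sum>d\<in>{2 ^ i..<2 ^ Suc i}. ?T d) = (\<Sum>d\<in>{D..<4 * D}. \<Sum>l\<in>{L..<4 * L}. a' d * b' l * c (d * l))"
        proof -
          have "?T d = (\<Sum>l\<in>{L..<4 * L}. a' d * b' l * c (d * l))" if d: "d \<in> {D..<2 * D}" for d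
          proof (rule sum.mono_neutral_cong_left)
            \<comment> \<open>With X = 2 D L and D \<le> d < 2 D, the condition X \<le> d l < 2 X
              confines l to [L, 4 L).\<close>
            show "?D d \<subseteq> {L..<4 * L}"
            proof
              fix l assume l: "l \<in> ?D d"
              have "2 * D * L \<le> d * l" using l XDL by simp
              also have "\<dots> \<le> 2 * D * l" using d by (intro mult_le_mono1) auto
              finally have 1: "L \<le> l" using D0 by simp
              have "D * l \<le> d * l" using d by (intro mult_le_mono1) auto
              also have "\<dots> < 2 * (2 * D * L)" using l Y XDL by simp
              finally have "D * l < D * (4 * L)" by simp
              then have "l < 4 * L" by simp
              with 1 show "l \<in> {L..<4 * L}" by simp
            qed
          qed (use d in \<open>auto simp: a'_def b'_def c_def\<close>)
          then have "(\<Sum>d\<in>{D..<2 * D}. ?T d) = (\<Sum>d\<in>{D..<2 * D}. \<Sum>l\<in>{L..<4 * L}. a' d * b' l * c (d * l))"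
            by (rule sum.cong[OF refl])
          also have "\<dots> = (\<Sum>d\<in>{D..<4 * D}. \<Sum>l\<in>{L..<4 * L}. a' d * b' l * c (d * l))"
            by (rule sum.mono_neutral_left) (auto simp: a'_def)
          finally show ?thesis by (simp add: D_def)
        qed
        show ?thesis
        \<comment> \<open>Both coefficient sequences vanish up to U, so boxes below U in either
          variable are empty. The others have both sides at least Q because 4 Q \<le> U, as the
          block argument requires.\<close>
        proof (cases "2 * D \<le> U \<or> 4 * L \<le> U")
          case True
          have "a' d * b' l = 0" if "d \<in> {D..<4 * D}" "l \<in> {L..<4 * L}" for d l
            using True that aa0[of d] D0 by (auto simp: a'_def b'_def L2_def)
          then have "(\<Sum>d\<in>{D..<4 * D}. \<Sum>l\<in>{L..<4 * L}. a' d * b' l * c (d * l)) = 0"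
            by (intro sum.neutral ballI) simp
          then show ?thesis unfolding T using type2_const_nonneg by simp
        next
          case False
          then have QD: "Q \<le> D" "Q \<le> L" using Q by auto
          have D4: "4 * D \<le> 4 * X" "4 * L \<le> 4 * X" using XDL D0 L0 by auto
          have A: "(\<Sum>d\<in>{D..<4 * D}. (norm (a' d))\<^sup>2) \<le> 4 * D * LL ^ 3"
          proof -
            have "(\<Sum>d\<in>{D..<4 * D}. (norm (a' d))\<^sup>2) \<le> (\<Sum>d\<in>{D..<4 * D}. (real (divisor_count d))\<^sup>2)"
              using aa_le by (intro sum_mono power_mono) (auto simp: a'_def)
            also have "\<dots> \<le> (\<Sum>d\<in>{1..4 * D}. (real (divisor_count d))\<^sup>2)"
              using D0 by (intro sum_mono2) auto
            also have "\<dots> \<le> real (4 * D) * (1 + ln (real (4 * D))) ^ 3"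
              using D0 by (intro sum_divisor_count_sq_le) auto
            also have "\<dots> \<le> real (4 * D) * LL ^ 3"
            proof (intro mult_left_mono power_mono)
              show "1 + ln (real (4 * D)) \<le> LL" unfolding log_size_def using D0 D4 X1 by simp
            qed (use D0 in auto)
            finally show ?thesis by simp
          qed
          have Bb: "(\<Sum>l\<in>{L..<4 * L}. (norm (b' l))\<^sup>2) \<le> 4 * L * LL ^ 2"
          proof -
            have "(\<Sum>l\<in>{L..<4 * L}. (norm (b' l))\<^sup>2) \<le> (\<Sum>l\<in>{L..<4 * L}. LL\<^sup>2)"
            proof (intro sum_mono power_mono)
              fix l assume l: "l \<in> {L..<4 * L}"
              then have "0 < l" "l \<le> 4 * X" using L0 D4 by auto
              then show "norm (b' l) \<le> LL"
                using mangoldt_le[of l] ln_le_LL[of l] log_size_ge_1 by (auto simp: b'_def L2_def)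
            qed simp
            also have "\<dots> = (4 * real L - real L) * LL\<^sup>2" by simp
            also have "\<dots> \<le> 4 * L * LL\<^sup>2" by (intro mult_right_mono) auto
            finally show ?thesis .
          qed
          show ?thesis
          \<comment> \<open>The box estimate wants the longer variable first; when d is the shorter
            one, the two variables exchange roles.\<close>
          proof (cases "L \<le> D")
            case True
            show ?thesis
              unfolding T c_def
              by (rule box_bound[OF XDL True QD(2) A Bb]) (use log_size_ge_1 in \<open>auto simp: power_numeral_reduce\<close>)
          next
            case False
            have "(\<Sum>d\<in>{D..<4 * D}. \<Sum>l\<in>{L..<4 * L}. a' d * b' l * c (d * l)) =
               (\<Sum>l\<in>{L..<4 * L}. \<Sum>d\<in>{D..<4 * D}. b' l * a' d * c (l * d))"
              by (subst sum.swap) (simp add: mult.commute)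
            moreover have "norm \<dots> \<le> B2"
              unfolding c_def
              by (rule box_bound[OF _ _ QD(1) Bb A]) (use log_size_ge_1 XDL False in \<open>auto simp: power_numeral_reduce\<close>)
            ultimately show ?thesis unfolding T by simp
          qed
        qed
      qed
    qed
    also have "\<dots> = real (Suc x) * B2" by simp
    also have "\<dots> \<le> 2 * LL * B2"
    proof (rule mult_right_mono)
      have "1/2 \<le> ln (2::real)" using ln_diff_le[of 1 "2::real"] by simp
      then have "real x * (1/2) \<le> real x * ln 2" by (rule mult_left_mono) simp
      also have "\<dots> = ln (real X)" by (simp add: X ln_realpow)
      also have "\<dots> \<le> ln (4 * real X)" using X1 by simp
      finally have "real x * (1/2) \<le> LL - 1" by (simp add: log_size_def)
      then show "real (Suc x) \<le> 2 * LL" using log_size_ge_1 by simp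
    qed (rule type2_const_nonneg)
    finally show ?thesis by (simp only: eq)
  qed
  have "norm (\<Sum>n\<in>{X..<Y}. mangoldt n * e n) \<le>
     (real U)\<^sup>2 * (2 * LL * B1) + (real U)\<^sup>2 * (LL * B1) + 2 * LL * B2"
    unfolding split by (intro norm_triangle_le add_mono II order.trans[OF norm_triangle_ineq4] I1 I2)
  then show ?thesis by (simp add: algebra_simps)
qed

end

section \<open>Sawtooth approximation by Fejer means\<close>

lemma e2pi_power: "e2pi t ^ j = e2pi (real j * t)"
  by (induction j) (simp_all add: e2pi_add distrib_right)

text \<open>A differentiated geometric sum. At an n-th root of unity other than 1 the right side is
  just n, which yields Fourier coefficients of the sawtooth without any integral.\<close>

lemma sum_mult_power:
  fixes w :: "'a :: comm_ring_1"
  shows "(w - 1) * (\<Sum>j<n. of_nat j * w ^ j) = of_nat n * w ^ n - w * (\<Sum>j<n. w ^ j)"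
  by (induction n) (simp_all add: algebra_simps)

text \<open>The Fejer kernel, with coefficient 1 - |k|/M at frequency k; as a squared modulus it is
  visibly nonnegative.\<close>

definition fejer :: "nat \<Rightarrow> real \<Rightarrow> real" where
  "fejer M t = (norm (\<Sum>r<M. e2pi (real r * t)))\<^sup>2 / real M"

lemma fejer_nonneg: "0 \<le> fejer M t"
  by (simp add: fejer_def)

lemma fejer_expand:
  "complex_of_real (fejer M t) = (\<Sum>r<M. \<Sum>s<M. e2pi (of_int (int r - int s) * t)) / of_nat M"
proof -
  have "complex_of_real (fejer M t) =
      (\<Sum>r<M. e2pi (real r * t)) * cnj (\<Sum>s<M. e2pi (real s * t)) / of_nat M"
    unfolding fejer_def of_real_divide complex_norm_square by simp
  also have "\<dots> = (\<Sum>r<M. \<Sum>s<M. e2pi (of_int (int r - int s) * t)) / of_nat M"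
    by (simp add: sum_product left_diff_distrib e2pi_diff)
  finally show ?thesis .
qed

text \<open>Quadratic decay away from the integers: e(t) - 1 times the geometric sum is e(M t) - 1,
  of modulus at most 2. The denominator is multiplied out, so integer t need no separate
  case.\<close>

lemma fejer_mult_le: "fejer M t * (norm (e2pi t - 1))\<^sup>2 \<le> 4 / real M"
proof -
  have "(e2pi t - 1) * (\<Sum>r<M. e2pi (real r * t)) = e2pi (real M * t) - 1"
    using power_diff_1_eq[of "e2pi t" M] by (simp add: e2pi_power)
  then have "fejer M t * (norm (e2pi t - 1))\<^sup>2 = (norm (e2pi (real M * t) - 1))\<^sup>2 / M"
    by (simp add: fejer_def flip: power_mult_distrib norm_mult) (simp add: mult.commute)
  also have "\<dots> \<le> 2\<^sup>2 / M"
    using norm_triangle_ineq4[of "e2pi (real M * t)" 1] by (intro divide_right_mono power_mono) auto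
  finally show ?thesis by simp
qed

text \<open>The k-th Fourier coefficient of the sawtooth, with the integral replaced by the sum over
  R equally spaced nodes.\<close>

definition saw_coeff :: "nat \<Rightarrow> int \<Rightarrow> complex" where
  "saw_coeff R k = (\<Sum>j<R. of_real (real j / real R) * e2pi (- (of_int k * (real j / real R)))) / of_nat R"

text \<open>
  The convolution of the sawtooth with the Fejer kernel is replaced by a quadrature with \<open>2 M\<close> nodes,
  for which the kernel still has average exactly 1 and the coefficients are finite geometric-type sums.
\<close>

definition saw_poly :: "nat \<Rightarrow> real \<Rightarrow> real" where
  "saw_poly M t = (\<Sum>j<2 * M. real j / real (2 * M) * fejer M (t - real j / real (2 * M))) / real (2 * M)"

text \<open>With R = 2 M nodes, |k| \<le> M means |k/R| \<le> 1/2. So a nonzero k is not aliased to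
  0, and e(-k/R) keeps a distance from 1 that is linear in k.\<close>

lemma root_of_unity:
  fixes k :: int
  assumes k: "k \<noteq> 0" "\<bar>k\<bar> \<le> int M" and R: "R = 2 * M"
  defines "w \<equiv> e2pi (- (of_int k / real R))"
  shows "w ^ R = 1" "4 * \<bar>of_int k\<bar> / real R \<le> norm (w - 1)" "w \<noteq> 1"
proof -
  have M: "M > 0" using k by (cases M) auto
  have "w ^ R = e2pi (of_int (- k))" using M by (simp add: w_def e2pi_power R)
  then show "w ^ R = 1" by (simp only: e2pi_of_int)
  have "\<bar>of_int k :: real\<bar> \<le> real M" using k(2) by (metis of_int_abs of_int_le_iff of_int_of_nat_eq)
  then have "\<bar>- (of_int k / real R)\<bar> \<le> 1 / 2" using M by (simp add: R field_simps)
  from norm_e2pi_minus_1_ge[OF this]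
  show *: "4 * \<bar>of_int k\<bar> / real R \<le> norm (w - 1)" by (simp add: w_def)
  have "0 < 4 * \<bar>of_int k :: real\<bar> / real R" using k M by (simp add: R)
  with * show "w \<noteq> 1" by auto
qed

text \<open>The frequencies r - s of the kernel are below M in modulus, so summation over 2 M nodes
  annihilates all of them except r = s.\<close>

lemma fejer_average:
  assumes M: "M > 0"
  shows "(\<Sum>j<2 * M. fejer M (t - real j / real (2 * M))) / real (2 * M) = 1"
proof -
  define R where "R = 2 * M"
  have R: "R > 0" using M by (simp add: R_def)
  have geo: "(\<Sum>j<R. e2pi (- (of_int k * (real j / real R)))) = (if k = 0 then of_nat R else 0)"
    if k: "\<bar>k\<bar> \<le> int M" for k
  proof (cases "k = 0")
    case False
    let ?w = "e2pi (- (of_int k / real R))"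
    have "(\<Sum>j<R. e2pi (- (of_int k * (real j / real R)))) = (\<Sum>j<R. ?w ^ j)"
      by (simp add: e2pi_power mult.commute)
    also have "\<dots> = 0"
      using root_of_unity[OF False k R_def] by (simp add: geometric_sum)
    finally show ?thesis using False by simp
  qed simp
  have "complex_of_real (\<Sum>j<R. fejer M (t - real j / real R)) =
      (\<Sum>j<R. \<Sum>r<M. \<Sum>s<M. e2pi (of_int (int r - int s) * (t - real j / real R))) / of_nat M"
    by (simp only: of_real_sum fejer_expand sum_divide_distrib)
  also have "(\<Sum>j<R. \<Sum>r<M. \<Sum>s<M. e2pi (of_int (int r - int s) * (t - real j / real R))) =
     (\<Sum>r<M. \<Sum>s<M. \<Sum>j<R. e2pi (of_int (int r - int s) * (t - real j / real R)))"
    unfolding sum.swap[where A = "{..<R}"] ..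
  also have "\<dots> = (\<Sum>r<M. \<Sum>s<M. e2pi (of_int (int r - int s) * t) *
      (\<Sum>j<R. e2pi (- (of_int (int r - int s) * (real j / real R)))))"
    by (simp add: sum_distrib_left right_diff_distrib e2pi_diff e2pi_minus)
  also have "\<dots> = (\<Sum>r<M. \<Sum>s<M. if s = r then of_nat R else 0)"
  proof (intro sum.cong refl)
    fix r s assume "r \<in> {..<M}" "s \<in> {..<M}"
    then have "\<bar>int r - int s\<bar> \<le> int M" by auto
    from geo[OF this] show "e2pi (of_int (int r - int s) * t) *
      (\<Sum>j<R. e2pi (- (of_int (int r - int s) * (real j / real R)))) = (if s = r then of_nat R else 0)"
      by auto
  qed
  also have "\<dots> = of_nat M * of_nat R" by simp
  finally have "complex_of_real (\<Sum>j<R. fejer M (t - real j / real R)) = complex_of_real (real R)"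
    using M by simp
  then have "(\<Sum>j<R. fejer M (t - real j / real R)) = real R" by (simp only: of_real_eq_iff)
  then show ?thesis using R by (simp add: R_def)
qed

text \<open>For w = e(-k/R) the product of w - 1 and the coefficient is exactly 1/R by
  \<open>sum_mult_power\<close>, and |w - 1| is at least 4 |k| / R.\<close>

lemma saw_coeff_bound:
  assumes k: "k \<noteq> 0" "\<bar>k\<bar> \<le> int M"
  shows "norm (saw_coeff (2 * M) k) \<le> 1 / (4 * \<bar>of_int k\<bar>)"
proof -
  define R where "R = 2 * M"
  have R: "R > 0" using k by (cases M) (auto simp: R_def)
  let ?w = "e2pi (- (of_int k / real R))"
  note w = root_of_unity[OF k R_def]
  have S: "(?w - 1) * (\<Sum>j<R. of_nat j * ?w ^ j) = of_nat R"
    using sum_mult_power[of ?w R] w by (simp add: geometric_sum)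
  have "saw_coeff R k = (\<Sum>j<R. of_nat j * ?w ^ j / of_nat R) / of_nat R"
    by (simp add: saw_coeff_def e2pi_power mult.commute)
  also have "\<dots> = (\<Sum>j<R. of_nat j * ?w ^ j) / of_nat R / of_nat R"
    by (simp only: sum_divide_distrib)
  finally have "(?w - 1) * saw_coeff R k = 1 / of_nat R" using S R by simp
  then have "norm (?w - 1) * norm (saw_coeff R k) = 1 / real R"
    by (metis norm_mult norm_divide norm_one norm_of_nat)
  moreover have "4 * \<bar>of_int k\<bar> / real R * norm (saw_coeff R k) \<le> norm (?w - 1) * norm (saw_coeff R k)"
    using w(2) by (intro mult_right_mono) auto
  ultimately have "4 * \<bar>of_int k\<bar> / real R * norm (saw_coeff R k) \<le> 1 / real R" by simp
  then have "4 * \<bar>of_int k\<bar> * norm (saw_coeff R k) \<le> 1" using R by (simp add: divide_le_cancel)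
  then show ?thesis using k unfolding R_def[symmetric] by (simp add: field_simps)
qed

lemma saw_poly_expand:
  assumes "M > 0"
  shows "complex_of_real (saw_poly M t) =
     (\<Sum>r<M. \<Sum>s<M. saw_coeff (2 * M) (int r - int s) * e2pi (of_int (int r - int s) * t)) / of_nat M"
proof -
  define R where "R = 2 * M"
  let ?k = "\<lambda>r s. int r - int s"
  have sp: "e2pi (k * (t - x)) = e2pi (- (k * x)) * e2pi (k * t)" for k x
    by (simp add: right_diff_distrib e2pi_diff e2pi_minus mult.commute)
  have "complex_of_real (saw_poly M t) =
     (\<Sum>j<R. of_real (real j / real R) * (\<Sum>r<M. \<Sum>s<M. e2pi (of_int (?k r s) * (t - real j / real R)))) / of_nat R / of_nat M"
  proof -
    have "complex_of_real (saw_poly M t) =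
       (\<Sum>j<R. of_real (real j / real R) * complex_of_real (fejer M (t - real j / real R))) / of_nat R"
      by (simp add: saw_poly_def R_def[symmetric])
    also have "\<dots> = (\<Sum>j<R. of_real (real j / real R) *
        (\<Sum>r<M. \<Sum>s<M. e2pi (of_int (?k r s) * (t - real j / real R)))) / of_nat M / of_nat R"
      by (simp only: fejer_expand times_divide_eq_right sum_divide_distrib[symmetric])
    finally show ?thesis by (simp only: divide_divide_eq_left mult.commute)
  qed
  also have "(\<Sum>j<R. of_real (real j / real R) * (\<Sum>r<M. \<Sum>s<M. e2pi (of_int (?k r s) * (t - real j / real R))))
     = (\<Sum>j<R. \<Sum>r<M. \<Sum>s<M. of_real (real j / real R) * e2pi (of_int (?k r s) * (t - real j / real R)))"
    by (simp only: sum_distrib_left)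
  also have "\<dots> = (\<Sum>r<M. \<Sum>s<M. \<Sum>j<R. of_real (real j / real R) * e2pi (of_int (?k r s) * (t - real j / real R)))"
    unfolding sum.swap[where A = "{..<R}"] ..
  also have "\<dots> = (\<Sum>r<M. \<Sum>s<M. (\<Sum>j<R. of_real (real j / real R) * e2pi (- (of_int (?k r s) * (real j / real R)))) *
       e2pi (of_int (?k r s) * t))"
    by (simp only: sp sum_distrib_right mult.assoc)
  also have "\<dots> / of_nat R = (\<Sum>r<M. \<Sum>s<M. saw_coeff R (?k r s) * e2pi (of_int (?k r s) * t))"
    unfolding saw_coeff_def times_divide_eq_left by (simp only: sum_divide_distrib[symmetric])
  finally show ?thesis by (simp add: R_def)
qed

text \<open>\<open>frac t\<close> is compared with the node values under the kernel, which has
  average 1. Evaluating at t - \<eta> makes every node within \<eta> of the evaluation point (modulo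
  1) lie to the left of t, so the jump of \<open>frac\<close> cannot spoil the inequality; t +
  \<eta> does the same on the other side. Nodes further away are charged to the tail of the
  kernel.\<close>

lemma saw_poly_bounds:
  assumes M: "M > 0" and \<eta>: "0 < \<eta>"
  shows "frac t \<le> saw_poly M (t - \<eta>) + (2 * \<eta> + 1 / (4 * real M * \<eta>\<^sup>2))"
    and "saw_poly M (t + \<eta>) - (2 * \<eta> + 1 / (4 * real M * \<eta>\<^sup>2)) \<le> frac t"
proof -
  define R where "R = 2 * M"
  have R: "R > 0" using M by (simp add: R_def)
  \<comment> \<open>Chebyshev's device: the quotient dominates the indicator of being more than
    \<eta> away from all integers, and \<open>fejer_mult_le\<close> bounds its average against the
    kernel.\<close>
  have far: "1 \<le> (norm (e2pi d - 1))\<^sup>2 / (16 * \<eta>\<^sup>2)" if d: "\<And>i::int. \<eta> < \<bar>d - of_int i\<bar>" for d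
  proof -
    define i where "i = round d"
    have "\<bar>d - of_int i\<bar> \<le> 1/2" using of_int_round_abs_le[of d] by (simp add: i_def abs_minus_commute)
    from norm_e2pi_minus_1_ge[OF this] have "4 * \<bar>d - of_int i\<bar> \<le> norm (e2pi d - 1)"
      by (simp add: e2pi_diff_int)
    moreover have "4 * \<eta> \<le> 4 * \<bar>d - of_int i\<bar>" using d[of i] by simp
    ultimately have "4 * \<eta> \<le> norm (e2pi d - 1)" by (rule order.trans[rotated])
    then have "(4 * \<eta>)\<^sup>2 \<le> (norm (e2pi d - 1))\<^sup>2" using \<eta> by (intro power_mono) auto
    then show ?thesis using \<eta> by (simp add: field_simps power_mult_distrib)
  qed
  have avg: "(\<Sum>j<R. (real j / real R + \<sigma>) * fejer M (u - real j / real R)) / real R = saw_poly M u + \<sigma>" for \<sigma> u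
  proof -
    have "(\<Sum>j<R. (real j / real R + \<sigma>) * fejer M (u - real j / real R)) / real R
      = saw_poly M u + \<sigma> * ((\<Sum>j<R. fejer M (u - real j / real R)) / real R)"
      by (simp add: saw_poly_def R_def distrib_right sum.distrib sum_distrib_left add_divide_distrib)
    then show ?thesis using fejer_average[OF M, of u] by (simp add: R_def)
  qed
  have tail: "(\<Sum>j<R. (norm (e2pi (u - real j / real R) - 1))\<^sup>2 / (16 * \<eta>\<^sup>2) * fejer M (u - real j / real R)) / real R
      \<le> 1 / (4 * real M * \<eta>\<^sup>2)" for u
  proof -
    have "(\<Sum>j<R. (norm (e2pi (u - real j / real R) - 1))\<^sup>2 / (16 * \<eta>\<^sup>2) * fejer M (u - real j / real R))
      \<le> (\<Sum>j<R. 4 / real M / (16 * \<eta>\<^sup>2))"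
    proof (rule sum_mono)
      fix j
      have "fejer M (u - real j / real R) * (norm (e2pi (u - real j / real R) - 1))\<^sup>2 / (16 * \<eta>\<^sup>2)
          \<le> 4 / real M / (16 * \<eta>\<^sup>2)"
        by (intro divide_right_mono fejer_mult_le) auto
      then show "(norm (e2pi (u - real j / real R) - 1))\<^sup>2 / (16 * \<eta>\<^sup>2) * fejer M (u - real j / real R)
          \<le> 4 / real M / (16 * \<eta>\<^sup>2)" by (simp add: mult.commute)
    qed
    also have "\<dots> = real R * (1 / (4 * real M * \<eta>\<^sup>2))" by simp
    finally show ?thesis using R by (simp add: field_simps)
  qed
  have "frac t = (\<Sum>j<R. frac t * fejer M ((t - \<eta>) - real j / real R)) / real R"
    using fejer_average[OF M, of "t - \<eta>"] by (simp add: R_def flip: sum_distrib_left)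
  also have "\<dots> \<le> (\<Sum>j<R. ((real j / real R + 2 * \<eta>) + (norm (e2pi ((t - \<eta>) - real j / real R) - 1))\<^sup>2 / (16 * \<eta>\<^sup>2))
       * fejer M ((t - \<eta>) - real j / real R)) / real R"
  proof (intro divide_right_mono sum_mono mult_right_mono fejer_nonneg)
    fix j assume j: "j \<in> {..<R}"
    define d where "d = (t - \<eta>) - real j / real R"
    have j01: "0 \<le> real j / real R" using R by simp
    show "frac t \<le> real j / real R + 2 * \<eta> + (norm (e2pi ((t - \<eta>) - real j / real R) - 1))\<^sup>2 / (16 * \<eta>\<^sup>2)"
    proof (cases "\<exists>i::int. \<bar>d - of_int i\<bar> \<le> \<eta>")
      case True
      then obtain i :: int where i: "\<bar>d - of_int i\<bar> \<le> \<eta>" by blast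
      have "of_int i \<le> t" using i j01 unfolding d_def by linarith
      then have "i \<le> \<lfloor>t\<rfloor>" by (simp add: le_floor_iff)
      then have "frac t \<le> t - of_int i" by (simp add: frac_def)
      also have "\<dots> \<le> real j / real R + 2 * \<eta>" using i by (simp add: d_def)
      finally show ?thesis by (simp add: add_increasing2)
    next
      case False
      then have "\<eta> < \<bar>d - of_int i\<bar>" for i :: int by (meson not_le)
      then have "1 \<le> (norm (e2pi d - 1))\<^sup>2 / (16 * \<eta>\<^sup>2)" by (rule far)
      then show ?thesis using frac_lt_1[of t] j01 \<eta> unfolding d_def by linarith
    qed
  qed simp
  also have "\<dots> = (\<Sum>j<R. (real j / real R + 2 * \<eta>) * fejer M ((t - \<eta>) - real j / real R)) / real R
     + (\<Sum>j<R. (norm (e2pi ((t - \<eta>) - real j / real R) - 1))\<^sup>2 / (16 * \<eta>\<^sup>2) * fejer M ((t - \<eta>) - real j / real R)) / real R"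
    by (simp only: distrib_right sum.distrib add_divide_distrib)
  also have "\<dots> \<le> saw_poly M (t - \<eta>) + 2 * \<eta> + 1 / (4 * real M * \<eta>\<^sup>2)"
    unfolding avg by (intro add_left_mono tail)
  finally show "frac t \<le> saw_poly M (t - \<eta>) + (2 * \<eta> + 1 / (4 * real M * \<eta>\<^sup>2))" by simp
  have "saw_poly M (t + \<eta>) - (2 * \<eta> + 1 / (4 * real M * \<eta>\<^sup>2)) \<le>
      (\<Sum>j<R. (real j / real R + - (2 * \<eta>)) * fejer M ((t + \<eta>) - real j / real R)) / real R
     - (\<Sum>j<R. (norm (e2pi ((t + \<eta>) - real j / real R) - 1))\<^sup>2 / (16 * \<eta>\<^sup>2) * fejer M ((t + \<eta>) - real j / real R)) / real R"
    unfolding avg using tail[of "t + \<eta>"] by linarith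
  also have "\<dots> = (\<Sum>j<R. ((real j / real R + - (2 * \<eta>)) - (norm (e2pi ((t + \<eta>) - real j / real R) - 1))\<^sup>2 / (16 * \<eta>\<^sup>2))
       * fejer M ((t + \<eta>) - real j / real R)) / real R"
    by (simp only: left_diff_distrib sum_subtractf diff_divide_distrib)
  also have "\<dots> \<le> (\<Sum>j<R. frac t * fejer M ((t + \<eta>) - real j / real R)) / real R"
  proof (intro divide_right_mono sum_mono mult_right_mono fejer_nonneg)
    fix j assume j: "j \<in> {..<R}"
    define d where "d = (t + \<eta>) - real j / real R"
    have j01: "real j / real R < 1" using R j by simp
    show "real j / real R + - (2 * \<eta>) - (norm (e2pi ((t + \<eta>) - real j / real R) - 1))\<^sup>2 / (16 * \<eta>\<^sup>2) \<le> frac t"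
    proof (cases "\<exists>i::int. \<bar>d - of_int i\<bar> \<le> \<eta>")
      case True
      then obtain i :: int where i: "\<bar>d - of_int i\<bar> \<le> \<eta>" by blast
      have "t < of_int i + 1" using i j01 unfolding d_def by linarith
      then have "\<lfloor>t\<rfloor> \<le> i" by (simp add: floor_le_iff)
      then have "t - of_int i \<le> frac t" by (simp add: frac_def)
      moreover have "real j / real R + - (2 * \<eta>) \<le> t - of_int i" using i by (simp add: d_def)
      moreover have "0 \<le> (norm (e2pi ((t + \<eta>) - real j / real R) - 1))\<^sup>2 / (16 * \<eta>\<^sup>2)" by simp
      ultimately show ?thesis by linarith
    next
      case False
      then have "\<eta> < \<bar>d - of_int i\<bar>" for i :: int by (meson not_le)
      then have "1 \<le> (norm (e2pi d - 1))\<^sup>2 / (16 * \<eta>\<^sup>2)" by (rule far)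
      then show ?thesis using frac_ge_0[of t] j01 \<eta> unfolding d_def by linarith
    qed
  qed simp
  also have "\<dots> = frac t"
    using fejer_average[OF M, of "t + \<eta>"] by (simp add: R_def flip: sum_distrib_left)
  finally show "saw_poly M (t + \<eta>) - (2 * \<eta> + 1 / (4 * real M * \<eta>\<^sup>2)) \<le> frac t" .
qed

lemma sum_inverse_dist_le:
  assumes "r < M"
  shows "(\<Sum>s\<in>{..<M} - {r}. 1 / \<bar>of_int (int r - int s)\<bar>) \<le> 2 * (1 + ln (real M))"
proof -
  let ?H = "\<Sum>k\<in>{1..M}. 1 / real k"
  have "{..<M} - {r} = {..<r} \<union> {r<..<M}" using assms by auto
  then have "(\<Sum>s\<in>{..<M} - {r}. 1 / \<bar>of_int (int r - int s) :: real\<bar>) =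
     (\<Sum>s\<in>{..<r} \<union> {r<..<M}. 1 / \<bar>of_int (int r - int s)\<bar>)" by (simp only:)
  also have "\<dots> = (\<Sum>s\<in>{..<r}. 1 / \<bar>of_int (int r - int s) :: real\<bar>) + (\<Sum>s\<in>{r<..<M}. 1 / \<bar>of_int (int r - int s)\<bar>)"
    by (rule sum.union_disjoint) auto
  also have "(\<Sum>s\<in>{..<r}. 1 / \<bar>of_int (int r - int s) :: real\<bar>) = (\<Sum>k\<in>{1..r}. 1 / real k)"
    by (rule sum.reindex_bij_witness[of _ "\<lambda>k. r - k" "\<lambda>s. r - s"]) (auto simp: of_nat_diff)
  also have "\<dots> \<le> ?H" using assms by (intro sum_mono2) auto
  also have "(\<Sum>s\<in>{r<..<M}. 1 / \<bar>of_int (int r - int s) :: real\<bar>) = (\<Sum>k\<in>{1..<M - r}. 1 / real k)"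
    by (rule sum.reindex_bij_witness[of _ "\<lambda>k. r + k" "\<lambda>s. s - r"]) (auto simp: of_nat_diff)
  also have "\<dots> \<le> ?H" by (intro sum_mono2) auto
  also have "?H \<le> 1 + ln (real M)" using assms by (intro sum_inverse_le) auto
  finally show ?thesis by simp
qed

text \<open>The pairs r = s give the mean value; every other pair has a frequency k with coefficient
  at most 1 / (4 |k|), so the average over r leaves a harmonic sum. As W is real, negative
  frequencies follow by conjugation. The shift u only rotates coefficients, so the main term is
  independent of it.\<close>

lemma saw_poly_sum:
  fixes W y :: "'a \<Rightarrow> real"
  assumes M: "M > 0" and B0: "0 \<le> B"
    and B: "\<And>k. 1 \<le> k \<Longrightarrow> k < M \<Longrightarrow> norm (\<Sum>n\<in>S. of_real (W n) * e2pi (real k * y n)) \<le> B"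
  shows "\<bar>(\<Sum>n\<in>S. W n * saw_poly M (y n + u)) - Re (saw_coeff (2 * M) 0) * (\<Sum>n\<in>S. W n)\<bar> \<le> B * (1 + ln (real M)) / 2"
proof -
  let ?k = "\<lambda>r s. int r - int s"
  let ?E = "\<lambda>k::int. \<Sum>n\<in>S. of_real (W n) * e2pi (of_int k * y n)"
  have E: "norm (?E k) \<le> B" if "k \<noteq> 0" "\<bar>k\<bar> < int M" for k
  proof (cases "0 < k")
    case True
    then show ?thesis using B[of "nat k"] that by simp
  next
    case False
    have "?E k = cnj (?E (- k))" by (simp add: e2pi_minus)
    then have "norm (?E k) = norm (?E (- k))" by (metis complex_mod_cnj)
    also have "\<dots> \<le> B" using B[of "nat (- k)"] that False by simp
    finally show ?thesis .
  qed
  define c where "c = (\<lambda>k. saw_coeff (2 * M) k * e2pi (of_int k * u))"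
  have "complex_of_real (\<Sum>n\<in>S. W n * saw_poly M (y n + u)) =
     (\<Sum>n\<in>S. \<Sum>r<M. \<Sum>s<M. c (?k r s) * (of_real (W n) * e2pi (of_int (?k r s) * y n))) / of_nat M"
  proof -
    have 1: "complex_of_real (saw_poly M (y n + u)) =
        (\<Sum>r<M. \<Sum>s<M. c (?k r s) * e2pi (of_int (?k r s) * y n)) / of_nat M" for n
      unfolding saw_poly_expand[OF M] c_def add.commute[of "y n" u]
      by (simp only: distrib_left e2pi_add mult.assoc)
    have "complex_of_real (\<Sum>n\<in>S. W n * saw_poly M (y n + u)) =
        (\<Sum>n\<in>S. of_real (W n) * (\<Sum>r<M. \<Sum>s<M. c (?k r s) * e2pi (of_int (?k r s) * y n))) / of_nat M"
      by (simp only: of_real_sum of_real_mult 1 times_divide_eq_right sum_divide_distrib[symmetric])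
    then show ?thesis by (simp only: sum_distrib_left mult.left_commute)
  qed
  also have "(\<Sum>n\<in>S. \<Sum>r<M. \<Sum>s<M. c (?k r s) * (of_real (W n) * e2pi (of_int (?k r s) * y n))) =
     (\<Sum>r<M. \<Sum>s<M. \<Sum>n\<in>S. c (?k r s) * (of_real (W n) * e2pi (of_int (?k r s) * y n)))"
    unfolding sum.swap[where A = S] ..
  also have "\<dots> = (\<Sum>r<M. \<Sum>s<M. c (?k r s) * ?E (?k r s))"
    by (simp only: sum_distrib_left)
  also have "\<dots> = (\<Sum>r<M. c 0 * ?E 0 + (\<Sum>s\<in>{..<M} - {r}. c (?k r s) * ?E (?k r s)))"
    by (intro sum.cong refl) (subst sum.remove[of _ r for r], auto)
  also have "\<dots> = of_nat M * (c 0 * ?E 0) + (\<Sum>r<M. \<Sum>s\<in>{..<M} - {r}. c (?k r s) * ?E (?k r s))"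
    by (simp add: sum.distrib)
  finally have eq: "complex_of_real (\<Sum>n\<in>S. W n * saw_poly M (y n + u)) - c 0 * ?E 0 =
      (\<Sum>r<M. \<Sum>s\<in>{..<M} - {r}. c (?k r s) * ?E (?k r s)) / of_nat M"
    using M by (simp add: add_divide_distrib)
  have "norm (\<Sum>r<M. \<Sum>s\<in>{..<M} - {r}. c (?k r s) * ?E (?k r s)) \<le>
      (\<Sum>r<M. B / 4 * (\<Sum>s\<in>{..<M} - {r}. 1 / \<bar>of_int (?k r s)\<bar>))"
  proof (rule sum_norm_le)
    fix r assume r: "r \<in> {..<M}"
    have "norm (\<Sum>s\<in>{..<M} - {r}. c (?k r s) * ?E (?k r s)) \<le>
       (\<Sum>s\<in>{..<M} - {r}. 1 / (4 * \<bar>of_int (?k r s)\<bar>) * B)"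
    proof (rule sum_norm_le)
      fix s assume s: "s \<in> {..<M} - {r}"
      have "norm (c (?k r s)) \<le> 1 / (4 * \<bar>of_int (?k r s)\<bar>)"
        unfolding c_def norm_mult using r s saw_coeff_bound[of "?k r s" M] by auto
      then show "norm (c (?k r s) * ?E (?k r s)) \<le> 1 / (4 * \<bar>of_int (?k r s)\<bar>) * B"
        unfolding norm_mult using r s B0 by (intro mult_mono E) auto
    qed
    also have "\<dots> = B / 4 * (\<Sum>s\<in>{..<M} - {r}. 1 / \<bar>of_int (?k r s)\<bar>)"
      by (simp add: sum_distrib_left)
    finally show "norm (\<Sum>s\<in>{..<M} - {r}. c (?k r s) * ?E (?k r s)) \<le>
       B / 4 * (\<Sum>s\<in>{..<M} - {r}. 1 / \<bar>of_int (?k r s)\<bar>)" .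
  qed
  also have "\<dots> \<le> (\<Sum>r<M. B / 4 * (2 * (1 + ln (real M))))"
    using B0 by (intro sum_mono mult_left_mono sum_inverse_dist_le) auto
  also have "\<dots> = real M * (B * (1 + ln (real M)) / 2)" by simp
  finally have "norm ((\<Sum>r<M. \<Sum>s\<in>{..<M} - {r}. c (?k r s) * ?E (?k r s)) / of_nat M) \<le> B * (1 + ln (real M)) / 2"
    using M by (simp add: norm_divide field_simps)
  then have "norm (complex_of_real (\<Sum>n\<in>S. W n * saw_poly M (y n + u)) - c 0 * ?E 0) \<le> B * (1 + ln (real M)) / 2"
    by (simp only: eq)
  then have "\<bar>Re (complex_of_real (\<Sum>n\<in>S. W n * saw_poly M (y n + u)) - c 0 * ?E 0)\<bar> \<le> B * (1 + ln (real M)) / 2"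
    using abs_Re_le_cmod order.trans by blast
  then show ?thesis by (simp add: c_def flip: of_real_sum)
qed

text \<open>The upper approximation for y and the lower one for y' have the same main term, a
  multiple of the total weight, and it cancels. Nonnegative weights allow the pointwise sandwich to
  be summed. Exchanging y and y' gives the bound from the other side.\<close>

lemma frac_equidistribution:
  fixes W y y' :: "'a \<Rightarrow> real"
  assumes M: "M > 0" and B0: "0 \<le> B" and W: "\<And>n. n \<in> S \<Longrightarrow> 0 \<le> W n"
    and B: "\<And>k. 1 \<le> k \<Longrightarrow> k < M \<Longrightarrow> norm (\<Sum>n\<in>S. of_real (W n) * e2pi (real k * y n)) \<le> B"
    and B': "\<And>k. 1 \<le> k \<Longrightarrow> k < M \<Longrightarrow> norm (\<Sum>n\<in>S. of_real (W n) * e2pi (real k * y' n)) \<le> B"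
  shows "(\<Sum>n\<in>S. W n * (frac (y n) - frac (y' n))) \<le> B * (1 + ln (real M)) + 5 * real M powr (- (1/3)) * (\<Sum>n\<in>S. W n)"
proof -
  \<comment> \<open>This choice balances 2 \<eta> against 1 / (4 M \<eta>^2).\<close>
  define \<eta> where "\<eta> = real M powr (- (1/3))"
  define err where "err = 2 * \<eta> + 1 / (4 * real M * \<eta>\<^sup>2)"
  have \<eta>: "0 < \<eta>" using M by (simp add: \<eta>_def)
  have "\<eta>\<^sup>2 = real M powr (- (2/3))" using M by (simp add: \<eta>_def power2_eq_square flip: powr_add)
  moreover have "real M powr (1/3) = real M powr (1 + - (2/3))" by simp
  then have "real M powr (1/3) = real M * real M powr (- (2/3))" unfolding powr_add by simp
  ultimately have "real M * \<eta>\<^sup>2 = real M powr (1/3)" by simp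
  then have "1 / (4 * real M * \<eta>\<^sup>2) = \<eta> / 4" by (simp add: mult.assoc \<eta>_def powr_minus_divide)
  then have "err = 2 * \<eta> + \<eta> / 4" by (simp only: err_def)
  then have err: "2 * err \<le> 5 * \<eta>" using \<eta> by linarith
  let ?c = "Re (saw_coeff (2 * M) 0)"
  have "(\<Sum>n\<in>S. W n * (frac (y n) - frac (y' n))) \<le>
      (\<Sum>n\<in>S. W n * ((saw_poly M (y n + - \<eta>) + err) - (saw_poly M (y' n + \<eta>) - err)))"
  proof (intro sum_mono mult_left_mono diff_mono W)
    fix n
    show "frac (y n) \<le> saw_poly M (y n + - \<eta>) + err"
      using saw_poly_bounds(1)[OF M \<eta>, of "y n"] by (simp add: err_def)
    show "saw_poly M (y' n + \<eta>) - err \<le> frac (y' n)"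
      using saw_poly_bounds(2)[OF M \<eta>, of "y' n"] by (simp add: err_def)
  qed
  also have "\<dots> = (\<Sum>n\<in>S. W n * saw_poly M (y n + - \<eta>)) - (\<Sum>n\<in>S. W n * saw_poly M (y' n + \<eta>)) + 2 * err * (\<Sum>n\<in>S. W n)"
    by (simp add: algebra_simps sum.distrib sum_subtractf flip: sum_distrib_left sum_distrib_right)
  also have "\<dots> \<le> (?c * (\<Sum>n\<in>S. W n) + B * (1 + ln (real M)) / 2) - (?c * (\<Sum>n\<in>S. W n) - B * (1 + ln (real M)) / 2)
      + 5 * \<eta> * (\<Sum>n\<in>S. W n)"
  proof -
    have 1: "(\<Sum>n\<in>S. W n * saw_poly M (y n + - \<eta>)) - ?c * (\<Sum>n\<in>S. W n) \<le> B * (1 + ln (real M)) / 2"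
      using saw_poly_sum[OF M B0 B, where u = "- \<eta>"] by (rule abs_le_D1)
    have 2: "- ((\<Sum>n\<in>S. W n * saw_poly M (y' n + \<eta>)) - ?c * (\<Sum>n\<in>S. W n)) \<le> B * (1 + ln (real M)) / 2"
      using saw_poly_sum[OF M B0 B', where u = \<eta>] by (rule abs_le_D2)
    have 3: "2 * err * (\<Sum>n\<in>S. W n) \<le> 5 * \<eta> * (\<Sum>n\<in>S. W n)"
      using W by (intro mult_right_mono err sum_nonneg) auto
    from 1 2 3 show ?thesis by linarith
  qed
  finally show ?thesis by (simp add: \<eta>_def)
qed

section \<open>The inverse function\<close>

lemma deriv_on_interior:
  assumes "f differentiable_on {a..}" "a < x"
  shows "(f has_real_derivative deriv_on {a..} f x) (at x)"
proof -
  have at: "at x within {a..} = at x" using assms(2) by (intro at_within_interior) simp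
  have "f differentiable (at x within {a..})" using assms by (simp add: differentiable_on_def)
  then show ?thesis
    by (simp add: deriv_on_def at vector_derivative_works has_real_derivative_iff_has_vector_derivative)
qed

text \<open>Differentiating the integral representation gives the logarithmic derivative x h'(x) /
  h(x) = c + \<theta>(x), from which all later estimates start. Beyond x0 the derivatives relative
  to the half-line are ordinary ones.\<close>

lemma family_theta:
  assumes "in_family c x0 h"
  obtains \<theta> \<theta>1 \<theta>2 where
    "\<And>x. x0 < x \<Longrightarrow> (\<theta> has_real_derivative \<theta>1 x) (at x)"
    "\<And>x. x0 < x \<Longrightarrow> (\<theta>1 has_real_derivative \<theta>2 x) (at x)"
    "\<And>x. x0 < x \<Longrightarrow> (h has_real_derivative h x * (c + \<theta> x) / x) (at x)"
    "(\<theta> \<longlongrightarrow> 0) at_top"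
    "c > 1 \<Longrightarrow> ((\<lambda>x. x * \<theta>1 x) \<longlongrightarrow> 0) at_top \<and> ((\<lambda>x. x\<^sup>2 * \<theta>2 x) \<longlongrightarrow> 0) at_top"
    "c = 1 \<Longrightarrow> (\<forall>x\<ge>x0. \<theta> x > 0) \<and> (\<forall>\<epsilon>>0. \<exists>K. \<forall>x\<ge>x0. 1 / \<theta> x \<le> K * x powr \<epsilon>)
       \<and> ((\<lambda>x. x / h x) \<longlongrightarrow> 0) at_top
       \<and> ((\<lambda>x. x * \<theta>1 x / \<theta> x) \<longlongrightarrow> 0) at_top \<and> ((\<lambda>x. x\<^sup>2 * \<theta>2 x / \<theta> x) \<longlongrightarrow> 0) at_top"
proof -
  let ?S = "{x0..}"
  from assms obtain \<theta> C where c: "1 \<le> c" "1 \<le> x0" and \<theta>: "C_diff_on 2 ?S \<theta>" "C > 0"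
    and h: "\<forall>x\<ge>x0. h x = C * x powr c * exp (integral {x0..x} (\<lambda>t. \<theta> t / t))"
    and c1: "c > 1 \<longrightarrow> (\<theta> \<longlongrightarrow> 0) at_top \<and> ((\<lambda>x. x * deriv_on ?S \<theta> x) \<longlongrightarrow> 0) at_top \<and>
           ((\<lambda>x. x\<^sup>2 * (deriv_on ?S ^^ 2) \<theta> x) \<longlongrightarrow> 0) at_top"
    and c2: "c = 1 \<longrightarrow> (\<forall>x\<ge>x0. \<theta> x > 0) \<and> antimono_on ?S \<theta> \<and>
           (\<forall>\<epsilon>>0. \<exists>K. \<forall>x\<ge>x0. 1 / \<theta> x \<le> K * x powr \<epsilon>) \<and>
           ((\<lambda>x. x / h x) \<longlongrightarrow> 0) at_top \<and> (\<theta> \<longlongrightarrow> 0) at_top \<and>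
           ((\<lambda>x. x * deriv_on ?S \<theta> x / \<theta> x) \<longlongrightarrow> 0) at_top \<and>
           ((\<lambda>x. x\<^sup>2 * (deriv_on ?S ^^ 2) \<theta> x / \<theta> x) \<longlongrightarrow> 0) at_top"
    unfolding in_family_def by blast
  have d: "(deriv_on ?S ^^ j) \<theta> differentiable_on ?S" if "j < 2" for j
    using \<theta>(1) that unfolding C_diff_on_def by blast
  have d0: "\<theta> differentiable_on ?S" using d[of 0] by simp
  have d1: "deriv_on ?S \<theta> differentiable_on ?S" using d[of 1] by simp
  have two: "(deriv_on ?S ^^ 2) \<theta> = deriv_on ?S (deriv_on ?S \<theta>)" by (simp add: numeral_2_eq_2)
  show thesis
  proof (rule that[of \<theta> "deriv_on ?S \<theta>" "deriv_on ?S (deriv_on ?S \<theta>)"])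
    fix x assume x: "x0 < x"
    show "(\<theta> has_real_derivative deriv_on ?S \<theta> x) (at x)" by (rule deriv_on_interior[OF d0 x])
    show "(deriv_on ?S \<theta> has_real_derivative deriv_on ?S (deriv_on ?S \<theta>) x) (at x)"
      by (rule deriv_on_interior[OF d1 x])
    let ?I = "\<lambda>x. integral {x0..x} (\<lambda>t. \<theta> t / t)"
    have "continuous_on {x0..x + 1} (\<lambda>t. \<theta> t / t)"
    proof (intro continuous_on_divide continuous_on_id)
      show "continuous_on {x0..x + 1} \<theta>"
        by (rule continuous_on_subset[OF differentiable_imp_continuous_on[OF d0]]) auto
    qed (use c in auto)
    from integral_has_real_derivative[OF this, of x]
    have "(?I has_real_derivative \<theta> x / x) (at x within {x0..x + 1})" using x by simp
    moreover have "at x within {x0..x + 1} = at x" using x by (intro at_within_interior) simp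
    ultimately have I: "(?I has_real_derivative \<theta> x / x) (at x)" by simp
    have x1: "0 < x" using x c by simp
    have "((\<lambda>x. C * x powr c * exp (?I x)) has_real_derivative
       C * (c * x powr (c - 1)) * exp (?I x) + C * x powr c * (exp (?I x) * (\<theta> x / x))) (at x)"
      by (rule derivative_eq_intros I refl | use x1 in simp)+
    also have "C * (c * x powr (c - 1)) * exp (?I x) + C * x powr c * (exp (?I x) * (\<theta> x / x)) =
        h x * (c + \<theta> x) / x"
      using h x x1 by (simp add: powr_diff field_simps)
    finally show "(h has_real_derivative h x * (c + \<theta> x) / x) (at x)"
    proof (rule has_field_derivative_transform_within_open[of _ _ _ "{x0<..}"])
      show "\<And>y. y \<in> {x0<..} \<Longrightarrow> C * y powr c * exp (?I y) = h y" using h by simp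
    qed (use x in auto)
  next
    show "(\<theta> \<longlongrightarrow> 0) at_top" using c1 c2 c by (cases "c > 1") auto
  qed (use c1 c2 two in auto)
qed

text \<open>ln h - a ln x has derivative (c + \<theta> - a)/x, whose sign is eventually fixed for a
  = c - \<epsilon>/2 and for a = c + \<epsilon>/2. The other half of \<epsilon> absorbs the
  constants of integration.\<close>

lemma family_growth:
  fixes h \<theta> :: "real \<Rightarrow> real"
  assumes h: "\<And>x. x0 < x \<Longrightarrow> (h has_real_derivative h x * (c + \<theta> x) / x) (at x)"
    and pos: "\<And>x. x0 \<le> x \<Longrightarrow> 0 < h x" and x0: "1 \<le> x0" and \<theta>: "(\<theta> \<longlongrightarrow> 0) at_top" and \<epsilon>: "0 < \<epsilon>"
  shows "eventually (\<lambda>x. x powr (c - \<epsilon>) \<le> h x \<and> h x \<le> x powr (c + \<epsilon>)) at_top"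
proof -
  have "eventually (\<lambda>x. \<bar>\<theta> x\<bar> < \<epsilon> / 2) at_top"
    using tendstoD[OF \<theta>, of "\<epsilon> / 2"] \<epsilon> by (simp add: dist_real_def)
  then obtain x1' where x1': "\<And>x. x \<ge> x1' \<Longrightarrow> \<bar>\<theta> x\<bar> < \<epsilon> / 2" by (auto simp: eventually_at_top_linorder)
  define x1 where "x1 = max (x0 + 1) x1'"
  have x1: "x0 < x1" "\<And>x. x \<ge> x1 \<Longrightarrow> \<bar>\<theta> x\<bar> < \<epsilon> / 2" using x1' by (auto simp: x1_def)
  have D: "((\<lambda>x. ln (h x) - a * ln x) has_real_derivative (c + \<theta> x - a) / x) (at x)" if "x1 \<le> x" for x a
  proof -
    have x: "0 < h x" "0 < x" "x0 < x" using that x1(1) pos[of x] x0 by auto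
    have "((\<lambda>x. ln (h x) - a * ln x) has_real_derivative (h x * (c + \<theta> x) / x) / h x - a * (1 / x)) (at x)"
      by (rule derivative_eq_intros h refl | use x in simp)+
    moreover have "(h x * (c + \<theta> x) / x) / h x - a * (1 / x) = (c + \<theta> x - a) / x"
      using x by (simp add: diff_divide_distrib)
    ultimately show ?thesis by simp
  qed
  define K1 where "K1 = ln (h x1) - (c - \<epsilon> / 2) * ln x1"
  define K2 where "K2 = ln (h x1) - (c + \<epsilon> / 2) * ln x1"
  have lower: "K1 \<le> ln (h x) - (c - \<epsilon> / 2) * ln x" if "x1 \<le> x" for x
    unfolding K1_def
  proof (rule DERIV_nonneg_imp_nondecreasing[OF that])
    fix t assume t: "x1 \<le> t" "t \<le> x"
    have "0 \<le> (c + \<theta> t - (c - \<epsilon> / 2)) / t" using x1(2)[OF t(1)] t x1(1) x0 by simp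
    then show "\<exists>y. ((\<lambda>x. ln (h x) - (c - \<epsilon> / 2) * ln x) has_real_derivative y) (at t) \<and> 0 \<le> y"
      using D[OF t(1)] by blast
  qed
  have upper: "ln (h x) - (c + \<epsilon> / 2) * ln x \<le> K2" if "x1 \<le> x" for x
    unfolding K2_def
  proof (rule DERIV_nonpos_imp_nonincreasing[OF that])
    fix t assume t: "x1 \<le> t" "t \<le> x"
    have "(c + \<theta> t - (c + \<epsilon> / 2)) / t \<le> 0" using x1(2)[OF t(1)] t x1(1) x0 by (simp add: divide_nonpos_pos)
    then show "\<exists>y. ((\<lambda>x. ln (h x) - (c + \<epsilon> / 2) * ln x) has_real_derivative y) (at t) \<and> y \<le> 0"
      using D[OF t(1)] by blast
  qed
  have "filterlim (\<lambda>x::real. (\<epsilon> / 2) * ln x) at_top at_top"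
    using \<epsilon> by (intro filterlim_tendsto_pos_mult_at_top[OF tendsto_const] ln_at_top) simp
  then have "eventually (\<lambda>x. max (- K1) K2 \<le> (\<epsilon> / 2) * ln x) at_top"
    by (simp add: filterlim_at_top)
  moreover have "eventually (\<lambda>x. x1 \<le> x) at_top" by (rule eventually_ge_at_top)
  ultimately show ?thesis
  proof eventually_elim
    case (elim x)
    have x: "0 < h x" "0 < x" using elim x1(1) pos[of x] x0 by auto
    have "(c - \<epsilon>) * ln x \<le> ln (h x)" using lower[of x] elim by (simp add: algebra_simps)
    moreover have "ln (h x) \<le> (c + \<epsilon>) * ln x" using upper[of x] elim by (simp add: algebra_simps)
    ultimately have "exp ((c - \<epsilon>) * ln x) \<le> exp (ln (h x))" "exp (ln (h x)) \<le> exp ((c + \<epsilon>) * ln x)"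
      by simp_all
    then show ?case using x by (simp add: powr_def)
  qed
qed

text \<open>
  At \<open>x = \<phi>(y)\<close> one has \<open>y\<^sup>2 \<phi>''(y) = - curv x (c + \<theta> x) (\<theta>' x)\<close>. The arguments of \<open>curv'\<close> are
  \<open>c + \<theta>\<close>, \<open>x \<theta>'\<close> and \<open>x\<^sup>2 \<theta>''\<close>, the quantities controlled by the definition of the family.
\<close>

definition curv :: "real \<Rightarrow> real \<Rightarrow> real \<Rightarrow> real" where
  "curv x p t = x * (p - 1) / p\<^sup>2 + x\<^sup>2 * t / p ^ 3"

definition curv' :: "real \<Rightarrow> real \<Rightarrow> real \<Rightarrow> real" where
  "curv' p u v = (p - 1) / p\<^sup>2 + u / p\<^sup>2 + 2 * u / p ^ 3 - 2 * (p - 1) * u / p ^ 3 + v / p ^ 3 - 3 * u\<^sup>2 / p ^ 4"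

lemma curv_deriv:
  assumes "(\<theta> has_real_derivative \<theta>1 x) (at x)" "(\<theta>1 has_real_derivative t2) (at x)" "c + \<theta> x \<noteq> 0"
  shows "((\<lambda>x. curv x (c + \<theta> x) (\<theta>1 x)) has_real_derivative curv' (c + \<theta> x) (x * \<theta>1 x) (x\<^sup>2 * t2)) (at x)"
proof -
  define p where "p = c + \<theta> x"
  have p: "p \<noteq> 0" using assms(3) by (simp add: p_def)
  have dp: "((\<lambda>x. c + \<theta> x) has_real_derivative \<theta>1 x) (at x)"
    using assms(1) by (auto intro!: derivative_eq_intros)
  have dp2: "((\<lambda>x. (c + \<theta> x)\<^sup>2) has_real_derivative 2 * p * \<theta>1 x) (at x)"
    by (rule derivative_eq_intros dp refl | simp add: p_def)+
  have dp3: "((\<lambda>x. (c + \<theta> x) ^ 3) has_real_derivative 3 * p\<^sup>2 * \<theta>1 x) (at x)"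
    by (rule derivative_eq_intros dp refl | simp add: p_def)+
  have n1: "((\<lambda>x. x * (c + \<theta> x - 1)) has_real_derivative (p - 1) + x * \<theta>1 x) (at x)"
    by (rule derivative_eq_intros assms(1) refl | simp add: p_def)+
  have n2: "((\<lambda>x. x\<^sup>2 * \<theta>1 x) has_real_derivative 2 * x * \<theta>1 x + x\<^sup>2 * t2) (at x)"
    using assms(2) by (auto intro!: derivative_eq_intros)
  have "((\<lambda>x. curv x (c + \<theta> x) (\<theta>1 x)) has_real_derivative
     (((p - 1) + x * \<theta>1 x) * p\<^sup>2 - x * (p - 1) * (2 * p * \<theta>1 x)) / (p\<^sup>2 * p\<^sup>2) +
     ((2 * x * \<theta>1 x + x\<^sup>2 * t2) * p ^ 3 - x\<^sup>2 * \<theta>1 x * (3 * p\<^sup>2 * \<theta>1 x)) / (p ^ 3 * p ^ 3)) (at x)"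
    unfolding curv_def using p
    by (intro DERIV_add DERIV_divide[OF n1 dp2, folded p_def] DERIV_divide[OF n2 dp3, folded p_def]) auto
  moreover have "(((p - 1) + x * \<theta>1 x) * p\<^sup>2 - x * (p - 1) * (2 * p * \<theta>1 x)) / (p\<^sup>2 * p\<^sup>2) +
     ((2 * x * \<theta>1 x + x\<^sup>2 * t2) * p ^ 3 - x\<^sup>2 * \<theta>1 x * (3 * p\<^sup>2 * \<theta>1 x)) / (p ^ 3 * p ^ 3)
     = curv' p (x * \<theta>1 x) (x\<^sup>2 * t2)"
    using p unfolding curv'_def by (simp add: field_simps power2_eq_square power3_eq_cube eval_nat_numeral)
  ultimately show ?thesis by (simp add: p_def)
qed

lemma powr_eventually_ge:
  assumes "0 < \<epsilon>" shows "eventually (\<lambda>x::real. K \<le> x powr \<epsilon>) at_top"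
proof -
  have "eventually (\<lambda>x. max K 1 powr (1 / \<epsilon>) \<le> x) at_top" by (rule eventually_ge_at_top)
  then show ?thesis
  proof eventually_elim
    case (elim x)
    have "K \<le> (max K 1 powr (1 / \<epsilon>)) powr \<epsilon>" using assms by (simp add: powr_powr)
    also have "\<dots> \<le> x powr \<epsilon>" using elim assms by (intro powr_mono2) auto
    finally show ?case .
  qed
qed

text \<open>For c > 1 both normalised quantities tend to (c - 1)/c^2 > 0. For c = 1 this limit is 0
  and \<theta> takes over as the leading term: it can be factored out of every summand, the
  cofactors tend to 1, and the lower bound x^(-\<epsilon>) comes from the growth condition on
  1/\<theta>.\<close>

lemma curv_bounds:
  fixes \<theta> \<theta>1 \<theta>2 :: "real \<Rightarrow> real"
  assumes c: "1 \<le> c" "c < 2" and \<theta>: "(\<theta> \<longlongrightarrow> 0) at_top"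
    and c1: "c > 1 \<Longrightarrow> ((\<lambda>x. x * \<theta>1 x) \<longlongrightarrow> 0) at_top \<and> ((\<lambda>x. x\<^sup>2 * \<theta>2 x) \<longlongrightarrow> 0) at_top"
    and c2: "c = 1 \<Longrightarrow> (\<forall>x\<ge>x0. \<theta> x > 0) \<and> (\<forall>\<epsilon>>0. \<exists>K. \<forall>x\<ge>x0. 1 / \<theta> x \<le> K * x powr \<epsilon>)
       \<and> ((\<lambda>x. x * \<theta>1 x / \<theta> x) \<longlongrightarrow> 0) at_top \<and> ((\<lambda>x. x\<^sup>2 * \<theta>2 x / \<theta> x) \<longlongrightarrow> 0) at_top"
    and \<epsilon>: "0 < \<epsilon>"
  shows "eventually (\<lambda>x. x powr (1 - \<epsilon>) \<le> curv x (c + \<theta> x) (\<theta>1 x) \<and> curv x (c + \<theta> x) (\<theta>1 x) \<le> x \<and>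
     x powr (- \<epsilon>) \<le> curv' (c + \<theta> x) (x * \<theta>1 x) (x\<^sup>2 * \<theta>2 x)) at_top"
proof -
  define R where "R = (\<lambda>x. (c + \<theta> x - 1) / (c + \<theta> x)\<^sup>2 + x * \<theta>1 x / (c + \<theta> x) ^ 3)"
  define R' where "R' = (\<lambda>x. curv' (c + \<theta> x) (x * \<theta>1 x) (x\<^sup>2 * \<theta>2 x))"
  have p: "((\<lambda>x. c + \<theta> x) \<longlongrightarrow> c) at_top" using tendsto_add[OF tendsto_const \<theta>, of c] by simp
  have *: "eventually (\<lambda>x. x powr (- \<epsilon>) \<le> R x \<and> R x \<le> 1 \<and> x powr (- \<epsilon>) \<le> R' x) at_top"
  proof (cases "c > 1")
    case True
    note u = conjunct1[OF c1[OF True]] and v = conjunct2[OF c1[OF True]]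
    have "(R \<longlongrightarrow> (c - 1) / c\<^sup>2 + 0 / c ^ 3) at_top"
      unfolding R_def using c by (intro tendsto_intros p u) auto
    then have R: "(R \<longlongrightarrow> (c - 1) / c\<^sup>2) at_top" by simp
    have "(R' \<longlongrightarrow> (c - 1) / c\<^sup>2 + 0 / c\<^sup>2 + 2 * 0 / c ^ 3 - 2 * (c - 1) * 0 / c ^ 3 + 0 / c ^ 3 - 3 * 0\<^sup>2 / c ^ 4) at_top"
      unfolding R'_def curv'_def using c by (intro tendsto_intros p u v) auto
    then have R': "(R' \<longlongrightarrow> (c - 1) / c\<^sup>2) at_top" by simp
    define r where "r = (c - 1) / c\<^sup>2"
    define a where "a = r / 2"
    have "0 < r" using True by (simp add: r_def)
    then have a: "0 < a" "a < (c - 1) / c\<^sup>2" by (simp_all add: a_def r_def[symmetric])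
    have le: "(c - 1) / c\<^sup>2 < 1" using c mult_mono[of 1 c 1 c] by (simp add: divide_less_eq power2_eq_square)
    have "eventually (\<lambda>x. a < R x) at_top" by (rule order_tendstoD(1)[OF R a(2)])
    moreover have "eventually (\<lambda>x. a < R' x) at_top" by (rule order_tendstoD(1)[OF R' a(2)])
    moreover have "eventually (\<lambda>x. R x < 1) at_top" by (rule order_tendstoD(2)[OF R le])
    moreover have "eventually (\<lambda>x. 1 / a \<le> x powr \<epsilon>) at_top" by (rule powr_eventually_ge[OF \<epsilon>])
    ultimately show ?thesis
    proof eventually_elim
      case (elim x)
      have "x powr (- \<epsilon>) \<le> a"
        using elim(4) a(1) by (simp add: powr_minus_divide divide_le_eq split: if_splits) (simp add: field_simps)
      then show ?case using elim by simp
    qed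
  next
    case False
    then have c0: "c = 1" using c by simp
    have pos: "\<And>x. x0 \<le> x \<Longrightarrow> \<theta> x > 0" and K: "\<forall>\<epsilon>>0. \<exists>K. \<forall>x\<ge>x0. 1 / \<theta> x \<le> K * x powr \<epsilon>"
      and u: "((\<lambda>x. x * \<theta>1 x / \<theta> x) \<longlongrightarrow> 0) at_top" and v: "((\<lambda>x. x\<^sup>2 * \<theta>2 x / \<theta> x) \<longlongrightarrow> 0) at_top"
      using c2[OF c0] by auto
    define P where "P = (\<lambda>x. 1 + \<theta> x)"
    define u' where "u' = (\<lambda>x. x * \<theta>1 x / \<theta> x)"
    define v' where "v' = (\<lambda>x. x\<^sup>2 * \<theta>2 x / \<theta> x)"
    have P: "(P \<longlongrightarrow> 1) at_top" using p by (simp add: P_def c0)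
    have u': "(u' \<longlongrightarrow> 0) at_top" and v': "(v' \<longlongrightarrow> 0) at_top" using u v by (auto simp: u'_def v'_def)
    define S where "S = (\<lambda>x. 1 / (P x)\<^sup>2 + u' x / (P x) ^ 3)"
    define S' where "S' = (\<lambda>x. 1 / (P x)\<^sup>2 + u' x / (P x)\<^sup>2 + 2 * u' x / (P x) ^ 3 - 2 * \<theta> x * u' x / (P x) ^ 3
        + v' x / (P x) ^ 3 - 3 * \<theta> x * (u' x)\<^sup>2 / (P x) ^ 4)"
    have "(S \<longlongrightarrow> 1 / 1\<^sup>2 + 0 / 1 ^ 3) at_top" unfolding S_def by (intro tendsto_intros P u') auto
    then have S: "(S \<longlongrightarrow> 1) at_top" by simp
    have "(S' \<longlongrightarrow> 1 / 1\<^sup>2 + 0 / 1\<^sup>2 + 2 * 0 / 1 ^ 3 - 2 * 0 * 0 / 1 ^ 3 + 0 / 1 ^ 3 - 3 * 0 * 0\<^sup>2 / 1 ^ 4) at_top"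
      unfolding S'_def by (intro tendsto_intros P u' v' \<theta>) auto
    then have S': "(S' \<longlongrightarrow> 1) at_top" by simp
    have RS: "R x = \<theta> x * S x" "R' x = \<theta> x * S' x" if "x0 \<le> x" for x
    proof -
      have t: "\<theta> x > 0" using pos[OF that] .
      have tu: "x * \<theta>1 x = \<theta> x * u' x" "x\<^sup>2 * \<theta>2 x = \<theta> x * v' x" using t by (auto simp: u'_def v'_def)
      have Pn: "P x > 0" using t by (simp add: P_def)
      show "R x = \<theta> x * S x" unfolding R_def S_def tu c0 using Pn
        by (simp add: P_def[symmetric]) (simp add: P_def distrib_left)
      have "R' x = curv' (P x) (\<theta> x * u' x) (\<theta> x * v' x)" unfolding R'_def tu c0 P_def ..
      also have "\<dots> = \<theta> x * S' x"
      proof -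
        have "P x - 1 = \<theta> x" by (simp add: P_def)
        then show ?thesis unfolding curv'_def S'_def by (simp add: algebra_simps power2_eq_square)
      qed
      finally show "R' x = \<theta> x * S' x" .
    qed
    have R0: "((\<lambda>x. \<theta> x * S x) \<longlongrightarrow> 0 * 1) at_top" by (intro tendsto_mult \<theta> S)
    obtain K where K: "\<And>x. x \<ge> x0 \<Longrightarrow> 1 / \<theta> x \<le> K * x powr (\<epsilon> / 2)" using K \<epsilon> by (meson half_gt_zero)
    have "eventually (\<lambda>x. 1/2 < S x) at_top" by (rule order_tendstoD(1)[OF S]) simp
    moreover have "eventually (\<lambda>x. 1/2 < S' x) at_top" by (rule order_tendstoD(1)[OF S']) simp
    moreover have "eventually (\<lambda>x. \<theta> x * S x < 1) at_top" by (rule order_tendstoD(2)[OF R0]) simp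
    moreover have "eventually (\<lambda>x. 2 * K \<le> x powr (\<epsilon> / 2)) at_top" using \<epsilon> by (intro powr_eventually_ge) simp
    moreover have "eventually (\<lambda>x. max 1 x0 \<le> x) at_top" by (rule eventually_ge_at_top)
    ultimately show ?thesis
    proof eventually_elim
      case (elim x)
      have t: "\<theta> x > 0" using pos elim by simp
      have x: "0 < x powr \<epsilon>" "0 < x powr (\<epsilon> / 2)" using elim by auto
      have "2 * (1 / \<theta> x) \<le> 2 * (K * x powr (\<epsilon> / 2))" using K[of x] elim by (intro mult_left_mono) auto
      also have "\<dots> = (2 * K) * x powr (\<epsilon> / 2)" by simp
      also have "\<dots> \<le> x powr (\<epsilon> / 2) * x powr (\<epsilon> / 2)" using elim by (intro mult_right_mono) auto
      also have "\<dots> = x powr \<epsilon>" by (simp flip: powr_add)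
      finally have "x powr (- \<epsilon>) \<le> \<theta> x * (1/2)" using t x by (simp add: powr_minus_divide field_simps)
      moreover have "\<theta> x * (1/2) \<le> \<theta> x * S x" "\<theta> x * (1/2) \<le> \<theta> x * S' x"
        using t elim by (auto intro!: mult_left_mono simp del: mult_le_cancel_left_pos)
      ultimately show ?case using RS[of x] elim by simp
    qed
  qed
  have "eventually (\<lambda>x. (1::real) \<le> x) at_top" by (rule eventually_ge_at_top)
  with * show ?thesis
  proof eventually_elim
    case (elim x)
    have E: "curv x (c + \<theta> x) (\<theta>1 x) = x * R x"
      by (simp add: curv_def R_def distrib_left power2_eq_square mult_ac)
    have "x * x powr (- \<epsilon>) \<le> x * R x" "x * R x \<le> x * 1" using elim by (auto intro!: mult_left_mono)
    moreover have "x * x powr (- \<epsilon>) = x powr (1 - \<epsilon>)" using elim by (simp add: powr_diff powr_minus_divide)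
    ultimately show ?case using elim E by (simp add: R'_def)
  qed
qed

text \<open>\<open>h\<close> increases strictly since its derivative is positive, and it is
  unbounded by \<open>family_growth\<close>; hence \<open>inv_into\<close> is a genuine inverse on
  [h(x0), oo). Its derivative is 1/h' rewritten through c + \<theta>.\<close>

lemma family_inverse:
  fixes h \<phi> :: "real \<Rightarrow> real"
  assumes fam: "in_family c x0 h" and \<phi>: "\<phi> = inv_into {x0..} h"
    and h': "\<forall>x>x0. (h has_real_derivative h x * (c + \<theta> x) / x) (at x)"
    and \<theta>: "(\<theta> \<longlongrightarrow> 0) at_top"
  shows "\<And>y. h x0 \<le> y \<Longrightarrow> x0 \<le> \<phi> y \<and> h (\<phi> y) = y"
    and "\<And>x. x0 \<le> x \<Longrightarrow> \<phi> (h x) = x"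
    and "\<And>x y. x0 \<le> x \<Longrightarrow> x < y \<Longrightarrow> h x < h y"
    and "\<And>y. h x0 < y \<Longrightarrow> (\<phi> has_real_derivative \<phi> y / (y * (c + \<theta> (\<phi> y)))) (at y)"
    and "\<And>x. x0 < x \<Longrightarrow> 0 < c + \<theta> x"
proof -
  from fam have c: "1 \<le> c" and x0: "1 \<le> x0" and h1: "\<And>x. x0 \<le> x \<Longrightarrow> 1 \<le> h x"
    and Ch: "C_diff_on 3 {x0..} h" and hp: "\<And>x. x0 \<le> x \<Longrightarrow> 0 < deriv_on {x0..} h x"
    unfolding in_family_def by auto
  have D: "(h has_real_derivative h x * (c + \<theta> x) / x) (at x)" if "x0 < x" for x
    using h' that by blast
  have "(deriv_on {x0..} ^^ 0) h differentiable_on {x0..}"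
    using Ch unfolding C_diff_on_def by (metis zero_less_numeral)
  then have hd: "h differentiable_on {x0..}" by simp
  have cont: "continuous_on {x0..} h" by (rule differentiable_imp_continuous_on[OF hd])
  have pos: "0 < h x * (c + \<theta> x) / x" if "x0 < x" for x
    using DERIV_unique[OF D[OF that] deriv_on_interior[OF hd that]] hp[of x] that by simp
  show mono: "h x < h y" if "x0 \<le> x" "x < y" for x y
  proof (rule DERIV_pos_imp_increasing_open[OF that(2)])
    fix t assume "x < t" "t < y"
    then show "\<exists>z. (h has_real_derivative z) (at t) \<and> 0 < z" using D[of t] pos[of t] that by auto
  qed (use that in \<open>auto intro: continuous_on_subset[OF cont]\<close>)
  then have inj: "inj_on h {x0..}"
    by (intro inj_onI) (metis atLeast_iff linorder_neqE_linordered_idom order_less_irrefl)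
  show \<phi>h: "\<phi> (h x) = x" if "x0 \<le> x" for x
    unfolding \<phi> by (rule inv_into_f_f[OF inj]) (use that in simp)
  have "eventually (\<lambda>x. x powr (c - 1/2) \<le> h x \<and> h x \<le> x powr (c + 1/2)) at_top"
    using h1 by (intro family_growth[OF D _ x0 \<theta>]) force+
  then obtain z where z: "\<And>x. x \<ge> z \<Longrightarrow> x powr (c - 1/2) \<le> h x" by (auto simp: eventually_at_top_linorder)
  have surj: "\<exists>x\<ge>x0. h x = y" if y: "h x0 \<le> y" for y
  proof -
    \<comment> \<open>Beyond z the growth bound with exponent c - 1/2 \<ge> 1/2 holds, so b \<ge>
      y^2 already gives h b \<ge> y.\<close>
    define b where "b = max (max z x0) (max 1 y ^ 2)"
    have y1: "1 \<le> y" using h1[of x0] y by simp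
    have "y = (y ^ 2) powr (1/2)" using y1 by (simp add: powr_half_sqrt)
    also have "\<dots> \<le> b powr (1/2)" using y1 by (intro powr_mono2) (auto simp: b_def max_def)
    also have "\<dots> \<le> b powr (c - 1/2)" using c x0 by (intro powr_mono) (auto simp: b_def)
    also have "\<dots> \<le> h b" by (rule z) (simp add: b_def)
    finally have "y \<le> h b" .
    moreover have "x0 \<le> b" by (simp add: b_def)
    ultimately have "\<exists>x. x0 \<le> x \<and> x \<le> b \<and> h x = y"
      using y by (intro IVT') (auto intro: continuous_on_subset[OF cont])
    then show ?thesis by blast
  qed
  show inv: "x0 \<le> \<phi> y \<and> h (\<phi> y) = y" if "h x0 \<le> y" for y
  proof -
    have "y \<in> h ` {x0..}" using surj[OF that] by auto
    then have "\<phi> y \<in> {x0..}" "h (\<phi> y) = y"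
      unfolding \<phi> by (rule inv_into_into, rule f_inv_into_f)
    then show ?thesis by simp
  qed
  show p: "0 < c + \<theta> x" if "x0 < x" for x
    using pos[OF that] h1[of x] that x0 by (simp add: zero_less_divide_iff zero_less_mult_iff)
  show "(\<phi> has_real_derivative \<phi> y / (y * (c + \<theta> (\<phi> y)))) (at y)" if y: "h x0 < y" for y
  proof -
    define x where "x = \<phi> y"
    have x: "x0 \<le> x" "h x = y" using inv[of y] y by (auto simp: x_def)
    then have x': "x0 < x" using y by (cases "x = x0") auto
    define a where "a = (x0 + x) / 2"
    have a: "x0 < a" "a < x" using x' by (auto simp: a_def)
    have "isCont \<phi> (h x)"
    proof (rule isCont_inverse_function2[of a x "x + 1"])
      show "\<phi> (h t) = t" if "a \<le> t" "t \<le> x + 1" for t using that a by (intro \<phi>h) simp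
      show "isCont h t" if "a \<le> t" "t \<le> x + 1" for t using DERIV_isCont[OF D[of t]] that a by simp
    qed (use a in auto)
    then have "isCont \<phi> y" using x by simp
    then have "(\<phi> has_real_derivative inverse (h x * (c + \<theta> x) / x)) (at y)"
      using D[OF x'] pos[OF x'] y inv
      by (intro DERIV_inverse_function[where f = h and a = "h x0" and b = "y + 1"]) (auto simp: x_def)
    then show ?thesis using x by (simp add: x_def)
  qed
qed

lemma inverse_derivatives:
  fixes \<phi> \<theta> \<theta>1 \<theta>2 :: "real \<Rightarrow> real"
  assumes \<phi>: "(\<phi> has_real_derivative \<phi> y / (y * (c + \<theta> (\<phi> y)))) (at y)"
    and \<theta>: "(\<theta> has_real_derivative \<theta>1 (\<phi> y)) (at (\<phi> y))"
    and \<theta>1: "(\<theta>1 has_real_derivative \<theta>2 (\<phi> y)) (at (\<phi> y))"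
    and p: "0 < c + \<theta> (\<phi> y)" and y0: "0 < y"
  defines "E \<equiv> \<lambda>x. curv x (c + \<theta> x) (\<theta>1 x)" and "E' \<equiv> \<lambda>x. curv' (c + \<theta> x) (x * \<theta>1 x) (x\<^sup>2 * \<theta>2 x)"
  shows "((\<lambda>y. \<phi> y / (y * (c + \<theta> (\<phi> y)))) has_real_derivative - (E (\<phi> y) / y\<^sup>2)) (at y)"
    and "((\<lambda>y. - E (\<phi> y)) has_real_derivative - (E' (\<phi> y) * (\<phi> y / (y * (c + \<theta> (\<phi> y)))))) (at y)"
proof -
  define x where "x = \<phi> y"
  define P where "P = c + \<theta> x"
  have P: "0 < P" using p by (simp add: P_def x_def)
  have \<phi>': "(\<phi> has_real_derivative x / (y * P)) (at y)" using \<phi> by (simp add: x_def P_def)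
  have \<theta>\<phi>: "((\<lambda>y. \<theta> (\<phi> y)) has_real_derivative \<theta>1 x * (x / (y * P))) (at y)"
    by (rule DERIV_chain2[OF \<theta> \<phi>', folded x_def])
  have den: "((\<lambda>y. y * (c + \<theta> (\<phi> y))) has_real_derivative P + y * (\<theta>1 x * (x / (y * P)))) (at y)"
    by (rule derivative_eq_intros \<theta>\<phi> refl | simp add: P_def x_def)+
  have "((\<lambda>y. \<phi> y / (y * (c + \<theta> (\<phi> y)))) has_real_derivative
     ((x / (y * P)) * (y * P) - x * (P + y * (\<theta>1 x * (x / (y * P))))) / ((y * P) * (y * P))) (at y)"
    using DERIV_divide[OF \<phi>' den] y0 P by (simp add: x_def P_def)
  moreover have "((x / (y * P)) * (y * P) - x * (P + y * (\<theta>1 x * (x / (y * P))))) / ((y * P) * (y * P)) = - (E x / y\<^sup>2)"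
    unfolding E_def curv_def P_def[symmetric] using y0 P
    by (simp add: field_simps power2_eq_square power3_eq_cube)
  ultimately show "((\<lambda>y. \<phi> y / (y * (c + \<theta> (\<phi> y)))) has_real_derivative - (E (\<phi> y) / y\<^sup>2)) (at y)"
    by (simp add: x_def)
  have "((\<lambda>x. curv x (c + \<theta> x) (\<theta>1 x)) has_real_derivative E' x) (at x)"
    unfolding E'_def by (rule curv_deriv[OF \<theta>[folded x_def] \<theta>1[folded x_def]]) (use P in \<open>simp add: P_def\<close>)
  then have "((\<lambda>y. E (\<phi> y)) has_real_derivative E' x * (x / (y * P))) (at y)"
    unfolding E_def x_def by (rule DERIV_chain2) (rule \<phi>'[unfolded x_def])
  then show "((\<lambda>y. - E (\<phi> y)) has_real_derivative - (E' (\<phi> y) * (\<phi> y / (y * (c + \<theta> (\<phi> y)))))) (at y)"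
    unfolding x_def P_def by (rule DERIV_minus)
qed

text \<open>Sizes are stated as powers of y up to \<epsilon>, so that c = 1, where A = 0 and only
  slowly varying factors remain, is treated like c > 1. The bound 1/2 on \<phi>' is listed
  separately because for c = 1 the power bound does not give it; it keeps \<phi>(p + 1) - \<phi>(p)
  below 1.\<close>

lemma family_phase:
  fixes h \<phi> :: "real \<Rightarrow> real"
  assumes fam: "in_family c x0 h" and \<phi>: "\<phi> = inv_into {x0..} h" and A: "A = 1 - 1 / c"
    and \<epsilon>: "0 < \<epsilon>" "\<epsilon> \<le> 1"
  obtains f1 f2 G' y0 where "h x0 < y0" "1 \<le> y0"
    "\<And>y. y0 \<le> y \<Longrightarrow> (\<phi> has_real_derivative f1 y) (at y)"
    "\<And>y. y0 \<le> y \<Longrightarrow> (f1 has_real_derivative f2 y) (at y)"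
    "\<And>y. y0 \<le> y \<Longrightarrow> ((\<lambda>y. y\<^sup>2 * f2 y) has_real_derivative G' y) (at y)"
    "\<And>y. y0 \<le> y \<Longrightarrow> y powr (- A - \<epsilon>) \<le> f1 y \<and> f1 y \<le> y powr (- A + \<epsilon>) \<and> f1 y \<le> 1/2"
    "\<And>y. y0 \<le> y \<Longrightarrow> f2 y \<le> - (y powr (- 1 - A - \<epsilon>)) \<and> \<bar>y * f2 y\<bar> \<le> y powr (- A + \<epsilon>)"
    "\<And>y. y0 \<le> y \<Longrightarrow> G' y \<le> - (y powr (- A - \<epsilon>))"
proof -
  from fam have c: "1 \<le> c" "c < 2" and x0: "1 \<le> x0" and h1: "\<And>x. x0 \<le> x \<Longrightarrow> 1 \<le> h x"
    unfolding in_family_def by auto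
  obtain \<theta> \<theta>1 \<theta>2 where \<theta>:
    "\<And>x. x0 < x \<Longrightarrow> (\<theta> has_real_derivative \<theta>1 x) (at x)"
    "\<And>x. x0 < x \<Longrightarrow> (\<theta>1 has_real_derivative \<theta>2 x) (at x)"
    "\<And>x. x0 < x \<Longrightarrow> (h has_real_derivative h x * (c + \<theta> x) / x) (at x)"
    "(\<theta> \<longlongrightarrow> 0) at_top"
    "c > 1 \<Longrightarrow> ((\<lambda>x. x * \<theta>1 x) \<longlongrightarrow> 0) at_top \<and> ((\<lambda>x. x\<^sup>2 * \<theta>2 x) \<longlongrightarrow> 0) at_top"
    "c = 1 \<Longrightarrow> (\<forall>x\<ge>x0. \<theta> x > 0) \<and> (\<forall>\<epsilon>>0. \<exists>K. \<forall>x\<ge>x0. 1 / \<theta> x \<le> K * x powr \<epsilon>)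
       \<and> ((\<lambda>x. x / h x) \<longlongrightarrow> 0) at_top
       \<and> ((\<lambda>x. x * \<theta>1 x / \<theta> x) \<longlongrightarrow> 0) at_top \<and> ((\<lambda>x. x\<^sup>2 * \<theta>2 x / \<theta> x) \<longlongrightarrow> 0) at_top"
    using family_theta[OF fam] by blast
  have h': "\<forall>x>x0. (h has_real_derivative h x * (c + \<theta> x) / x) (at x)" using \<theta>(3) by blast
  note inv = family_inverse[OF fam \<phi> h' \<theta>(4)]
  define \<gamma> where "\<gamma> = 1 / c"
  have \<gamma>: "1/2 < \<gamma>" "\<gamma> \<le> 1" "c * \<gamma> = 1" using c by (auto simp: \<gamma>_def field_simps)
  have A': "A = 1 - \<gamma>" by (simp add: A \<gamma>_def)
  \<comment> \<open>The exponent of \<phi>, the curvature bounds and the absorbed constants each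
    lose a few \<eta>; the total stays within 8 \<eta>.\<close>
  define \<eta> where "\<eta> = \<epsilon> / 8"
  have \<eta>: "0 < \<eta>" "\<eta> \<le> 1/8" using \<epsilon> by (auto simp: \<eta>_def)
  define E where "E = (\<lambda>x. curv x (c + \<theta> x) (\<theta>1 x))"
  define E' where "E' = (\<lambda>x. curv' (c + \<theta> x) (x * \<theta>1 x) (x\<^sup>2 * \<theta>2 x))"
  have ev_h: "eventually (\<lambda>x. x powr (c - \<eta> / 2) \<le> h x \<and> h x \<le> x powr (c + \<eta> / 2)) at_top"
    using h1 \<eta> by (intro family_growth[OF \<theta>(3) _ x0 \<theta>(4)]) force+
  have ev_E: "eventually (\<lambda>x. x powr (1 - \<eta>) \<le> E x \<and> E x \<le> x \<and> x powr (- \<eta>) \<le> E' x) at_top"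
    unfolding E_def E'_def by (rule curv_bounds[OF c \<theta>(4,5) _ \<eta>(1)]) (use \<theta>(6) in auto)
  have ev_\<theta>: "eventually (\<lambda>x. \<bar>\<theta> x\<bar> < 1/2) at_top"
    using tendstoD[OF \<theta>(4), of "1/2"] by (simp add: dist_real_def)
  \<comment> \<open>At x = \<phi>(y) the derivative \<phi>'(y) is at most 2 x / h(x), so this yields
    the bound 1/2. For c = 1 it is the assumption x / h(x) -> 0, for c > 1 a consequence of the
    growth of \<open>h\<close>.\<close>
  have ev_x: "eventually (\<lambda>x. x / h x \<le> 1/4) at_top"
  proof (cases "c = 1")
    case True
    then have "((\<lambda>x. x / h x) \<longlongrightarrow> 0) at_top" using \<theta>(6) by blast
    from order_tendstoD(2)[OF this, of "1/4"] show ?thesis by (auto elim: eventually_mono)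
  next
    case False
    define b where "b = (c - 1) / 2"
    have b: "0 < b" using False c by (simp add: b_def)
    have "eventually (\<lambda>x. x powr (c - b) \<le> h x \<and> h x \<le> x powr (c + b)) at_top"
      using h1 b by (intro family_growth[OF \<theta>(3) _ x0 \<theta>(4)]) force+
    moreover have "eventually (\<lambda>x. 4 \<le> x powr b) at_top" by (rule powr_eventually_ge[OF b])
    moreover have "eventually (\<lambda>x. 1 \<le> (x::real)) at_top" by (rule eventually_ge_at_top)
    ultimately show ?thesis
    proof eventually_elim
      case (elim x)
      have "4 * x \<le> x powr b * x" using elim by (intro mult_right_mono) auto
      also have "\<dots> = x powr (c - b)" proof -
        have "c - b = 1 + b" by (simp add: b_def field_simps)
        then show ?thesis using elim by (simp add: powr_mult_base mult.commute add.commute)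
      qed
      also have "\<dots> \<le> h x" using elim by simp
      finally show ?case using elim by (simp add: field_simps)
    qed
  qed
  have ev_two: "eventually (\<lambda>x. 4 \<le> (x::real) powr \<eta>) at_top" by (rule powr_eventually_ge[OF \<eta>(1)])
  have "eventually (\<lambda>x. x powr (c - \<eta> / 2) \<le> h x \<and> h x \<le> x powr (c + \<eta> / 2) \<and>
      (x powr (1 - \<eta>) \<le> E x \<and> E x \<le> x \<and> x powr (- \<eta>) \<le> E' x) \<and> \<bar>\<theta> x\<bar> < 1/2 \<and> x / h x \<le> 1/4) at_top"
    using ev_h ev_E ev_\<theta> ev_x by eventually_elim simp
  then obtain x1 where x1: "\<And>x. x1 \<le> x \<Longrightarrow> x powr (c - \<eta> / 2) \<le> h x \<and> h x \<le> x powr (c + \<eta> / 2) \<and>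
      (x powr (1 - \<eta>) \<le> E x \<and> E x \<le> x \<and> x powr (- \<eta>) \<le> E' x) \<and> \<bar>\<theta> x\<bar> < 1/2 \<and> x / h x \<le> 1/4"
    by (auto simp: eventually_at_top_linorder)
  obtain y1 where y1: "\<And>y. y1 \<le> y \<Longrightarrow> 4 \<le> y powr \<eta>" using ev_two by (auto simp: eventually_at_top_linorder)
  define x2 where "x2 = max x1 (x0 + 1)"
  define y0 where "y0 = max y1 (h x2)"
  have x2: "x1 \<le> x2" "x0 < x2" by (auto simp: x2_def)
  have hx2: "h x0 < h x2" by (rule inv(3)) (use x2 in auto)
  have y0: "h x0 < y0" "1 \<le> y0" "y1 \<le> y0" using hx2 h1[of x2] x2 by (auto simp: y0_def)
  define f1 where "f1 = (\<lambda>y. \<phi> y / (y * (c + \<theta> (\<phi> y))))"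
  define f2 where "f2 = (\<lambda>y. - (E (\<phi> y) / y\<^sup>2))"
  define G' where "G' = (\<lambda>y. - (E' (\<phi> y) * f1 y))"
  have \<phi>x: "x0 < \<phi> y" if "h x0 < y" for y
    using inv(1)[of y] that by (cases "\<phi> y = x0") auto
  have D1: "(\<phi> has_real_derivative f1 y) (at y)" if "h x0 < y" for y
    unfolding f1_def by (rule inv(4)[OF that])
  have hx0: "0 \<le> h x0" using h1[of x0] by simp
  have Ds: "(f1 has_real_derivative f2 y) (at y)" "((\<lambda>y. - E (\<phi> y)) has_real_derivative G' y) (at y)"
    if y: "h x0 < y" for y
  proof -
    have "0 < y" using y hx0 by simp
    note * = inverse_derivatives[where \<phi> = \<phi> and \<theta> = \<theta> and ?\<theta>1.0 = \<theta>1 and ?\<theta>2.0 = \<theta>2 and y = y, OF inv(4)[OF y] \<theta>(1)[OF \<phi>x[OF y]] \<theta>(2)[OF \<phi>x[OF y]] inv(5)[OF \<phi>x[OF y]] this]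
    show "(f1 has_real_derivative f2 y) (at y)" using *(1) by (simp only: f1_def f2_def E_def)
    show "((\<lambda>y. - E (\<phi> y)) has_real_derivative G' y) (at y)"
      using *(2) by (simp only: f1_def G'_def E_def E'_def)
  qed
  have facts: "x2 \<le> \<phi> y \<and> h (\<phi> y) = y" if y: "y0 \<le> y" for y
  proof -
    have "h x0 \<le> y" "h x2 \<le> y" using y y0 by (auto simp: y0_def)
    then have i: "x0 \<le> \<phi> y" "h (\<phi> y) = y" using inv(1) by auto
    have "x2 \<le> \<phi> y"
    proof (rule ccontr)
      assume "\<not> x2 \<le> \<phi> y"
      then have "h (\<phi> y) < h x2" using i by (intro inv(3)) auto
      then show False using i \<open>h x2 \<le> y\<close> by simp
    qed
    then show ?thesis using i by simp
  qed
  have bounds: "y powr (\<gamma> - \<eta>) \<le> \<phi> y \<and> \<phi> y \<le> y powr (\<gamma> + \<eta>) \<and> y powr (\<gamma> - 1 - 2 * \<eta>) \<le> f1 y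
      \<and> f1 y \<le> y powr (\<gamma> - 1 + 2 * \<eta>) \<and> f1 y \<le> 1/2" if y: "y0 \<le> y" for y
  proof -
    define x where "x = \<phi> y"
    have x: "x1 \<le> x" "1 \<le> x" "h x = y" using facts[OF y] x2 x0 by (auto simp: x_def)
    have y1': "1 \<le> y" using y y0 by simp
    note X = x1[OF x(1)]
    have "c * \<eta> \<ge> \<eta>" using c \<eta> by simp
    \<comment> \<open>This inverts h(x) \<ge> x^(c - \<eta>/2): the product of c - \<eta>/2 and
      \<gamma> + \<eta> is at least 1 because c \<gamma> = 1 and c \<eta> \<ge> \<eta>.\<close>
    have 1: "x \<le> y powr (\<gamma> + \<eta>)"
    proof -
      have "\<eta> / 2 * (\<gamma> + \<eta>) \<le> \<eta> / 2 * 2" using \<eta> \<gamma> by (intro mult_left_mono) auto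
      then have "1 \<le> (c - \<eta> / 2) * (\<gamma> + \<eta>)" using \<open>c * \<eta> \<ge> \<eta>\<close> \<gamma>(3) by (simp add: left_diff_distrib distrib_left)
      then have "x powr 1 \<le> x powr ((c - \<eta> / 2) * (\<gamma> + \<eta>))" using x by (intro powr_mono) auto
      also have "\<dots> = (x powr (c - \<eta> / 2)) powr (\<gamma> + \<eta>)" by (simp add: powr_powr)
      also have "\<dots> \<le> y powr (\<gamma> + \<eta>)" using X x \<gamma> \<eta> by (intro powr_mono2) auto
      finally show ?thesis using x by simp
    qed
    have 2: "y powr (\<gamma> - \<eta>) \<le> x"
    proof -
      have "\<eta> / 2 * (\<gamma> - \<eta>) \<le> \<eta> / 2 * 2" using \<eta> \<gamma> by (intro mult_left_mono) auto
      then have "(c + \<eta> / 2) * (\<gamma> - \<eta>) \<le> 1" using \<open>c * \<eta> \<ge> \<eta>\<close> \<gamma>(3) by (simp add: distrib_right right_diff_distrib)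
      then have "x powr ((c + \<eta> / 2) * (\<gamma> - \<eta>)) \<le> x powr 1" using x by (intro powr_mono) auto
      moreover have "y powr (\<gamma> - \<eta>) \<le> (x powr (c + \<eta> / 2)) powr (\<gamma> - \<eta>)"
        using X x \<gamma> \<eta> y1' by (intro powr_mono2) auto
      ultimately show ?thesis using x by (simp add: powr_powr)
    qed
    have p: "1/2 \<le> c + \<theta> x" "c + \<theta> x \<le> 5/2" using X c by auto
    have f1x: "f1 y = x / y * (1 / (c + \<theta> x))" by (simp add: f1_def x_def)
    have xy: "0 \<le> x / y" using x y1' by simp
    have up: "f1 y \<le> 2 * (x / y)"
    proof -
      have "1 / (c + \<theta> x) \<le> 2" using p by (simp add: divide_le_eq)
      from mult_left_mono[OF this xy] show ?thesis by (simp only: f1x mult.commute)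
    qed
    have lo: "(1/4) * (x / y) \<le> f1 y"
    proof -
      have "1/4 \<le> 1 / (c + \<theta> x)" using p by (simp add: le_divide_eq)
      from mult_left_mono[OF this xy] show ?thesis by (simp only: f1x mult.commute)
    qed
    have "4 \<le> y powr \<eta>" using y1 y y0 by auto
    then have y2: "2 \<le> y powr \<eta>" by simp
    have "2 * (x / y) \<le> y powr \<eta> * (y powr (\<gamma> + \<eta>) / y)"
      using y2 1 x y1' by (intro mult_mono divide_right_mono) auto
    also have "\<dots> = y powr (\<gamma> - 1 + 2 * \<eta>)"
    proof -
      have "y powr (\<gamma> - 1 + 2 * \<eta>) = y powr (\<eta> + (\<gamma> + \<eta>) - 1)" by (simp add: algebra_simps)
      then show ?thesis using y1' by (simp only: powr_diff powr_add powr_one) simp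
    qed
    finally have up': "f1 y \<le> y powr (\<gamma> - 1 + 2 * \<eta>)" using up by simp
    have yd: "y powr (\<gamma> - 1 - 2 * \<eta>) = y powr (\<gamma> - \<eta>) / y / y powr \<eta>"
    proof -
      have "y powr (\<gamma> - 1 - 2 * \<eta>) = y powr ((\<gamma> - \<eta>) - 1 - \<eta>)" by simp
      then show ?thesis using y1' by (simp only: powr_diff powr_one)
    qed
    have "y powr (\<gamma> - \<eta>) / y / y powr \<eta> \<le> (1/4) * (x / y)"
    proof -
      have "4 \<le> y powr \<eta>" using y1 y y0 by auto
      then have "y powr (\<gamma> - \<eta>) / y / y powr \<eta> \<le> x / y / 4"
        using 2 x y1' by (intro frac_le divide_right_mono) auto
      then show ?thesis by simp
    qed
    then have lo': "y powr (\<gamma> - 1 - 2 * \<eta>) \<le> f1 y" unfolding yd using lo by linarith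
    have "x / y \<le> 1/4" using X x by simp
    then have "f1 y \<le> 1/2" using up by linarith
    then show ?thesis using 1 2 up' lo' by (simp add: x_def)
  qed
  have Gy: "y\<^sup>2 * f2 y = - E (\<phi> y)" if "y \<noteq> 0" for y using that by (simp add: f2_def)
  show thesis
  proof (rule that[of y0 f1 f2 G'])
    fix y assume y: "y0 \<le> y"
    have y': "h x0 < y" "1 \<le> y" using y y0 by auto
    define x where "x = \<phi> y"
    have x: "x1 \<le> x" "1 \<le> x" "h x = y" using facts[OF y] x2 x0 by (auto simp: x_def)
    note X = x1[OF x(1)] and b = bounds[OF y, folded x_def]
    show "(\<phi> has_real_derivative f1 y) (at y)" by (rule D1[OF y'(1)])
    show "(f1 has_real_derivative f2 y) (at y)"
      by (rule Ds(1)[OF y'(1)])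
    have "((\<lambda>y. - E (\<phi> y)) has_real_derivative G' y) (at y)"
      by (rule Ds(2)[OF y'(1)])
    then show "((\<lambda>y. y\<^sup>2 * f2 y) has_real_derivative G' y) (at y)"
      by (rule has_field_derivative_transform_within_open[of _ _ _ "{0<..}"]) (use y' in \<open>auto simp: Gy\<close>)
    show "y powr (- A - \<epsilon>) \<le> f1 y \<and> f1 y \<le> y powr (- A + \<epsilon>) \<and> f1 y \<le> 1/2"
    proof -
      have "y powr (- A - \<epsilon>) \<le> y powr (\<gamma> - 1 - 2 * \<eta>)" using y' \<epsilon> by (intro powr_mono) (auto simp: A' \<eta>_def)
      moreover have "y powr (\<gamma> - 1 + 2 * \<eta>) \<le> y powr (- A + \<epsilon>)" using y' \<epsilon> by (intro powr_mono) (auto simp: A' \<eta>_def)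
      ultimately show ?thesis using b by linarith
    qed
    have f2x: "f2 y = - (E x / y\<^sup>2)" by (simp add: f2_def x_def)
    have E0: "0 \<le> E x" using X powr_ge_zero[of x "1 - \<eta>"] by linarith
    show "f2 y \<le> - (y powr (- 1 - A - \<epsilon>)) \<and> \<bar>y * f2 y\<bar> \<le> y powr (- A + \<epsilon>)"
    proof
      have e: "\<gamma> - 2 * \<eta> \<le> (\<gamma> - \<eta>) * (1 - \<eta>)"
      proof -
        have "\<gamma> * \<eta> \<le> 1 * \<eta>" using \<gamma> \<eta> by (intro mult_right_mono) auto
        moreover have "0 \<le> \<eta> * \<eta>" by simp
        moreover have "(\<gamma> - \<eta>) * (1 - \<eta>) = \<gamma> - \<eta> - \<gamma> * \<eta> + \<eta> * \<eta>" by (simp add: algebra_simps)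
        ultimately show ?thesis by linarith
      qed
      have "y powr (1 - A - \<epsilon>) \<le> y powr ((\<gamma> - \<eta>) * (1 - \<eta>))"
        using y' \<epsilon> e by (intro powr_mono) (auto simp: A' \<eta>_def)
      also have "\<dots> = (y powr (\<gamma> - \<eta>)) powr (1 - \<eta>)" by (simp add: powr_powr)
      also have "\<dots> \<le> x powr (1 - \<eta>)" using b \<eta> by (intro powr_mono2) auto
      also have "\<dots> \<le> E x" using X by simp
      finally have "y powr (1 - A - \<epsilon>) / y\<^sup>2 \<le> E x / y\<^sup>2" by (intro divide_right_mono) auto
      moreover have "y powr (1 - A - \<epsilon>) / y\<^sup>2 = y powr (- 1 - A - \<epsilon>)"
      proof -
        have "y powr (1 - A - \<epsilon>) / y powr 2 = y powr (1 - A - \<epsilon> - 2)" by (simp only: powr_diff)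
        moreover have "1 - A - \<epsilon> - 2 = - 1 - A - \<epsilon>" by simp
        moreover have "y powr 2 = y\<^sup>2" using y' by simp
        ultimately show ?thesis by simp
      qed
      ultimately show "f2 y \<le> - (y powr (- 1 - A - \<epsilon>))" unfolding f2x by linarith
      have "\<bar>y * f2 y\<bar> = E x / y" unfolding f2x using y' E0 by (simp add: power2_eq_square abs_mult)
      also have "\<dots> \<le> x / y" using X y' by (intro divide_right_mono) auto
      also have "\<dots> \<le> y powr (\<gamma> + \<eta>) / y" using b y' by (intro divide_right_mono) auto
      also have "\<dots> = y powr (\<gamma> + \<eta> - 1)" using y' by (simp add: powr_diff)
      also have "\<dots> \<le> y powr (- A + \<epsilon>)" using y' \<epsilon> by (intro powr_mono) (auto simp: A' \<eta>_def)
      finally show "\<bar>y * f2 y\<bar> \<le> y powr (- A + \<epsilon>)" .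
    qed
    show "G' y \<le> - (y powr (- A - \<epsilon>))"
    proof -
      have "(\<gamma> + \<eta>) * \<eta> \<le> 2 * \<eta>" using \<gamma> \<eta> by (intro mult_right_mono) auto
      moreover have "\<epsilon> = 8 * \<eta>" by (simp add: \<eta>_def)
      ultimately have "- A - \<epsilon> \<le> (\<gamma> + \<eta>) * - \<eta> + (\<gamma> - 1 - 2 * \<eta>)"
        unfolding A' mult_minus_right using \<eta>(1) by linarith
      then have "y powr (- A - \<epsilon>) \<le> y powr ((\<gamma> + \<eta>) * - \<eta> + (\<gamma> - 1 - 2 * \<eta>))"
        using y' by (intro powr_mono) auto
      also have "\<dots> = (y powr (\<gamma> + \<eta>)) powr (- \<eta>) * y powr (\<gamma> - 1 - 2 * \<eta>)"
        unfolding powr_add[of y "(\<gamma> + \<eta>) * - \<eta>" "\<gamma> - 1 - 2 * \<eta>"] powr_powr ..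
      also have "\<dots> \<le> E' x * f1 y"
      proof (rule mult_mono)
        have "(y powr (\<gamma> + \<eta>)) powr (- \<eta>) \<le> x powr (- \<eta>)"
          using b x \<eta> by (intro powr_mono2') auto
        then show "(y powr (\<gamma> + \<eta>)) powr (- \<eta>) \<le> E' x" using X by linarith
        show "0 \<le> E' x" using X powr_ge_zero[of x "- \<eta>"] by linarith
      qed (use b in auto)
      finally show ?thesis by (simp add: G'_def x_def)
    qed
  qed (use y0 in auto)
qed

text \<open>The range reaches 3 X because arguments up to 2 X will be shifted by at most 1 \<le>
  X.\<close>

lemma powr_comparable:
  fixes X z a :: real
  assumes "0 < X" "X \<le> z" "z \<le> 3 * X"
  shows "a \<le> 1 \<Longrightarrow> z powr a \<le> 3 * X powr a" and "- 3 \<le> a \<Longrightarrow> X powr a / 27 \<le> z powr a"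
proof -
  define t where "t = z / X"
  have t: "1 \<le> t" "t \<le> 3" using assms by (auto simp: t_def field_simps)
  have z: "z powr a = X powr a * t powr a" using assms by (simp add: t_def powr_divide)
  {
    assume "a \<le> 1"
    then have "t powr a \<le> t powr 1" using t by (intro powr_mono)
    then have "t powr a \<le> 3" using t by simp
    then have "X powr a * t powr a \<le> X powr a * 3" by (intro mult_left_mono) auto
    then show "z powr a \<le> 3 * X powr a" by (simp add: z)
  next
    assume "- 3 \<le> a"
    have "3 powr (- 3) \<le> t powr (- 3)" using t by (intro powr_mono2') auto
    also have "\<dots> \<le> t powr a" using t \<open>- 3 \<le> a\<close> by (intro powr_mono)
    finally have "1 / 27 \<le> t powr a" by (simp add: powr_minus_divide)
    then have "X powr a * (1 / 27) \<le> X powr a * t powr a" by (intro mult_left_mono) auto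
    then show "X powr a / 27 \<le> z powr a" by (simp add: z)
  }
qed

text \<open>The obstacle is the last clause of \<open>local_phase\<close>: it concerns y^2 f2(y +
  s), while the hypothesis controls (y + s)^2 f2(y + s). The ratio (y/(y + s))^2 is increasing and
  at least 1/4, and the controlled quantity is negative, so the variation of the ratio works in the
  right direction. Constants are absorbed by a second factor X^\<epsilon>.\<close>

lemma local_phase_shift:
  fixes \<phi> f1 f2 G' :: "real \<Rightarrow> real"
  assumes d: "\<And>y. y0 \<le> y \<Longrightarrow> (\<phi> has_real_derivative f1 y) (at y)"
    "\<And>y. y0 \<le> y \<Longrightarrow> (f1 has_real_derivative f2 y) (at y)"
    "\<And>y. y0 \<le> y \<Longrightarrow> ((\<lambda>y. y\<^sup>2 * f2 y) has_real_derivative G' y) (at y)"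
    and b1: "\<And>y. y0 \<le> y \<Longrightarrow> y powr (- A - \<epsilon>) \<le> f1 y \<and> f1 y \<le> y powr (- A + \<epsilon>) \<and> f1 y \<le> 1/2"
    and b2: "\<And>y. y0 \<le> y \<Longrightarrow> f2 y \<le> - (y powr (- 1 - A - \<epsilon>)) \<and> \<bar>y * f2 y\<bar> \<le> y powr (- A + \<epsilon>)"
    and b3: "\<And>y. y0 \<le> y \<Longrightarrow> G' y \<le> - (y powr (- A - \<epsilon>))"
    and A: "0 \<le> A" "A \<le> 1" and \<epsilon>: "0 < \<epsilon>" "\<epsilon> \<le> 1" and s: "0 \<le> s" "s \<le> 1"
    and X: "y0 \<le> X" "1 \<le> X" and X108: "108 \<le> X powr \<epsilon>"
  shows "local_phase X (X powr (- A + 2 * \<epsilon>)) (X powr (- 1 - A - 2 * \<epsilon>)) (\<lambda>y. \<phi> (y + s))"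
  unfolding local_phase_def
proof (rule exI[of _ "\<lambda>y. f1 (y + s)"], rule exI[of _ "\<lambda>y. f2 (y + s)"], intro conjI ballI impI)
  have big: "X powr (- A + 2 * \<epsilon>) = X powr \<epsilon> * X powr (- A + \<epsilon>)" by (simp flip: powr_add)
  \<comment> \<open>108 is 27 from the comparison on [X, 3 X] times 4 from the shift.\<close>
  have small: "X powr (- 1 - A - 2 * \<epsilon>) \<le> X powr (- 1 - A - \<epsilon>) / 108"
  proof -
    have "X powr (- 1 - A - 2 * \<epsilon>) = X powr ((- 1 - A - \<epsilon>) - \<epsilon>)" by simp
    also have "\<dots> = X powr (- 1 - A - \<epsilon>) / X powr \<epsilon>" by (rule powr_diff)
    also have "\<dots> \<le> X powr (- 1 - A - \<epsilon>) / 108" using X108 by (intro divide_left_mono) auto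
    finally show ?thesis .
  qed
  have z: "y0 \<le> y + s" "0 < X" "X \<le> y + s" "y + s \<le> 3 * X" if "y \<in> {X..2*X}" for y
    using that X s by auto
  fix y assume y: "y \<in> {X..2*X}"
  note Z = z[OF y]
  have sh: "((\<lambda>y. y + s) has_real_derivative 1) (at y)" by (auto intro!: derivative_eq_intros)
  show "((\<lambda>y. \<phi> (y + s)) has_real_derivative f1 (y + s)) (at y)"
    using DERIV_chain2[OF d(1)[OF Z(1)] sh] by simp
  show "((\<lambda>y. f1 (y + s)) has_real_derivative f2 (y + s)) (at y)"
    using DERIV_chain2[OF d(2)[OF Z(1)] sh] by simp
  have up: "(y + s) powr (- A + \<epsilon>) \<le> 3 * X powr (- A + \<epsilon>)"
    using A \<epsilon> by (intro powr_comparable(1)[OF Z(2-4)]) simp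
  have f1: "\<bar>f1 (y + s)\<bar> \<le> 3 * X powr (- A + \<epsilon>)"
    using b1[OF Z(1)] up powr_ge_zero[of "y + s" "- A - \<epsilon>"] by linarith
  have six: "6 * X powr (- A + \<epsilon>) \<le> X powr (- A + 2 * \<epsilon>)"
    unfolding big using X108 by (intro mult_right_mono) auto
  then show "\<bar>f1 (y + s)\<bar> \<le> X powr (- A + 2 * \<epsilon>)"
    using f1 powr_ge_zero[of X "- A + \<epsilon>"] by linarith
  have "\<bar>y * f2 (y + s)\<bar> \<le> \<bar>(y + s) * f2 (y + s)\<bar>"
    unfolding abs_mult using y X s by (intro mult_right_mono) auto
  also have "\<dots> \<le> 3 * X powr (- A + \<epsilon>)" using b2[OF Z(1)] up by linarith
  finally show "\<bar>f1 (y + s) + y * f2 (y + s)\<bar> \<le> X powr (- A + 2 * \<epsilon>)" using f1 six by linarith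
  have "X powr (- 1 - A - \<epsilon>) / 27 \<le> (y + s) powr (- 1 - A - \<epsilon>)"
    using A \<epsilon> by (intro powr_comparable(2)[OF Z(2-4)]) simp
  then show "f2 (y + s) \<le> - (X powr (- 1 - A - 2 * \<epsilon>))"
    using b2[OF Z(1)] small powr_ge_zero[of X "- 1 - A - \<epsilon>"] by linarith
next
  fix a b assume a: "a \<in> {X..2*X}" and b: "b \<in> {X..2*X}" and ab: "a \<le> b"
  let ?G = "\<lambda>z. z\<^sup>2 * f2 z"
  let ?w = "\<lambda>y. (y / (y + s))\<^sup>2"
  have X0: "0 < X" using X by simp
  have pos: "0 < a" "0 < b" "0 < a + s" "0 < b + s" using a b X s by auto
  have low: "?G (b + s) - ?G (a + s) \<le> - ((b - a) * (X powr (- A - \<epsilon>) / 27))"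
  proof (cases "a = b")
    case False
    then have "a + s < b + s" using ab by simp
    then have "\<exists>z>a + s. z < b + s \<and> ?G (b + s) - ?G (a + s) = ((b + s) - (a + s)) * G' z"
      using a X s by (intro MVT2 d(3)) auto
    then obtain z where z: "a + s < z" "z < b + s" "?G (b + s) - ?G (a + s) = (b - a) * G' z" by auto
    have zX: "y0 \<le> z" "X \<le> z" "z \<le> 3 * X" using z a b X s by auto
    have "X powr (- A - \<epsilon>) / 27 \<le> z powr (- A - \<epsilon>)"
      using A \<epsilon> by (intro powr_comparable(2)[OF X0 zX(2,3)]) simp
    then have "G' z \<le> - (X powr (- A - \<epsilon>) / 27)" using b3[OF zX(1)] by linarith
    then have "(b - a) * G' z \<le> (b - a) * - (X powr (- A - \<epsilon>) / 27)" using ab by (intro mult_left_mono) auto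
    then show ?thesis using z by simp
  qed simp
  have Gneg: "?G (b + s) \<le> 0"
  proof -
    have "y0 \<le> b + s" using b X s by auto
    then have "f2 (b + s) \<le> 0" using b2[of "b + s"] powr_ge_zero[of "b + s" "- 1 - A - \<epsilon>"] by linarith
    then show ?thesis by (intro mult_nonneg_nonpos) auto
  qed
  have w: "1/4 \<le> ?w a" "?w a \<le> ?w b"
  proof -
    have "1/2 \<le> a / (a + s)" using a s X pos by (simp add: field_simps)
    then have "(1/2)\<^sup>2 \<le> ?w a" by (intro power_mono) auto
    then show "1/4 \<le> ?w a" by (simp add: power2_eq_square)
    have "a / (a + s) \<le> b / (b + s)" using pos mult_right_mono[OF ab s(1)] by (simp add: field_simps)
    then show "?w a \<le> ?w b" using pos s by (intro power_mono) auto
  qed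
  have G: "y\<^sup>2 * f2 (y + s) = ?w y * ?G (y + s)" if "0 < y" for y
    using that s by (simp add: power_divide)
  have D0: "0 \<le> (b - a) * (X powr (- A - \<epsilon>) / 27)" using ab by simp
  have "b\<^sup>2 * f2 (b + s) - a\<^sup>2 * f2 (a + s) = ?w b * ?G (b + s) - ?w a * ?G (a + s)"
    by (simp only: G[OF pos(1)] G[OF pos(2)])
  also have "\<dots> \<le> ?w a * ?G (b + s) - ?w a * ?G (a + s)"
    using mult_right_mono_neg[OF w(2) Gneg] by simp
  also have "\<dots> = ?w a * (?G (b + s) - ?G (a + s))" by (simp add: right_diff_distrib)
  also have "\<dots> \<le> ?w a * - ((b - a) * (X powr (- A - \<epsilon>) / 27))" by (intro mult_left_mono low) auto
  also have "\<dots> \<le> - ((b - a) * (X powr (- A - \<epsilon>) / 108))"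
    using mult_right_mono[OF w(1) D0] by simp
  also have "\<dots> \<le> - ((b - a) * X * X powr (- 1 - A - 2 * \<epsilon>))"
  proof -
    have "X * X powr (- 1 - A - 2 * \<epsilon>) = X powr (- A - \<epsilon> - \<epsilon>)"
      using X0 by (simp add: powr_mult_base algebra_simps)
    also have "\<dots> = X powr (- A - \<epsilon>) / X powr \<epsilon>" by (rule powr_diff)
    also have "\<dots> \<le> X powr (- A - \<epsilon>) / 108" using X108 by (intro divide_left_mono) auto
    finally have "(b - a) * (X * X powr (- 1 - A - 2 * \<epsilon>)) \<le> (b - a) * (X powr (- A - \<epsilon>) / 108)"
      using ab by (intro mult_left_mono) auto
    then show ?thesis by (simp add: mult.assoc)
  qed
  finally show "b\<^sup>2 * f2 (b + s) - a\<^sup>2 * f2 (a + s) \<le> - ((b - a) * X * X powr (- 1 - A - 2 * \<epsilon>))" .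
qed

section \<open>Exponential sums over primes\<close>

text \<open>
  The first three exponent conditions make the terms of the type I bound at most \<open>X\<close> to the power
  \<open>1 - \<delta>\<close>; the last three do the same for type II with blocks of length about \<open>X\<close> to the power \<open>2 \<delta> + 8 \<epsilon>\<close>.
\<close>

lemma mangoldt_exp_sum_power:
  fixes X Y m x :: nat and A \<delta> \<epsilon> \<xi> :: real and f :: "real \<Rightarrow> real"
  assumes A: "0 \<le> A" and \<delta>: "0 < \<delta>" and \<epsilon>: "0 < \<epsilon>"
    and h: "13/2 * \<delta> - A / 2 + 37/2 * \<epsilon> \<le> 1/2" "5 * \<delta> + A / 2 + 35/2 * \<epsilon> \<le> 1/2"
      "12 * \<delta> - A + 34 * \<epsilon> \<le> 1" "9/2 * \<delta> - A / 2 + 27/2 * \<epsilon> \<le> 1/4"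
      "2 * \<delta> + A / 2 + 17/2 * \<epsilon> \<le> 1/4" "7 * \<delta> - A + 17 * \<epsilon> \<le> 1/2"
    and X: "X = 2 ^ x" "64 < X" and lnX: "1 + ln (4 * real X) \<le> real X powr \<epsilon>"
    and f: "local_phase X (real X powr (- A + \<epsilon>)) (real X powr (- 1 - A - \<epsilon>)) f"
    and Y: "Y \<le> 2 * X" and m: "0 < m" "real m \<le> real X powr (3 * \<delta>)"
  shows "norm (\<Sum>n\<in>{X..<Y}. mangoldt n * e2pi (\<xi> * real n + real m * f (real n))) \<le> 130000 * real X powr (1 - \<delta>)"
proof -
  define P where "P = (\<lambda>a. real X powr a)"
  have X1: "1 \<le> real X" using X by simp
  have P_add: "P a * P b = P (a + b)" for a b by (simp add: P_def powr_add)
  have P_mono: "P a \<le> P b" if "a \<le> b" for a b using that X1 by (simp add: P_def powr_mono)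
  have P0: "0 < P a" for a using X1 by (simp add: P_def)
  have P_0: "P 0 = 1" using X1 by (simp add: P_def)
  have P_1: "P 1 = real X" using X1 by (simp add: P_def)
  have P_ge1: "1 \<le> P a" if "0 \<le> a" for a using P_mono[OF that] P_0 by simp
  have P_sqrt: "sqrt (P a) = P (a / 2)" for a
    by (simp add: P_def powr_half_sqrt[symmetric] powr_powr)
  have P_inv: "1 / P a = P (- a)" for a by (simp add: P_def powr_minus_divide)
  \<comment> \<open>Blocks of length Q save \<open>sqrt (1 / Q)\<close>, about X^(-\<delta> - 4
    \<epsilon>); of this, 7/2 \<epsilon> pays for the logarithms L and L^(5/2).\<close>
  define s where "s = 2 * \<delta> + 8 * \<epsilon>"
  have s: "0 < s" "s \<le> 1/4" using \<delta> \<epsilon> A h(5) by (auto simp: s_def)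
  define Q where "Q = nat \<lceil>P s\<rceil>"
  define M where "M = nat \<lfloor>P (3 * \<delta>)\<rfloor>"
  \<comment> \<open>The least value compatible with 4 Q \<le> U, since the type I bound grows with
    U.\<close>
  define U where "U = 4 * Q"
  define V where "V = P (- A + \<epsilon>)"
  define \<kappa> where "\<kappa> = P (- 1 - A - \<epsilon>)"
  have Q1: "P s \<le> real Q" "real Q \<le> 2 * P s" "0 < Q"
  proof -
    have 1: "1 \<le> P s" using s by (intro P_ge1) simp
    show q: "P s \<le> real Q" unfolding Q_def by linarith
    have "real Q \<le> P s + 1" unfolding Q_def using 1 by linarith
    then show "real Q \<le> 2 * P s" using 1 by linarith
    show "0 < Q" using q 1 by (cases "Q = 0") auto
  qed
  have M1: "real M \<le> P (3 * \<delta>)" using P0[of "3 * \<delta>"] unfolding M_def by linarith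
  have mM: "m \<le> M" using m(2) unfolding M_def P_def by (simp add: le_nat_iff le_floor_iff)
  have U1: "real U \<le> 8 * P s" using Q1 by (simp add: U_def)
  have UX: "U < X"
  proof -
    have "8 < sqrt (real X)" using X(2) by (intro real_less_rsqrt) simp
    also have "\<dots> = P (1/2)" by (simp add: P_def powr_half_sqrt)
    finally have "8 * P (1/4) < P (1/2) * P (1/4)" using P0[of "1/4"] by simp
    also have "\<dots> \<le> P 1" unfolding P_add by (rule P_mono) simp
    finally have "8 * P (1/4) < real X" by (simp add: P_1)
    moreover have "8 * P s \<le> 8 * P (1/4)" using P_mono[OF s(2)] by simp
    ultimately show ?thesis using U1 by linarith
  qed
  have \<kappa>V: "0 < \<kappa>" "0 < V" using P0 by (auto simp: \<kappa>_def V_def)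
  have f': "local_phase X V \<kappa> f" using f by (simp add: V_def \<kappa>_def P_def)
  note params = f' X(1) Y m(1) mM \<kappa>V(1) less_imp_le[OF \<kappa>V(2)] Q1(3) eq_refl[OF U_def[symmetric]] UX
  define L where "L = log_size X"
  have L: "L \<le> P \<epsilon>" "1 \<le> L" using lnX log_size_ge_1[OF params] by (auto simp: L_def log_size_def P_def)
  have main: "norm (\<Sum>n\<in>{X..<Y}. mangoldt n * e2pi (\<xi> * real n + real m * f (real n)))
      \<le> 3 * L * (real U)\<^sup>2 * type1_const M U V \<kappa> + 2 * L * type2_const X M Q V \<kappa>"
    unfolding L_def by (rule mangoldt_exp_sum[OF params])
  have sM: "sqrt (real M) \<le> P (3/2 * \<delta>)"
  proof -
    have "sqrt (real M) \<le> sqrt (P (3 * \<delta>))" by (rule real_sqrt_le_mono[OF M1])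
    then show ?thesis by (simp add: P_sqrt)
  qed
  have \<kappa>': "1 / sqrt \<kappa> = P (1/2 + A / 2 + \<epsilon> / 2)"
    unfolding \<kappa>_def P_sqrt P_inv by (rule arg_cong[where f = P]) (simp add: field_simps)
  have U2: "(real U)\<^sup>2 \<le> 64 * P (2 * s)"
  proof -
    have "(real U)\<^sup>2 \<le> (8 * P s)\<^sup>2" using U1 by (intro power_mono) auto
    also have "\<dots> = 64 * (P s * P s)" by (simp add: power2_eq_square)
    finally show ?thesis by (simp add: P_add)
  qed
  have T1: "3 * L * (real U)\<^sup>2 * type1_const M U V \<kappa> \<le> 127104 * P (1 - \<delta>)"
  proof -
    have "sqrt (real M) * V / sqrt \<kappa> \<le> P (3/2 * \<delta>) * V * P (1/2 + A / 2 + \<epsilon> / 2)"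
      unfolding \<kappa>'[symmetric] using sM \<kappa>V by (simp add: divide_right_mono mult_right_mono)
    also have "\<dots> = P (3/2 * \<delta> - A / 2 + 1/2 + 3/2 * \<epsilon>)"
      unfolding V_def P_add by (rule arg_cong[where f = P]) (simp add: field_simps)
    finally have a1: "sqrt (real M) * V / sqrt \<kappa> \<le> P (3/2 * \<delta> - A / 2 + 1/2 + 3/2 * \<epsilon>)" .
    have "real M * (real U)\<^sup>2 * V \<le> P (3 * \<delta>) * (64 * P (2 * s)) * V"
      using M1 U2 \<kappa>V by (intro mult_right_mono mult_mono) auto
    also have "\<dots> = 64 * (P (3 * \<delta>) * P (2 * s) * V)" by simp
    also have "\<dots> = 64 * P (3 * \<delta> + 2 * s - A + \<epsilon>)"
      unfolding V_def P_add by (simp add: algebra_simps)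
    finally have a3: "real M * (real U)\<^sup>2 * V \<le> 64 * P (3 * \<delta> + 2 * s - A + \<epsilon>)" .
    have "type1_const M U V \<kappa> = 6 * (sqrt (real M) * V / sqrt \<kappa>) + 6 * (1 / sqrt \<kappa>) + 10 * (real M * (real U)\<^sup>2 * V) + 10 * 1"
      unfolding type1_const_def by (simp add: add_divide_distrib)
    also have "\<dots> \<le> 6 * P (3/2 * \<delta> - A / 2 + 1/2 + 3/2 * \<epsilon>) + 6 * P (1/2 + A / 2 + \<epsilon> / 2)
        + 10 * (64 * P (3 * \<delta> + 2 * s - A + \<epsilon>)) + 10 * P 0"
      unfolding \<kappa>' P_0 using a1 a3 by (intro add_mono mult_left_mono) auto
    finally have b1: "type1_const M U V \<kappa> \<le> 6 * P (3/2 * \<delta> - A / 2 + 1/2 + 3/2 * \<epsilon>) + 6 * P (1/2 + A / 2 + \<epsilon> / 2)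
        + 640 * P (3 * \<delta> + 2 * s - A + \<epsilon>) + 10 * P 0" by simp
    have "3 * L * (real U)\<^sup>2 * type1_const M U V \<kappa> \<le> 3 * P \<epsilon> * (64 * P (2 * s)) * type1_const M U V \<kappa>"
      using L U2 P0[of \<epsilon>] type1_const_nonneg[OF params] by (intro mult_right_mono mult_mono) auto
    also have "\<dots> \<le> 3 * P \<epsilon> * (64 * P (2 * s)) * (6 * P (3/2 * \<delta> - A / 2 + 1/2 + 3/2 * \<epsilon>) + 6 * P (1/2 + A / 2 + \<epsilon> / 2)
        + 640 * P (3 * \<delta> + 2 * s - A + \<epsilon>) + 10 * P 0)"
      using b1 P0 by (intro mult_left_mono mult_nonneg_nonneg less_imp_le[OF P0]) auto
    also have "\<dots> = 192 * (6 * P (\<epsilon> + 2 * s + (3/2 * \<delta> - A / 2 + 1/2 + 3/2 * \<epsilon>)) + 6 * P (\<epsilon> + 2 * s + (1/2 + A / 2 + \<epsilon> / 2))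
        + 640 * P (\<epsilon> + 2 * s + (3 * \<delta> + 2 * s - A + \<epsilon>)) + 10 * P (\<epsilon> + 2 * s + 0))"
      unfolding P_add[symmetric] by (simp add: algebra_simps)
    also have "\<dots> \<le> 192 * (6 * P (1 - \<delta>) + 6 * P (1 - \<delta>) + 640 * P (1 - \<delta>) + 10 * P (1 - \<delta>))"
      using h \<delta> \<epsilon> A by (intro mult_left_mono add_mono P_mono) (auto simp: s_def)
    finally show ?thesis by simp
  qed
  have T2: "2 * L * type2_const X M Q V \<kappa> \<le> 148 * P (1 - \<delta>)"
  proof -
    have MQ: "real M * real Q \<le> 2 * P (3 * \<delta> + s)"
    proof -
      have "real M * real Q \<le> P (3 * \<delta>) * (2 * P s)"
        using M1 Q1 less_imp_le[OF P0] by (intro mult_mono) auto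
      then show ?thesis by (simp add: P_add[symmetric])
    qed
    have "sqrt (real M * real Q) \<le> sqrt (2 * P (3 * \<delta> + s))" by (rule real_sqrt_le_mono[OF MQ])
    also have "\<dots> = sqrt 2 * P ((3 * \<delta> + s) / 2)" by (simp add: real_sqrt_mult P_sqrt)
    also have "\<dots> \<le> 2 * P ((3 * \<delta> + s) / 2)"
      using sqrt2_less_2 P0[of "(3 * \<delta> + s) / 2"] by (intro mult_right_mono) auto
    finally have sMQ: "sqrt (real M * real Q) \<le> 2 * P ((3 * \<delta> + s) / 2)" .
    have P34: "1 / (real X powr (3/4) * sqrt \<kappa>) = P (- 1/4 + A / 2 + \<epsilon> / 2)"
    proof -
      have "1 / (real X powr (3/4) * sqrt \<kappa>) = (1 / P (3/4)) * (1 / sqrt \<kappa>)" by (simp add: P_def)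
      also have "\<dots> = P (- 1/4 + A / 2 + \<epsilon> / 2)"
        unfolding \<kappa>' P_inv P_add by (rule arg_cong[where f = P]) simp
      finally show ?thesis .
    qed
    have P12: "1 / sqrt (real X) = P (- 1/2)"
      using P_inv[of "1/2"] by (simp add: P_def powr_half_sqrt)
    have "type2_ratio X M Q V \<kappa> = 24 * (sqrt (real M * real Q) * V * (1 / (real X powr (3/4) * sqrt \<kappa>))) + 24 * (1 / (real X powr (3/4) * sqrt \<kappa>))
       + 20 * (real M * real Q * V * (1 / sqrt (real X))) + 20 * (1 / sqrt (real X))"
      unfolding type2_ratio_def by (simp add: add_divide_distrib distrib_left)
    also have "\<dots> \<le> 24 * (2 * P ((3 * \<delta> + s) / 2) * V * P (- 1/4 + A / 2 + \<epsilon> / 2)) + 24 * P (- 1/4 + A / 2 + \<epsilon> / 2)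
       + 20 * (2 * P (3 * \<delta> + s) * V * P (- 1/2)) + 20 * P (- 1/2)"
      unfolding P34 P12 using sMQ MQ \<kappa>V P0
      by (intro add_mono mult_left_mono mult_right_mono less_imp_le[OF P0]) auto
    also have "\<dots> = 48 * P ((3 * \<delta> + s) / 2 + (- A + \<epsilon>) + (- 1/4 + A / 2 + \<epsilon> / 2)) + 24 * P (- 1/4 + A / 2 + \<epsilon> / 2)
       + 40 * P (3 * \<delta> + s + (- A + \<epsilon>) + (- 1/2)) + 20 * P (- 1/2)"
      unfolding V_def P_add[symmetric] by simp
    also have "\<dots> \<le> 48 * P (- s) + 24 * P (- s) + 40 * P (- s) + 20 * P (- s)"
      using h \<delta> \<epsilon> A unfolding s_def by (intro mult_left_mono add_mono P_mono; argo)
    finally have G: "type2_ratio X M Q V \<kappa> \<le> 132 * P (- s)" by simp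
    have "2 / real Q \<le> 2 / P s" using Q1 P0[of s] by (intro divide_left_mono) auto
    also have "\<dots> = 2 * P (- s)" using P_inv[of s] by (simp add: field_simps)
    finally have "2 / real Q + type2_ratio X M Q V \<kappa> \<le> 134 * P (- s)" using G by simp
    moreover have "L ^ 5 \<le> P (5 * \<epsilon>)"
    proof -
      have "L ^ 5 \<le> P \<epsilon> ^ 5" using L by (intro power_mono) auto
      also have "\<dots> = P (5 * \<epsilon>)" using X1 by (simp add: P_def powr_powr mult.commute flip: powr_realpow)
      finally show ?thesis .
    qed
    ultimately have "40 * L ^ 5 * (2 / real Q + type2_ratio X M Q V \<kappa>) \<le> 40 * P (5 * \<epsilon>) * (134 * P (- s))"
      using L type2_ratio_nonneg[OF params] less_imp_le[OF P0] by (intro mult_mono mult_left_mono) auto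
    also have "\<dots> = 5360 * P (5 * \<epsilon> - s)" using P_add[of "5 * \<epsilon>" "- s"] by simp
    \<comment> \<open>5360 is replaced by the next perfect square, so that the root is
      explicit.\<close>
    also have "\<dots> \<le> 74\<^sup>2 * P (5 * \<epsilon> - s)" using P0[of "5 * \<epsilon> - s"] by simp
    finally have "sqrt (40 * L ^ 5 * (2 / real Q + type2_ratio X M Q V \<kappa>)) \<le> sqrt (74\<^sup>2 * P (5 * \<epsilon> - s))"
      by (rule real_sqrt_le_mono)
    also have "\<dots> = 74 * P ((5 * \<epsilon> - s) / 2)" by (simp add: real_sqrt_mult P_sqrt)
    finally have sq: "sqrt (40 * L ^ 5 * (2 / real Q + type2_ratio X M Q V \<kappa>)) \<le> 74 * P ((5 * \<epsilon> - s) / 2)" .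
    have "2 * L * type2_const X M Q V \<kappa> = 2 * L * (P 1 * sqrt (40 * L ^ 5 * (2 / real Q + type2_ratio X M Q V \<kappa>)))"
      by (simp add: type2_const_def P_1 L_def)
    also have "\<dots> \<le> 2 * P \<epsilon> * (P 1 * (74 * P ((5 * \<epsilon> - s) / 2)))"
      using L sq P0 type2_ratio_nonneg[OF params] less_imp_le[OF P0]
      by (intro mult_mono mult_left_mono) auto
    also have "\<dots> = 148 * P (\<epsilon> + 1 + (5 * \<epsilon> - s) / 2)" unfolding P_add[symmetric] by simp
    also have "\<dots> \<le> 148 * P (1 - \<delta>)"
      using \<epsilon> by (intro mult_left_mono P_mono) (auto simp: s_def field_simps)
    finally show ?thesis .
  qed
  have "norm (\<Sum>n\<in>{X..<Y}. mangoldt n * e2pi (\<xi> * real n + real m * f (real n)))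
      \<le> 127104 * P (1 - \<delta>) + 148 * P (1 - \<delta>)" using main T1 T2 by linarith
  also have "\<dots> \<le> 130000 * P (1 - \<delta>)" using P0[of "1 - \<delta>"] by simp
  finally show ?thesis by (simp add: P_def)
qed

text \<open>What remains are powers p^k with k \<ge> 2. Below 2 X they have p at most
  \<open>sqrt (2 X)\<close> and k at most x + 1, so they number at most a logarithm times
  \<open>sqrt X\<close> up to a constant.\<close>

lemma sum_mangoldt_nonprime_le:
  fixes X x Y :: nat
  assumes X: "X = 2 ^ x" and Y: "Y \<le> 2 * X"
  shows "(\<Sum>n\<in>{X..<Y}. if prime n then 0 else mangoldt n) \<le> 2 * sqrt X * (2 * (1 + ln (4 * real X))) * (1 + ln (4 * real X))"
proof -
  define L where "L = 1 + ln (4 * real X)"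
  have X1: "1 \<le> X" using X by simp
  define s where "s = nat \<lfloor>sqrt (2 * real X)\<rfloor>"
  let ?T = "{n\<in>{X..<Y}. primepow n \<and> \<not> prime n}"
  let ?R = "(\<lambda>(p, k). p ^ k) ` ({1..s} \<times> {1..Suc x})"
  have sub: "?T \<subseteq> ?R"
  proof
    fix n assume "n \<in> ?T"
    then have n: "X \<le> n" "n < Y" "primepow n" "\<not> prime n" by auto
    then obtain p k where p: "prime p" "0 < k" "n = p ^ k" by (auto simp: primepow_def)
    have k2: "2 \<le> k" using p n(4) by (cases "k = 1") auto
    have p2: "2 \<le> p" using p(1) by (rule prime_ge_2_nat)
    have n2: "n < 2 ^ Suc x" using n Y X by simp
    have "p\<^sup>2 \<le> p ^ k" using k2 p2 by (intro power_increasing) auto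
    then have "real (p\<^sup>2) \<le> real (2 * X)" using p n Y by (simp only: of_nat_le_iff)
    then have "real p \<le> sqrt (2 * real X)" by (intro real_le_rsqrt) simp
    then have "p \<le> s" unfolding s_def by (simp add: le_nat_iff le_floor_iff)
    moreover have "k < Suc x"
    proof -
      have "2 ^ k \<le> p ^ k" using p2 by (rule power_mono) simp
      also have "p ^ k < 2 ^ Suc x" using n2 p(3) by simp
      finally have "(2::nat) ^ k < 2 ^ Suc x" .
      then show ?thesis by (rule power_less_imp_less_exp[rotated]) simp
    qed
    ultimately have "(p, k) \<in> {1..s} \<times> {1..Suc x}" using p p2 by simp
    then show "n \<in> ?R" by (rule rev_image_eqI) (simp add: p(3))
  qed
  have "(\<Sum>n\<in>{X..<Y}. if prime n then 0 else mangoldt n :: real) = (\<Sum>n\<in>?T. mangoldt n)"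
    by (rule sum.mono_neutral_cong_right) (auto simp: mangoldt_def)
  also have "\<dots> \<le> (\<Sum>n\<in>?T. L)"
  proof (rule sum_mono)
    fix n assume n: "n \<in> ?T"
    then have "0 < n" "real n \<le> 4 * real X" using X1 Y by auto
    then have "ln (real n) \<le> ln (4 * real X)" by simp
    then show "mangoldt n \<le> L" using mangoldt_le[of n] \<open>0 < n\<close> by (simp add: L_def)
  qed
  also have "\<dots> = real (card ?T) * L" by simp
  also have "\<dots> \<le> (2 * sqrt X * (2 * L)) * L"
  proof (rule mult_right_mono)
    have "card ?T \<le> card ?R" by (rule card_mono[OF _ sub]) auto
    also have "\<dots> \<le> card ({1..s} \<times> {1..Suc x})" by (rule card_image_le) auto
    also have "\<dots> = s * Suc x" by (simp add: card_cartesian_product)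
    finally have "real (card ?T) \<le> real s * real (Suc x)" by (metis of_nat_le_iff of_nat_mult)
    also have "\<dots> \<le> (2 * sqrt X) * (2 * L)"
    proof (rule mult_mono)
      have "real s \<le> sqrt (2 * real X)" unfolding s_def by simp
      also have "\<dots> \<le> sqrt (4 * real X)" by (intro real_sqrt_le_mono) simp
      finally show "real s \<le> 2 * sqrt X" by (simp add: real_sqrt_mult)
      have "1/2 \<le> ln (2::real)" using ln_diff_le[of 1 "2::real"] by simp
      then have "real x * (1/2) \<le> real x * ln 2" by (rule mult_left_mono) simp
      also have "\<dots> = ln (real X)" by (simp add: X ln_realpow)
      also have "\<dots> \<le> ln (4 * real X)" using X1 by simp
      finally have "real x * (1/2) \<le> L - 1" by (simp add: L_def)
      moreover have "0 \<le> ln (4 * real X)" using X1 by simp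
      ultimately show "real (Suc x) \<le> 2 * L" by (simp add: L_def)
    qed auto
    finally show "real (card ?T) \<le> 2 * sqrt X * (2 * L)" .
  qed (use X1 in \<open>simp add: L_def\<close>)
  finally show ?thesis by (simp add: L_def)
qed

section \<open>Restriction to a residue class\<close>

lemma e2pi_eq_1_iff: "e2pi t = 1 \<longleftrightarrow> t \<in> \<int>"
proof
  assume "e2pi t = 1"
  then have "sin (pi * t) = 0" using norm_e2pi_minus_1[of t] by simp
  then obtain i :: int where "pi * t = of_int i * pi" by (auto simp: sin_zero_iff_int2)
  then have "t = of_int i" by simp
  then show "t \<in> \<int>" by simp
qed (auto elim!: Ints_cases)

lemma residue_class_detect:
  fixes a q n :: nat
  assumes q: "0 < q"
  shows "(\<Sum>j<q. e2pi (real j / real q * real n) * e2pi (- (real j / real q * real a))) = (if [n = a] (mod q) then of_nat q else 0)"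
proof -
  let ?t = "(real n - real a) / real q"
  have eq: "(\<Sum>j<q. e2pi (real j / real q * real n) * e2pi (- (real j / real q * real a))) = (\<Sum>j<q. e2pi ?t ^ j)"
  proof (rule sum.cong[OF refl])
    fix j
    have "real j / real q * real n + - (real j / real q * real a) = real j * ?t"
      by (simp add: diff_divide_distrib right_diff_distrib)
    then show "e2pi (real j / real q * real n) * e2pi (- (real j / real q * real a)) = e2pi ?t ^ j"
      by (simp only: e2pi_power e2pi_add[symmetric])
  qed
  have iff: "[n = a] (mod q) \<longleftrightarrow> ?t \<in> \<int>"
  proof
    assume "[n = a] (mod q)"
    then have "[int n = int a] (mod int q)" by (simp add: cong_int_iff)
    then have "int q dvd int n - int a" by (simp add: cong_iff_dvd_diff)
    then obtain k where k: "int n - int a = int q * k" by auto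
    have "real n - real a = of_int (int n - int a)" by simp
    then have "real n - real a = real q * of_int k" unfolding k by simp
    then show "?t \<in> \<int>" using q by simp
  next
    assume "?t \<in> \<int>"
    then obtain k where "?t = of_int k" by (auto elim: Ints_cases)
    then have "real n - real a = of_int (int q * k)" using q by (simp add: field_simps)
    then have "of_int (int n - int a) = (of_int (int q * k) :: real)" by simp
    then have "int n - int a = int q * k" by (simp only: of_int_eq_iff)
    then have "int q dvd int n - int a" by simp
    then show "[n = a] (mod q)" by (simp add: cong_iff_dvd_diff flip: cong_int_iff)
  qed
  show ?thesis
  proof (cases "[n = a] (mod q)")
    case True
    then have "e2pi ?t = 1" using iff e2pi_eq_1_iff by blast
    then show ?thesis unfolding eq using True by simp
  next
    case False
    then have "e2pi ?t \<noteq> 1" using iff e2pi_eq_1_iff by blast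
    moreover have "e2pi ?t ^ q = 1"
    proof -
      have "real q * ?t = of_int (int n - int a)" using q by simp
      then show ?thesis by (simp only: e2pi_power e2pi_of_int)
    qed
    ultimately show ?thesis unfolding eq using False by (simp add: geometric_sum)
  qed
qed

text \<open>Detecting the class by additive characters multiplies the summands by e(j n / q), and
  the average over j compensates the factor q. A bound uniform in j is therefore inherited without
  loss.\<close>

lemma residue_class_bound:
  fixes z :: "nat \<Rightarrow> complex" and a q :: nat
  assumes q: "0 < q" and B: "\<And>j. j < q \<Longrightarrow> norm (\<Sum>n\<in>S. e2pi (real j / real q * real n) * z n) \<le> B"
  shows "norm (\<Sum>n\<in>S. if [n = a] (mod q) then z n else 0) \<le> B"
proof -
  have "of_nat q * (\<Sum>n\<in>S. if [n = a] (mod q) then z n else 0) =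
     (\<Sum>n\<in>S. (\<Sum>j<q. e2pi (real j / real q * real n) * e2pi (- (real j / real q * real a))) * z n)"
    unfolding residue_class_detect[OF q] sum_distrib_left by (intro sum.cong) auto
  also have "\<dots> = (\<Sum>n\<in>S. \<Sum>j<q. e2pi (- (real j / real q * real a)) * (e2pi (real j / real q * real n) * z n))"
    by (simp only: sum_distrib_left sum_distrib_right mult_ac)
  also have "\<dots> = (\<Sum>j<q. \<Sum>n\<in>S. e2pi (- (real j / real q * real a)) * (e2pi (real j / real q * real n) * z n))"
    by (rule sum.swap)
  also have "\<dots> = (\<Sum>j<q. e2pi (- (real j / real q * real a)) * (\<Sum>n\<in>S. e2pi (real j / real q * real n) * z n))"
    by (simp only: sum_distrib_left)
  finally have "norm (of_nat q * (\<Sum>n\<in>S. if [n = a] (mod q) then z n else 0)) =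
      norm (\<Sum>j<q. e2pi (- (real j / real q * real a)) * (\<Sum>n\<in>S. e2pi (real j / real q * real n) * z n))"
    by (rule arg_cong)
  also have "\<dots> \<le> (\<Sum>j<q. B)"
    by (rule sum_norm_le) (use B in \<open>simp add: norm_mult del: times_divide_eq_left\<close>)
  finally show ?thesis using q by (simp add: norm_mult)
qed

section \<open>Fractional parts along weighted primes\<close>

definition prime_weight :: "nat \<Rightarrow> nat \<Rightarrow> (real \<Rightarrow> real) \<Rightarrow> nat \<Rightarrow> real" where
  "prime_weight q a g n = (if prime n \<and> [n = a] (mod q) then ln (real n) / g (real n) else 0)"

text \<open>The oscillating part of a counting function: the number of integers in [\<phi>(n),
  \<phi>(n + 1)) is \<phi>(n + 1) - \<phi>(n) plus this term.\<close>

definition frac_jump :: "(real \<Rightarrow> real) \<Rightarrow> nat \<Rightarrow> real" where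
  "frac_jump \<phi> n = frac (- \<phi> (real n + 1)) - frac (- \<phi> (real n))"

context
  fixes X x q a :: nat and A chi \<epsilon> \<delta> :: real and \<phi> f1 :: "real \<Rightarrow> real"
  assumes X: "X = 2 ^ x" "64 < X" and lnX: "1 + ln (4 * real X) \<le> real X powr \<epsilon>"
    and A: "0 \<le> A" and chi: "0 < chi" "16 * A + 28 * chi < 1"
    and \<epsilon>: "\<epsilon> = chi / 100" and \<delta>: "\<delta> = A + chi + 4 * \<epsilon>"
    and phase: "local_phase X (real X powr (- A + \<epsilon>)) (real X powr (- 1 - A - \<epsilon>)) \<phi>"
      "local_phase X (real X powr (- A + \<epsilon>)) (real X powr (- 1 - A - \<epsilon>)) (\<lambda>y. \<phi> (y + 1))"
    and f1: "\<And>y. real X \<le> y \<Longrightarrow> y powr (- A - \<epsilon>) \<le> f1 y"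
    and f1_mono: "\<And>y z. real X \<le> y \<Longrightarrow> y \<le> z \<Longrightarrow> f1 z \<le> f1 y"
    and q: "0 < q"
begin

private abbreviation (input) "w \<equiv> prime_weight q a f1"
private abbreviation (input) "d \<equiv> frac_jump \<phi>"
private abbreviation (input) "Bw \<equiv> 2 * (4 * real X powr (A + \<epsilon>)) * (130004 * real X powr (1 - \<delta>))"
private abbreviation (input) "Bd \<equiv> 2080144 * real X powr (1 - chi - 2 * \<epsilon>)"

private lemma params: "0 < \<epsilon>" "0 < \<delta>" "\<delta> \<le> 1/4" "\<epsilon> \<le> 1/100" "1 \<le> real X" "A \<le> 1/16" "3 * \<delta> \<le> 1"
proof -
  have "A + chi + chi / 25 \<le> 1/4" using chi A by argo
  then show "\<delta> \<le> 1/4" by (simp add: \<delta> \<epsilon>)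
  then show "3 * \<delta> \<le> 1" by simp
  show "0 < \<epsilon>" "0 < \<delta>" "\<epsilon> \<le> 1/100" "1 \<le> real X" "A \<le> 1/16" using chi A X by (auto simp: \<epsilon> \<delta>)
qed

lemma prime_exp_sum:
  assumes s: "\<psi> = \<phi> \<or> \<psi> = (\<lambda>y. \<phi> (y + 1))" and m: "0 < m" "real m \<le> real X powr (3 * \<delta>)" and Y: "Y \<le> 2 * X"
  shows "norm (\<Sum>n\<in>{X..<Y}. if prime n then of_real (ln (real n)) * e2pi (\<xi> * real n + real m * \<psi> (real n)) else 0)
     \<le> 130004 * real X powr (1 - \<delta>)"
proof -
  let ?e = "\<lambda>n::nat. e2pi (\<xi> * real n + real m * \<psi> (real n))"
  have ph: "local_phase X (real X powr (- A + \<epsilon>)) (real X powr (- 1 - A - \<epsilon>)) \<psi>"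
    using s phase by auto
  have 1: "norm (\<Sum>n\<in>{X..<Y}. mangoldt n * ?e n) \<le> 130000 * real X powr (1 - \<delta>)"
  proof (rule mangoldt_exp_sum_power[OF A params(2,1) _ _ _ _ _ _ X lnX ph Y m])
    show "13/2 * \<delta> - A / 2 + 37/2 * \<epsilon> \<le> 1/2" unfolding \<delta> \<epsilon> using A chi by argo
    show "5 * \<delta> + A / 2 + 35/2 * \<epsilon> \<le> 1/2" unfolding \<delta> \<epsilon> using A chi by argo
    show "12 * \<delta> - A + 34 * \<epsilon> \<le> 1" unfolding \<delta> \<epsilon> using A chi by argo
    \<comment> \<open>After inserting \<delta> and \<epsilon> and multiplying by 4 this reads 16 A +
      19.26 chi \<le> 1; it is the condition that accounts for the coefficient 16.\<close>
    show "9/2 * \<delta> - A / 2 + 27/2 * \<epsilon> \<le> 1/4" unfolding \<delta> \<epsilon> using A chi by argo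
    show "2 * \<delta> + A / 2 + 17/2 * \<epsilon> \<le> 1/4" unfolding \<delta> \<epsilon> using A chi by argo
    show "7 * \<delta> - A + 17 * \<epsilon> \<le> 1/2" unfolding \<delta> \<epsilon> using A chi by argo
  qed
  have "(\<Sum>n\<in>{X..<Y}. if prime n then of_real (ln (real n)) * ?e n else 0) =
     (\<Sum>n\<in>{X..<Y}. mangoldt n * ?e n) - (\<Sum>n\<in>{X..<Y}. of_real (if prime n then 0 else mangoldt n) * ?e n)"
    unfolding sum_subtractf[symmetric] by (intro sum.cong refl) auto
  also have "norm \<dots> \<le> 130000 * real X powr (1 - \<delta>) + (\<Sum>n\<in>{X..<Y}. if prime n then 0 else mangoldt n)"
  proof (intro order.trans[OF norm_triangle_ineq4] add_mono 1)
    show "norm (\<Sum>n\<in>{X..<Y}. of_real (if prime n then 0 else mangoldt n) * ?e n) \<le>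
        (\<Sum>n\<in>{X..<Y}. if prime n then 0 else mangoldt n)"
      by (rule sum_norm_le) (simp add: norm_mult mangoldt_nonneg)
  qed
  also have "(\<Sum>n\<in>{X..<Y}. if prime n then 0 else mangoldt n) \<le> 2 * sqrt X * (2 * (1 + ln (4 * real X))) * (1 + ln (4 * real X))"
    by (rule sum_mangoldt_nonprime_le[OF X(1) Y])
  also have "\<dots> \<le> 2 * sqrt X * (2 * real X powr \<epsilon>) * real X powr \<epsilon>"
    using lnX params(5) by (intro mult_mono mult_left_mono) auto
  also have "\<dots> = 4 * real X powr (1/2 + \<epsilon> + \<epsilon>)"
    by (simp only: powr_add powr_half_sqrt of_nat_0_le_iff)
  also have "\<dots> \<le> 4 * real X powr (1 - \<delta>)"
    using params by (intro mult_left_mono powr_mono) auto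
  finally show ?thesis by simp
qed

lemma residue_exp_sum:
  assumes s: "\<psi> = \<phi> \<or> \<psi> = (\<lambda>y. \<phi> (y + 1))" and m: "0 < m" "real m \<le> real X powr (3 * \<delta>)" and Y: "Y \<le> 2 * X"
  shows "norm (\<Sum>n\<in>{X..<Y}. if prime n \<and> [n = a] (mod q) then of_real (ln (real n)) * e2pi (\<xi> * real n + real m * \<psi> (real n)) else 0)
     \<le> 130004 * real X powr (1 - \<delta>)"
proof -
  let ?z = "\<lambda>\<xi> n. if prime n then of_real (ln (real n)) * e2pi (\<xi> * real n + real m * \<psi> (real n)) else 0"
  have "norm (\<Sum>n\<in>{X..<Y}. if [n = a] (mod q) then ?z \<xi> n else 0) \<le> 130004 * real X powr (1 - \<delta>)"
  proof (rule residue_class_bound[OF q])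
    fix j
    have "(\<Sum>n\<in>{X..<Y}. e2pi (real j / real q * real n) * ?z \<xi> n) = (\<Sum>n\<in>{X..<Y}. ?z (real j / real q + \<xi>) n)"
    proof (rule sum.cong[OF refl])
      fix n
      have "(real j / real q + \<xi>) * real n + real m * \<psi> (real n) = real j / real q * real n + (\<xi> * real n + real m * \<psi> (real n))"
        by (simp add: distrib_right)
      then show "e2pi (real j / real q * real n) * ?z \<xi> n = ?z (real j / real q + \<xi>) n"
        by (simp only: e2pi_add[of "real j / real q * real n"]) simp
    qed
    then show "norm (\<Sum>n\<in>{X..<Y}. e2pi (real j / real q * real n) * ?z \<xi> n) \<le> 130004 * real X powr (1 - \<delta>)"
      using prime_exp_sum[OF s m Y] by simp
  qed
  also have "(\<Sum>n\<in>{X..<Y}. if [n = a] (mod q) then ?z \<xi> n else 0) =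
     (\<Sum>n\<in>{X..<Y}. if prime n \<and> [n = a] (mod q) then of_real (ln (real n)) * e2pi (\<xi> * real n + real m * \<psi> (real n)) else 0)"
    by (intro sum.cong refl) auto
  finally show ?thesis .
qed

lemma f1_pos: "real X \<le> y \<Longrightarrow> 0 < f1 y"
  using f1[of y] params(5) by (smt (verit) powr_gt_zero)

lemma inverse_f1_le:
  assumes "X \<le> n" "n \<le> 2 * X"
  shows "1 / f1 (real n) \<le> 4 * real X powr (A + \<epsilon>)"
proof -
  have n: "real X \<le> real n" "real n \<le> 2 * real X" "1 \<le> real n" using assms params(5) by auto
  have "1 / f1 (real n) \<le> 1 / real n powr (- A - \<epsilon>)"
    using f1[OF n(1)] n(3) by (intro divide_left_mono mult_pos_pos f1_pos[OF n(1)]) auto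
  also have "\<dots> = real n powr (A + \<epsilon>)" using n by (simp add: powr_minus_divide powr_diff powr_add field_simps)
  also have "\<dots> \<le> (2 * real X) powr (A + \<epsilon>)" using n A params by (intro powr_mono2) auto
  also have "\<dots> = 2 powr (A + \<epsilon>) * real X powr (A + \<epsilon>)" by (simp add: powr_mult)
  also have "\<dots> \<le> 2 powr 2 * real X powr (A + \<epsilon>)" using params by (intro mult_right_mono powr_mono) auto
  finally show ?thesis by simp
qed

text \<open>The weight 1 / \<open>f1\<close> is increasing because \<open>f1\<close> decreases, so
  partial summation costs only twice its upper bound.\<close>

lemma weighted_exp_sum:
  assumes s: "\<psi> = \<phi> \<or> \<psi> = (\<lambda>y. \<phi> (y + 1))" and m: "0 < m" "real m \<le> real X powr (3 * \<delta>)" and Y: "Y \<le> 2 * X"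
  shows "norm (\<Sum>n\<in>{X..<Y}. of_real (if prime n \<and> [n = a] (mod q) then ln (real n) / f1 (real n) else 0) *
      e2pi (\<xi> * real n + real m * \<psi> (real n))) \<le> Bw"
proof -
  let ?z = "\<lambda>n. if prime n \<and> [n = a] (mod q) then of_real (ln (real n)) * e2pi (\<xi> * real n + real m * \<psi> (real n)) else 0"
  have "norm (\<Sum>n\<in>{X..<Y}. of_real (1 / f1 (real n)) * ?z n) \<le> Bw"
  proof (rule abel_bound)
    fix i assume i: "X \<le> i" "i < Y"
    then show "0 \<le> 1 / f1 (real i) \<and> 1 / f1 (real i) \<le> 4 * real X powr (A + \<epsilon>)"
      using inverse_f1_le[of i] f1_pos[of "real i"] Y by (auto intro: less_imp_le)
  next
    fix i assume i: "X \<le> i" "Suc i < Y"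
    then show "1 / f1 (real i) \<le> 1 / f1 (real (Suc i))"
      using f1_mono[of "real i" "real (Suc i)"] f1_pos[of "real i"] f1_pos[of "real (Suc i)"]
      by (intro divide_left_mono mult_pos_pos) auto
  next
    fix n assume "X < n" "n \<le> Y"
    then show "norm (\<Sum>i\<in>{X..<n}. ?z i) \<le> 130004 * real X powr (1 - \<delta>)"
      using residue_exp_sum[OF s m, of n] Y by simp
  qed auto
  also have "(\<Sum>n\<in>{X..<Y}. of_real (1 / f1 (real n)) * ?z n) =
     (\<Sum>n\<in>{X..<Y}. of_real (if prime n \<and> [n = a] (mod q) then ln (real n) / f1 (real n) else 0) * e2pi (\<xi> * real n + real m * \<psi> (real n)))"
    by (intro sum.cong refl) auto
  finally show ?thesis .
qed

lemma w_nonneg: "X \<le> n \<Longrightarrow> 0 \<le> w n"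
  using f1_pos[of "real n"] params(5) by (simp add: prime_weight_def)

lemma sum_w_le:
  assumes Y: "Y \<le> 2 * X"
  shows "(\<Sum>n\<in>{X..<Y}. w n) \<le> 4 * real X powr (1 + A + 2 * \<epsilon>)"
proof -
  have "(\<Sum>n\<in>{X..<Y}. w n) \<le> (\<Sum>n\<in>{X..<2 * X}. real X powr \<epsilon> * (4 * real X powr (A + \<epsilon>)))"
  proof (rule sum_mono2[THEN order.trans])
    show "{X..<Y} \<subseteq> {X..<2 * X}" using Y by auto
    show "0 \<le> w n" if "n \<in> {X..<2 * X} - {X..<Y}" for n using w_nonneg[of n] that by auto
    show "(\<Sum>n\<in>{X..<2 * X}. w n) \<le> (\<Sum>n\<in>{X..<2 * X}. real X powr \<epsilon> * (4 * real X powr (A + \<epsilon>)))"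
    proof (rule sum_mono)
      fix n assume n: "n \<in> {X..<2 * X}"
      have n1: "1 \<le> real n" using n params(5) by auto
      have "real n \<le> 4 * real X" using n by auto
      then have "ln (real n) \<le> ln (4 * real X)" using n1 by simp
      then have "ln (real n) \<le> real X powr \<epsilon>" using lnX by linarith
      moreover have "1 / f1 (real n) \<le> 4 * real X powr (A + \<epsilon>)" using n by (intro inverse_f1_le) auto
      ultimately have "ln (real n) * (1 / f1 (real n)) \<le> real X powr \<epsilon> * (4 * real X powr (A + \<epsilon>))"
        using n1 f1_pos[of "real n"] n by (intro mult_mono) auto
      then show "w n \<le> real X powr \<epsilon> * (4 * real X powr (A + \<epsilon>))" by (simp add: prime_weight_def)
    qed
  qed simp
  also have "\<dots> = real X * (real X powr \<epsilon> * (4 * real X powr (A + \<epsilon>)))" by simp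
  also have "\<dots> = 4 * real X powr (1 + A + 2 * \<epsilon>)"
  proof -
    have "real X powr (1 + A + 2 * \<epsilon>) = real X powr (1 + \<epsilon> + (A + \<epsilon>))" by (simp add: algebra_simps)
    then show ?thesis using params(5) by (simp only: powr_add) simp
  qed
  finally show ?thesis .
qed

text \<open>The factor 1 + \<sigma> cos keeps the weights nonnegative, as
  \<open>frac_equidistribution\<close> requires; the values \<sigma> = 1 and \<sigma> = 0 will be
  subtracted later. Expanding the cosine yields the linear frequencies 0, \<xi> and -\<xi> with
  total coefficient 1 + \<sigma> \<le> 2.\<close>

lemma discrepancy_cos:
  assumes Y: "Y \<le> 2 * X" and \<sigma>: "0 \<le> \<sigma>" "\<sigma> \<le> 1"
  shows "\<bar>\<Sum>n\<in>{X..<Y}. w n * (1 + \<sigma> * cos (2 * pi * (\<xi> * real n + \<beta>))) * d n\<bar> \<le> Bd"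
proof -
  define W where "W = (\<lambda>n. w n * (1 + \<sigma> * cos (2 * pi * (\<xi> * real n + \<beta>))))"
  \<comment> \<open>With this M the approximation error M^(-1/3) is of order X^(-\<delta>).\<close>
  define M where "M = nat \<lfloor>real X powr (3 * \<delta>)\<rfloor>"
  have big: "1 \<le> real X powr (3 * \<delta>)" using params by (simp add: ge_one_powr_ge_zero)
  have M: "0 < M" "real M \<le> real X powr (3 * \<delta>)" "real X powr (3 * \<delta>) \<le> 2 * real M"
  proof -
    show "real M \<le> real X powr (3 * \<delta>)" unfolding M_def by simp
    have "real X powr (3 * \<delta>) < real M + 1" unfolding M_def by linarith
    moreover have "1 \<le> M" unfolding M_def using big by (simp add: le_nat_iff le_floor_iff)
    ultimately show "0 < M" "real X powr (3 * \<delta>) \<le> 2 * real M" by auto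
  qed
  have cosb: "0 \<le> 1 + \<sigma> * cos t" "1 + \<sigma> * cos t \<le> 2" for t
  proof -
    have "\<sigma> * \<bar>cos t\<bar> \<le> 1 * 1" using \<sigma> by (intro mult_mono) auto
    then have "\<bar>\<sigma> * cos t\<bar> \<le> 1" using \<sigma> by (simp add: abs_mult)
    then show "0 \<le> 1 + \<sigma> * cos t" "1 + \<sigma> * cos t \<le> 2" by linarith+
  qed
  have W0: "0 \<le> W n" if "n \<in> {X..<Y}" for n
    unfolding W_def using that w_nonneg[of n] cosb by (intro mult_nonneg_nonneg) auto
  have sumW: "(\<Sum>n\<in>{X..<Y}. W n) \<le> 8 * real X powr (1 + A + 2 * \<epsilon>)"
  proof -
    have "(\<Sum>n\<in>{X..<Y}. W n) \<le> (\<Sum>n\<in>{X..<Y}. w n * 2)"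
      unfolding W_def using w_nonneg cosb by (intro sum_mono mult_left_mono) auto
    also have "\<dots> = 2 * (\<Sum>n\<in>{X..<Y}. w n)" by (simp add: sum_distrib_left mult.commute)
    finally show ?thesis using sum_w_le[OF Y] by simp
  qed
  have B00: "0 \<le> Bw" by simp
  have E: "norm (\<Sum>n\<in>{X..<Y}. of_real (W n) * e2pi (real k * (- \<psi> (real n)))) \<le> 2 * Bw"
    if k: "1 \<le> k" "k < M" and s: "\<psi> = \<phi> \<or> \<psi> = (\<lambda>y. \<phi> (y + 1))" for k \<psi>
  proof -
    have k': "0 < k" "real k \<le> real X powr (3 * \<delta>)" using k M(2) by auto
    let ?T = "\<lambda>\<xi>. \<Sum>n\<in>{X..<Y}. of_real (w n) * e2pi (\<xi> * real n + real k * \<psi> (real n))"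
    have T: "norm (?T \<xi>) \<le> Bw" for \<xi> using weighted_exp_sum[OF s k' Y] unfolding prime_weight_def .
    have cos_e: "complex_of_real (cos (2 * pi * t)) = (e2pi t + cnj (e2pi t)) / 2" for t
      by (simp add: e2pi_cis complex_eq_iff)
    have "(\<Sum>n\<in>{X..<Y}. of_real (W n) * e2pi (real k * \<psi> (real n))) =
       ?T 0 + of_real \<sigma> / 2 * (e2pi \<beta> * ?T \<xi>) + of_real \<sigma> / 2 * (cnj (e2pi \<beta>) * ?T (- \<xi>))"
      unfolding sum_distrib_left sum.distrib[symmetric]
    proof (rule sum.cong[OF refl])
      fix n
      let ?E = "e2pi (real k * \<psi> (real n))"
      have t: "e2pi (\<xi> * real n + \<beta>) = e2pi (\<xi> * real n) * e2pi \<beta>" by (rule e2pi_add)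
      have 1: "e2pi (0 * real n + real k * \<psi> (real n)) = ?E" by simp
      have 2: "e2pi (\<xi> * real n + real k * \<psi> (real n)) = e2pi (\<xi> * real n) * ?E" by (rule e2pi_add)
      have 3: "e2pi (- \<xi> * real n + real k * \<psi> (real n)) = cnj (e2pi (\<xi> * real n)) * ?E"
        by (simp only: e2pi_add mult_minus_left e2pi_minus)
      have "complex_of_real (W n) = of_real (w n) * (1 + of_real \<sigma> * ((e2pi (\<xi> * real n) * e2pi \<beta> + cnj (e2pi (\<xi> * real n) * e2pi \<beta>)) / 2))"
        unfolding W_def of_real_mult of_real_add cos_e t by simp
      then show "complex_of_real (W n) * ?E = of_real (w n) * e2pi (0 * real n + real k * \<psi> (real n)) +
          of_real \<sigma> / 2 * (e2pi \<beta> * (of_real (w n) * e2pi (\<xi> * real n + real k * \<psi> (real n)))) +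
          of_real \<sigma> / 2 * (cnj (e2pi \<beta>) * (of_real (w n) * e2pi (- \<xi> * real n + real k * \<psi> (real n))))"
        unfolding 1 2 3 by (simp add: algebra_simps add_divide_distrib)
    qed
    then have "norm (\<Sum>n\<in>{X..<Y}. of_real (W n) * e2pi (real k * \<psi> (real n))) \<le>
        norm (?T 0) + norm (of_real \<sigma> / 2 * (e2pi \<beta> * ?T \<xi>)) + norm (of_real \<sigma> / 2 * (cnj (e2pi \<beta>) * ?T (- \<xi>)))"
      by (simp only:) (intro norm_triangle_mono order.refl)
    also have "\<dots> \<le> Bw + 1 / 2 * Bw + 1 / 2 * Bw"
    proof -
      have "norm (of_real \<sigma> / 2 * (e2pi \<beta> * ?T \<xi>)) = \<sigma> / 2 * norm (?T \<xi>)" using \<sigma> by (simp add: norm_mult)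
      also have "\<dots> \<le> 1 / 2 * Bw" using \<sigma> T B00 by (intro mult_mono) auto
      finally have 1: "norm (of_real \<sigma> / 2 * (e2pi \<beta> * ?T \<xi>)) \<le> 1 / 2 * Bw" .
      have "norm (of_real \<sigma> / 2 * (cnj (e2pi \<beta>) * ?T (- \<xi>))) = \<sigma> / 2 * norm (?T (- \<xi>))" using \<sigma> by (simp add: norm_mult)
      also have "\<dots> \<le> 1 / 2 * Bw" using \<sigma> T[of "- \<xi>"] B00 by (intro mult_mono) auto
      finally have 2: "norm (of_real \<sigma> / 2 * (cnj (e2pi \<beta>) * ?T (- \<xi>))) \<le> 1 / 2 * Bw" .
      show ?thesis by (intro add_mono T 1 2)
    qed
    finally have "norm (\<Sum>n\<in>{X..<Y}. of_real (W n) * e2pi (real k * \<psi> (real n))) \<le> 2 * Bw" by (simp add: mult_ac)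
    moreover have "(\<Sum>n\<in>{X..<Y}. of_real (W n) * e2pi (real k * (- \<psi> (real n)))) =
       cnj (\<Sum>n\<in>{X..<Y}. of_real (W n) * e2pi (real k * \<psi> (real n)))"
      by (simp add: e2pi_minus)
    ultimately show ?thesis by (simp only: complex_mod_cnj)
  qed
  define R where "R = 2 * Bw * (1 + ln (real M)) + 5 * real M powr (- (1/3)) * (\<Sum>n\<in>{X..<Y}. W n)"
  have 1: "(\<Sum>n\<in>{X..<Y}. W n * (frac (- \<phi> (real n + 1)) - frac (- \<phi> (real n)))) \<le> R"
    unfolding R_def
    by (rule frac_equidistribution[OF M(1) _ W0]) (use B00 E[of _ \<phi>] E[of _ "\<lambda>y. \<phi> (y + 1)"] in auto)
  have 2: "(\<Sum>n\<in>{X..<Y}. W n * (frac (- \<phi> (real n)) - frac (- \<phi> (real n + 1)))) \<le> R"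
    unfolding R_def
    by (rule frac_equidistribution[OF M(1) _ W0]) (use B00 E[of _ \<phi>] E[of _ "\<lambda>y. \<phi> (y + 1)"] in auto)
  have "(\<Sum>n\<in>{X..<Y}. W n * (frac (- \<phi> (real n)) - frac (- \<phi> (real n + 1)))) = - (\<Sum>n\<in>{X..<Y}. W n * d n)"
    by (simp add: frac_jump_def sum_negf[symmetric] right_diff_distrib)
  then have "\<bar>\<Sum>n\<in>{X..<Y}. W n * d n\<bar> \<le> R" using 1 2 unfolding frac_jump_def by linarith
  \<comment> \<open>\<delta> = A + chi + 4 \<epsilon> gives both parts of R the exponent 1 - chi - 2
    \<epsilon>: the first loses A + 2 \<epsilon> through the weight and a logarithm, the second
    loses the same through the total weight.\<close>
  also have "R \<le> Bd"
  proof -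
    have lnM: "1 + ln (real M) \<le> real X powr \<epsilon>"
    proof -
      have "ln (real M) \<le> ln (real X powr (3 * \<delta>))"
        by (subst ln_le_cancel_iff) (use M params(5) in auto)
      also have "\<dots> = 3 * \<delta> * ln (real X)" using params(5) by (simp add: ln_powr)
      also have "\<dots> \<le> 1 * ln (real X)" using params by (intro mult_right_mono) auto
      also have "\<dots> \<le> ln (4 * real X)" using params(5) by simp
      finally show ?thesis using lnX by linarith
    qed
    have "2 * Bw * (1 + ln (real M)) \<le> 2 * Bw * real X powr \<epsilon>"
      using B00 lnM by (intro mult_left_mono) auto
    also have "\<dots> = 2080064 * (real X powr (A + \<epsilon>) * real X powr (1 - \<delta>) * real X powr \<epsilon>)"
      by simp
    also have "\<dots> = 2080064 * real X powr (1 - chi - 2 * \<epsilon>)"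
      unfolding powr_add[symmetric] \<delta> by (simp add: algebra_simps)
    finally have a: "2 * Bw * (1 + ln (real M)) \<le> 2080064 * real X powr (1 - chi - 2 * \<epsilon>)" .
    have "real M powr (- (1/3)) \<le> (real X powr (3 * \<delta>) / 2) powr (- (1/3))"
      using M big params(5) by (intro powr_mono2') auto
    also have "\<dots> = real X powr (- \<delta>) * 2 powr (1/3)"
      by (simp add: powr_divide powr_powr powr_minus_divide)
    also have "\<dots> \<le> real X powr (- \<delta>) * 2 powr 1" by (intro mult_left_mono powr_mono) auto
    finally have m: "real M powr (- (1/3)) \<le> 2 * real X powr (- \<delta>)" by simp
    have "5 * real M powr (- (1/3)) * (\<Sum>n\<in>{X..<Y}. W n) \<le> 5 * (2 * real X powr (- \<delta>)) * (8 * real X powr (1 + A + 2 * \<epsilon>))"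
      using m sumW W0 by (intro mult_mono mult_left_mono sum_nonneg) auto
    also have "\<dots> = 80 * (real X powr (- \<delta>) * real X powr (1 + A + 2 * \<epsilon>))" by simp
    also have "\<dots> = 80 * real X powr (1 - chi - 2 * \<epsilon>)"
      unfolding powr_add[symmetric] \<delta> by (simp add: algebra_simps)
    finally have b: "5 * real M powr (- (1/3)) * (\<Sum>n\<in>{X..<Y}. W n) \<le> 80 * real X powr (1 - chi - 2 * \<epsilon>)" .
    have "R \<le> 2080064 * real X powr (1 - chi - 2 * \<epsilon>) + 80 * real X powr (1 - chi - 2 * \<epsilon>)"
      unfolding R_def by (rule add_mono[OF a b])
    then show ?thesis by simp
  qed
  finally show ?thesis by (simp only: W_def)
qed

text \<open>Subtracting the case \<sigma> = 0 from \<sigma> = 1 isolates the cosine. The phases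
  \<beta> = 0 and \<beta> = -1/4 turn it into the real and the imaginary part of the
  exponential.\<close>

lemma discrepancy:
  assumes Y: "Y \<le> 2 * X"
  shows "norm (\<Sum>n\<in>{X..<Y}. of_real (w n * d n) * e2pi (\<xi> * real n)) \<le> 4 * Bd"
proof -
  have c: "\<bar>\<Sum>n\<in>{X..<Y}. w n * d n * cos (2 * pi * (\<xi> * real n + \<beta>))\<bar> \<le> 2 * Bd" for \<beta>
  proof -
    have "(\<Sum>n\<in>{X..<Y}. w n * d n * cos (2 * pi * (\<xi> * real n + \<beta>))) =
      (\<Sum>n\<in>{X..<Y}. w n * (1 + 1 * cos (2 * pi * (\<xi> * real n + \<beta>))) * d n) - (\<Sum>n\<in>{X..<Y}. w n * (1 + 0 * cos (2 * pi * (\<xi> * real n + \<beta>))) * d n)"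
      unfolding sum_subtractf[symmetric] by (intro sum.cong refl) (simp add: algebra_simps)
    then show ?thesis
      using discrepancy_cos[OF Y, of 1 \<xi> \<beta>] discrepancy_cos[OF Y, of 0 \<xi> \<beta>] by linarith
  qed
  let ?S = "\<Sum>n\<in>{X..<Y}. of_real (w n * d n) * e2pi (\<xi> * real n)"
  have "Re ?S = (\<Sum>n\<in>{X..<Y}. w n * d n * cos (2 * pi * (\<xi> * real n + 0)))"
    by (simp add: e2pi_cis)
  moreover have "Im ?S = (\<Sum>n\<in>{X..<Y}. w n * d n * cos (2 * pi * (\<xi> * real n + - (1/4))))"
  proof -
    have "cos (2 * pi * (t + - (1/4))) = sin (2 * pi * t)" for t
    proof -
      have "2 * pi * (t + - (1/4)) = - (pi / 2 - 2 * pi * t)" by (simp add: algebra_simps)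
      then show ?thesis by (simp only: cos_minus) (simp add: cos_diff)
    qed
    then show ?thesis by (simp add: e2pi_cis)
  qed
  ultimately show ?thesis using c[of 0] c[of "- (1/4)"] cmod_le[of ?S] by simp
qed

end

section \<open>Proof of the theorem\<close>

text \<open>With u = \<phi>(p) and v = \<phi>(p + 1), the integers n with u \<le> n < v number ceil
  v - ceil u, and frac(-t) = ceil t - t. The gap of at most 1/2 forces this number to be 0 or 1, so
  it equals the indicator.\<close>

lemma family_indicator:
  fixes h \<phi> :: "real \<Rightarrow> real" and p :: nat
  assumes fam: "in_family c x0 h" and \<phi>: "\<phi> = inv_into {x0..} h"
    and p: "prime p" "h x0 \<le> real p" and gap: "\<phi> (real p + 1) - \<phi> (real p) \<le> 1/2"
  shows "(if p \<in> primes_of x0 h then 1 else 0) =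
     (\<phi> (real p + 1) - \<phi> (real p)) + (frac (- \<phi> (real p + 1)) - frac (- \<phi> (real p)))"
proof -
  have "\<exists>\<theta>. (\<forall>x>x0. (h has_real_derivative h x * (c + \<theta> x) / x) (at x)) \<and> (\<theta> \<longlongrightarrow> 0) at_top"
    by (rule family_theta[OF fam]) blast
  then obtain \<theta> where h': "\<forall>x>x0. (h has_real_derivative h x * (c + \<theta> x) / x) (at x)"
    and \<theta>: "(\<theta> \<longlongrightarrow> 0) at_top" by blast
  note inv = family_inverse[OF fam \<phi> h' \<theta>]
  have x0: "1 \<le> x0" using fam by (simp add: in_family_def)
  have mono: "h a \<le> h b \<longleftrightarrow> a \<le> b" if "x0 \<le> a" "x0 \<le> b" for a b
    using inv(3)[of a b] inv(3)[of b a] that by (cases a b rule: linorder_cases) auto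
  define u where "u = \<phi> (real p)"
  define v where "v = \<phi> (real p + 1)"
  have u: "x0 \<le> u" "h u = real p" and v: "x0 \<le> v" "h v = real p + 1"
    using inv(1)[of "real p"] inv(1)[of "real p + 1"] p(2) by (auto simp: u_def v_def)
  have ceil: "\<lceil>u\<rceil> \<le> \<lceil>v\<rceil>" "\<lceil>v\<rceil> \<le> \<lceil>u\<rceil> + 1"
  proof -
    have "u \<le> v" using mono[OF u(1) v(1)] u v by simp
    then show "\<lceil>u\<rceil> \<le> \<lceil>v\<rceil>" by (rule ceiling_mono)
    have "v \<le> u + 1" using gap by (simp add: u_def v_def)
    also have "u + 1 \<le> of_int (\<lceil>u\<rceil> + 1)" by simp
    finally show "\<lceil>v\<rceil> \<le> \<lceil>u\<rceil> + 1" by (simp only: ceiling_le_iff)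
  qed
  have iff: "p \<in> primes_of x0 h \<longleftrightarrow> \<lceil>u\<rceil> < \<lceil>v\<rceil>"
  proof
    assume "p \<in> primes_of x0 h"
    then obtain n :: nat where n: "x0 \<le> real n" "int p = \<lfloor>h (real n)\<rfloor>" by (auto simp: primes_of_def)
    then have hn: "real p \<le> h (real n)" "h (real n) < real p + 1"
    proof -
      have "real p = of_int \<lfloor>h (real n)\<rfloor>" using n(2) by (metis of_int_of_nat_eq)
      then show "real p \<le> h (real n)" "h (real n) < real p + 1" using floor_correct[of "h (real n)"] by linarith+
    qed
    have "u \<le> real n" using hn(1) mono[OF u(1) n(1)] u(2) by simp
    then have "\<lceil>u\<rceil> \<le> int n" by (simp add: ceiling_le_iff)
    moreover have "real n < v" using hn(2) mono[OF v(1) n(1)] v(2) by auto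
    then have "int n < \<lceil>v\<rceil>" by (simp add: less_ceiling_iff)
    ultimately show "\<lceil>u\<rceil> < \<lceil>v\<rceil>" by linarith
  next
    assume uv: "\<lceil>u\<rceil> < \<lceil>v\<rceil>"
    define n where "n = nat \<lceil>u\<rceil>"
    have "1 \<le> \<lceil>u\<rceil>" using u(1) x0 by linarith
    then have n: "int n = \<lceil>u\<rceil>" "1 \<le> n" unfolding n_def by linarith+
    have rn: "real n = of_int \<lceil>u\<rceil>" using n(1) by (metis of_int_of_nat_eq)
    have "u \<le> real n" unfolding rn by (rule le_of_int_ceiling)
    moreover have "real n < v" unfolding rn using uv by (simp add: less_ceiling_iff)
    ultimately have "h u \<le> h (real n)" "\<not> h v \<le> h (real n)" "x0 \<le> real n"
      using mono[OF u(1), of "real n"] mono[OF v(1), of "real n"] u(1) by auto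
    then have "\<lfloor>h (real n)\<rfloor> = int p" using u v by (intro floor_unique) auto
    then show "p \<in> primes_of x0 h"
      using p(1) n(2) \<open>x0 \<le> real n\<close> by (auto simp: primes_of_def)
  qed
  have "(v - u) + (frac (- v) - frac (- u)) = of_int (\<lceil>v\<rceil> - \<lceil>u\<rceil>)"
    by (simp add: frac_def ceiling_def)
  also have "\<dots> = (if p \<in> primes_of x0 h then 1 else 0)"
    using ceil iff by (cases "\<lceil>u\<rceil> < \<lceil>v\<rceil>") auto
  finally show ?thesis by (simp add: u_def v_def)
qed

lemma ln_le_powr_eventually:
  fixes \<epsilon> :: real
  assumes "0 < \<epsilon>" shows "eventually (\<lambda>X. 1 + ln (4 * X) \<le> X powr \<epsilon>) at_top"
proof -
  have "eventually (\<lambda>X::real. 1 + 8 / \<epsilon> \<le> X powr (\<epsilon> / 2)) at_top" using assms by (intro powr_eventually_ge) simp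
  moreover have "eventually (\<lambda>X::real. 4 \<le> X) at_top" by (rule eventually_ge_at_top)
  ultimately show ?thesis
  proof eventually_elim
    case (elim X)
    have "ln X \<le> X powr (\<epsilon> / 2) / (\<epsilon> / 2)" using elim assms by (intro ln_powr_bound) auto
    moreover have "ln 4 \<le> ln X" using elim by simp
    moreover have "ln (4 * X) = ln 4 + ln X" using elim by (simp add: ln_mult)
    ultimately have "ln (4 * X) \<le> 2 * (X powr (\<epsilon> / 2) / (\<epsilon> / 2))" by linarith
    also have "\<dots> = 4 / \<epsilon> * X powr (\<epsilon> / 2)" by simp
    also have "\<dots> \<le> 8 / \<epsilon> * X powr (\<epsilon> / 2)" using assms by (intro mult_right_mono divide_right_mono) auto
    finally have "1 + ln (4 * X) \<le> 1 * X powr (\<epsilon> / 2) + 8 / \<epsilon> * X powr (\<epsilon> / 2)"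
      using elim assms by (intro add_mono) (auto simp: ge_one_powr_ge_zero)
    also have "\<dots> = (1 + 8 / \<epsilon>) * X powr (\<epsilon> / 2)" by (simp only: distrib_right)
    also have "\<dots> \<le> X powr (\<epsilon> / 2) * X powr (\<epsilon> / 2)" using elim by (intro mult_right_mono) auto
    also have "\<dots> = X powr \<epsilon>" by (simp flip: powr_add)
    finally show ?case .
  qed
qed

theorem lemma1p10:
  fixes c \<gamma> x0 chi :: real and h \<phi> :: "real \<Rightarrow> real" and a q :: nat
  assumes "1 \<le> c" and "c < 16 / 15"
    and "in_family c x0 h"
    and "\<phi> = inv_into {x0..} h"
    and "\<gamma> = 1 / c"
    and "1 \<le> q" and "a \<le> q - 1" and "coprime a q"
    and "chi > 0" and "16 * (1 - \<gamma>) + 28 * chi < 1"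
  shows "\<exists>chi'>0. \<exists>K::real. \<forall>N::nat. 1 \<le> N \<longrightarrow> (\<forall>\<xi>::real. 0 \<le> \<xi> \<and> \<xi> \<le> 1 \<longrightarrow>
     norm ((\<Sum>p | p \<in> primes_of x0 h \<and> p \<le> N \<and> [p = a] (mod q) \<and> h x0 \<le> real p.
              of_real (inverse (deriv_on {h x0..} \<phi> (real p)) * ln (real p)) * e2pi (\<xi> * real p))
         - (\<Sum>p | prime p \<and> p \<le> N \<and> [p = a] (mod q).
              of_real (ln (real p)) * e2pi (\<xi> * real p)))
     \<le> K * real N powr (1 - chi - chi'))"
proof -
  note fam = assms(3) and \<phi> = assms(4)
  define A where "A = 1 - 1 / c"
  define \<epsilon> where "\<epsilon> = chi / 100"
  define \<delta> where "\<delta> = A + chi + 4 * \<epsilon>"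
  have A: "0 \<le> A" "A \<le> 1" using assms(1) by (auto simp: A_def)
  have chi: "0 < chi" "16 * A + 28 * chi < 1" using assms by (auto simp: A_def)
  have \<epsilon>: "0 < \<epsilon>" "\<epsilon> \<le> 1" using chi A by (auto simp: \<epsilon>_def)
  \<comment> \<open>\<open>family_phase\<close> is used with \<epsilon>/2 because
    \<open>local_phase_shift\<close> doubles the loss.\<close>
  have \<epsilon>2: "0 < \<epsilon> / 2" "\<epsilon> / 2 \<le> 1" using \<epsilon> by auto
  obtain f1 f2 G' y0 where y0: "h x0 < y0" "1 \<le> y0"
    and D1: "\<And>y. y0 \<le> y \<Longrightarrow> (\<phi> has_real_derivative f1 y) (at y)"
    and D2: "\<And>y. y0 \<le> y \<Longrightarrow> (f1 has_real_derivative f2 y) (at y)"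
    and D3: "\<And>y. y0 \<le> y \<Longrightarrow> ((\<lambda>y. y\<^sup>2 * f2 y) has_real_derivative G' y) (at y)"
    and b1: "\<And>y. y0 \<le> y \<Longrightarrow> y powr (- A - \<epsilon> / 2) \<le> f1 y \<and> f1 y \<le> y powr (- A + \<epsilon> / 2) \<and> f1 y \<le> 1/2"
    and b2: "\<And>y. y0 \<le> y \<Longrightarrow> f2 y \<le> - (y powr (- 1 - A - \<epsilon> / 2)) \<and> \<bar>y * f2 y\<bar> \<le> y powr (- A + \<epsilon> / 2)"
    and b3: "\<And>y. y0 \<le> y \<Longrightarrow> G' y \<le> - (y powr (- A - \<epsilon> / 2))"
    by (rule family_phase[OF fam \<phi> A_def \<epsilon>2]) blast
  have "eventually (\<lambda>X. y0 \<le> X \<and> 64 < X \<and> 1 + ln (4 * X) \<le> X powr \<epsilon> \<and> 108 \<le> X powr (\<epsilon> / 2)) at_top"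
    by (intro eventually_conj eventually_ge_at_top eventually_gt_at_top ln_le_powr_eventually powr_eventually_ge \<epsilon> \<epsilon>2)
  then obtain T where T: "\<And>X. T \<le> X \<Longrightarrow> y0 \<le> X \<and> 64 < X \<and> 1 + ln (4 * X) \<le> X powr \<epsilon> \<and> 108 \<le> X powr (\<epsilon> / 2)"
    unfolding eventually_at_top_linorder by blast
  obtain i0 where "T < 2 ^ i0" using real_arch_pow[of 2 T] by auto
  then have X: "y0 \<le> X \<and> 64 < X \<and> 1 + ln (4 * X) \<le> X powr \<epsilon> \<and> 108 \<le> X powr (\<epsilon> / 2)" if "2 ^ i0 \<le> X" for X
    using T[of X] that by simp
  \<comment> \<open>The two sums of the theorem are merged: for a prime n in the residue class this
    is its coefficient in their difference.\<close>
  define D where "D = (\<lambda>n::nat. (if n \<in> primes_of x0 h \<and> h x0 \<le> real n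
     then inverse (deriv_on {h x0..} \<phi> (real n)) * ln (real n) else 0) - ln (real n))"
  define F where "F = (\<lambda>\<xi> n. if prime n \<and> [n = a] (mod q) then of_real (D n) * e2pi (\<xi> * real n) else 0)"
  \<comment> \<open>Small n are bounded trivially, by a constant that depends on neither N nor
    \<xi>. A prime equal to h(x0), where the derivative is one-sided, falls in this range.\<close>
  define K0 where "K0 = (\<Sum>n\<in>{1..<2 ^ i0}. \<bar>D n\<bar>)"
  have f1_mono: "f1 z \<le> f1 y" if "y0 \<le> y" "y \<le> z" for y z
  proof (rule DERIV_nonpos_imp_nonincreasing[OF that(2)])
    fix t assume "y \<le> t" "t \<le> z"
    then have "f2 t \<le> 0" using b2[of t] that powr_ge_zero[of t "- 1 - A - \<epsilon> / 2"] by linarith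
    then show "\<exists>w. (f1 has_real_derivative w) (at t) \<and> w \<le> 0" using D2[of t] \<open>y \<le> t\<close> that by auto
  qed
  have f1_pos: "0 < f1 y" if "y0 \<le> y" for y
    using b1[OF that] that y0 powr_gt_zero[of y "- A - \<epsilon> / 2"] by (smt (verit))
  \<comment> \<open>Replacing \<phi>(n + 1) - \<phi>(n) by \<phi>'(n) costs a value of \<phi>'',
    which is smaller than \<phi>' by a factor of about n; the powers n^(-A) cancel in the
    quotient.\<close>
  have pointwise: "\<bar>D n - ln (real n) / f1 (real n) * (frac (- \<phi> (real n + 1)) - frac (- \<phi> (real n)))\<bar>
      \<le> ln (real n) * real n powr (\<epsilon> - 1)"
    if n: "prime n" "y0 \<le> real n" for n
  proof -
    let ?y = "real n"
    define \<Delta> where "\<Delta> = \<phi> (?y + 1) - \<phi> ?y"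
    have y1: "1 \<le> ?y" using n y0 by simp
    have "\<exists>z>?y. z < ?y + 1 \<and> \<phi> (?y + 1) - \<phi> ?y = (?y + 1 - ?y) * f1 z"
      using n by (intro MVT2 D1) auto
    then obtain z where z: "?y < z" "z < ?y + 1" "\<Delta> = f1 z" by (auto simp: \<Delta>_def)
    have ind: "(if n \<in> primes_of x0 h then 1 else 0) = \<Delta> + (frac (- \<phi> (?y + 1)) - frac (- \<phi> ?y))"
      unfolding \<Delta>_def
      by (rule family_indicator[OF fam \<phi> n(1)]) (use n y0 z b1[of z] in \<open>auto simp: \<Delta>_def\<close>)
    have "at ?y within {h x0..} = at ?y" using n y0 by (intro at_within_interior) simp
    then have der: "deriv_on {h x0..} \<phi> ?y = f1 ?y"
      using D1[OF n(2)] by (simp add: deriv_on_def has_real_derivative_iff_has_vector_derivative vector_derivative_at)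
    have "D n = (if n \<in> primes_of x0 h then 1 else 0) * (ln ?y / f1 ?y) - ln ?y"
      using n y0 by (simp add: D_def der divide_inverse mult.commute)
    also have "\<dots> = ln ?y / f1 ?y * (frac (- \<phi> (?y + 1)) - frac (- \<phi> ?y)) + ln ?y * ((\<Delta> - f1 ?y) / f1 ?y)"
      unfolding ind using f1_pos[OF n(2)] by (simp add: field_simps)
    finally have "\<bar>D n - ln ?y / f1 ?y * (frac (- \<phi> (?y + 1)) - frac (- \<phi> ?y))\<bar> = ln ?y * (\<bar>\<Delta> - f1 ?y\<bar> / f1 ?y)"
      using y1 f1_pos[OF n(2)] by (simp add: abs_mult)
    also have "\<dots> \<le> ln ?y * ?y powr (\<epsilon> - 1)"
    proof (rule mult_left_mono)
      have "\<exists>w>?y. w < z \<and> f1 z - f1 ?y = (z - ?y) * f2 w"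
        using n z by (intro MVT2 D2) auto
      then obtain w where w: "?y < w" "w < z" "f1 z - f1 ?y = (z - ?y) * f2 w" by auto
      have "\<bar>f2 w\<bar> \<le> w powr (- A + \<epsilon> / 2) / w"
        using b2[of w] w n y1 by (simp add: abs_mult field_simps)
      also have "\<dots> = w powr (- A + \<epsilon> / 2 - 1)" using w y1 by (simp add: powr_diff)
      also have "\<dots> \<le> ?y powr (- A + \<epsilon> / 2 - 1)" using w y1 A \<epsilon> by (intro powr_mono2') auto
      finally have f2: "\<bar>f2 w\<bar> \<le> ?y powr (- A + \<epsilon> / 2 - 1)" .
      have "\<bar>\<Delta> - f1 ?y\<bar> = (z - ?y) * \<bar>f2 w\<bar>" unfolding z(3) w(3) using z by (simp add: abs_mult)
      also have "\<dots> \<le> 1 * ?y powr (- A + \<epsilon> / 2 - 1)" using z f2 by (intro mult_mono) auto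
      finally have "\<bar>\<Delta> - f1 ?y\<bar> / f1 ?y \<le> ?y powr (- A + \<epsilon> / 2 - 1) / ?y powr (- A - \<epsilon> / 2)"
        using b1[OF n(2)] y1 by (intro frac_le) auto
      also have "\<dots> = ?y powr ((- A + \<epsilon> / 2 - 1) - (- A - \<epsilon> / 2))" by (rule powr_diff[symmetric])
      also have "(- A + \<epsilon> / 2 - 1) - (- A - \<epsilon> / 2) = \<epsilon> - 1" by simp
      finally show "\<bar>\<Delta> - f1 ?y\<bar> / f1 ?y \<le> ?y powr (\<epsilon> - 1)" .
    qed (use y1 in simp)
    finally show ?thesis .
  qed
  \<comment> \<open>The upper end Y stays free so that the last dyadic block can be cut at
    N.\<close>
  have block: "norm (\<Sum>n\<in>{2 ^ i..<Y}. F \<xi> n) \<le> 8320577 * (2 ^ i) powr (1 - chi - 2 * \<epsilon>)"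
    if i: "i0 \<le> i" and Y: "Y \<le> 2 * 2 ^ i" for i Y \<xi>
  proof -
    define X where "X = (2 ^ i :: nat)"
    have "(2::real) ^ i0 \<le> 2 ^ i" using i by (intro power_increasing) auto
    then have X': "y0 \<le> real X" "64 < real X" "1 + ln (4 * real X) \<le> real X powr \<epsilon>" "108 \<le> real X powr (\<epsilon> / 2)"
      using X[of "2 ^ i"] by (auto simp: X_def)
    have X1: "1 \<le> real X" using X' by simp
    have ph: "local_phase X (real X powr (- A + \<epsilon>)) (real X powr (- 1 - A - \<epsilon>)) (\<lambda>y. \<phi> (y + s))" if "0 \<le> s" "s \<le> 1" for s
    proof -
      have "2 * (\<epsilon> / 2) = \<epsilon>" by simp
      with local_phase_shift[OF D1 D2 D3 b1 b2 b3 A \<epsilon>2 that X'(1) X1 X'(4)] show ?thesis by simp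
    qed
    have disc: "norm (\<Sum>n\<in>{X..<Y}. of_real (prime_weight q a f1 n * frac_jump \<phi> n) * e2pi (\<xi> * real n)) \<le> 4 * (2080144 * real X powr (1 - chi - 2 * \<epsilon>))"
    proof (rule discrepancy)
      show "X = 2 ^ i" by (rule X_def)
      show "64 < X" using X'(2) by simp
      show "1 + ln (4 * real X) \<le> real X powr \<epsilon>" by (rule X'(3))
      show "0 \<le> A" "0 < chi" "16 * A + 28 * chi < 1" using A chi by auto
      show "\<epsilon> = chi / 100" "\<delta> = A + chi + 4 * \<epsilon>" by (simp_all add: \<epsilon>_def \<delta>_def)
      show "local_phase X (real X powr (- A + \<epsilon>)) (real X powr (- 1 - A - \<epsilon>)) \<phi>" using ph[of 0] by simp
      show "local_phase X (real X powr (- A + \<epsilon>)) (real X powr (- 1 - A - \<epsilon>)) (\<lambda>y. \<phi> (y + 1))" using ph[of 1] by simp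
      show "y powr (- A - \<epsilon>) \<le> f1 y" if "real X \<le> y" for y
      proof -
        have "y powr (- A - \<epsilon>) \<le> y powr (- A - \<epsilon> / 2)" using that X1 \<epsilon> by (intro powr_mono) auto
        then show ?thesis using b1[of y] that X'(1) by simp
      qed
      show "f1 z \<le> f1 y" if "real X \<le> y" "y \<le> z" for y z using f1_mono[of y z] that X'(1) by simp
      show "0 < q" using assms by simp
      show "Y \<le> 2 * X" using Y by (simp add: X_def)
    qed
    define r where "r = (\<lambda>n. if prime n \<and> [n = a] (mod q)
       then D n - ln (real n) / f1 (real n) * (frac (- \<phi> (real n + 1)) - frac (- \<phi> (real n))) else 0)"
    have r: "\<bar>r n\<bar> \<le> real X powr \<epsilon> * real X powr (\<epsilon> - 1)" if n: "n \<in> {X..<Y}" for n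
    proof -
      have "X \<le> n" "n \<le> 4 * X" using n Y by (auto simp: X_def)
      then have "real X \<le> real n" "real n \<le> real (4 * X)" by (simp_all only: of_nat_le_iff)
      then have n': "real X \<le> real n" "real n \<le> 4 * real X" "1 \<le> real n" using X1 by auto
      have "ln (real n) \<le> ln (4 * real X)" using n' by simp
      then have "ln (real n) \<le> real X powr \<epsilon>" using X'(3) by linarith
      moreover have "real n powr (\<epsilon> - 1) \<le> real X powr (\<epsilon> - 1)"
        using n' X1 \<epsilon> by (intro powr_mono2') auto
      ultimately have "ln (real n) * real n powr (\<epsilon> - 1) \<le> real X powr \<epsilon> * real X powr (\<epsilon> - 1)"
        using n' by (intro mult_mono) auto
      then show ?thesis using pointwise[of n] n' X'(1) by (auto simp: r_def)
    qed
    have "(\<Sum>n\<in>{X..<Y}. F \<xi> n) = (\<Sum>n\<in>{X..<Y}. of_real (prime_weight q a f1 n * frac_jump \<phi> n) * e2pi (\<xi> * real n))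
        + (\<Sum>n\<in>{X..<Y}. of_real (r n) * e2pi (\<xi> * real n))"
      unfolding sum.distrib[symmetric]
      by (intro sum.cong refl) (simp add: F_def r_def prime_weight_def frac_jump_def algebra_simps)
    then have "norm (\<Sum>n\<in>{X..<Y}. F \<xi> n) \<le> norm (\<Sum>n\<in>{X..<Y}. of_real (prime_weight q a f1 n * frac_jump \<phi> n) * e2pi (\<xi> * real n))
        + norm (\<Sum>n\<in>{X..<Y}. of_real (r n) * e2pi (\<xi> * real n))"
      by (simp only: norm_triangle_ineq)
    also have "\<dots> \<le> 4 * (2080144 * real X powr (1 - chi - 2 * \<epsilon>)) + real X powr (1 - chi - 2 * \<epsilon>)"
    proof (rule add_mono[OF disc])
      have "norm (\<Sum>n\<in>{X..<Y}. of_real (r n) * e2pi (\<xi> * real n)) \<le> (\<Sum>n\<in>{X..<Y}. real X powr \<epsilon> * real X powr (\<epsilon> - 1))"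
        using r by (intro sum_norm_le) (simp add: norm_mult)
      also have "\<dots> \<le> real X * (real X powr \<epsilon> * real X powr (\<epsilon> - 1))"
      proof -
        have "real (Y - X) \<le> real X" using Y by (simp add: X_def)
        then have "real (Y - X) * (real X powr \<epsilon> * real X powr (\<epsilon> - 1)) \<le> real X * (real X powr \<epsilon> * real X powr (\<epsilon> - 1))"
          by (rule mult_right_mono) simp
        then show ?thesis by simp
      qed
      also have "\<dots> = real X powr (1 + (\<epsilon> + (\<epsilon> - 1)))" using X1 by (simp only: powr_add) simp
      also have "\<dots> \<le> real X powr (1 - chi - 2 * \<epsilon>)" using X1 chi A by (intro powr_mono) (auto simp: \<epsilon>_def)
      finally show "norm (\<Sum>n\<in>{X..<Y}. of_real (r n) * e2pi (\<xi> * real n)) \<le> real X powr (1 - chi - 2 * \<epsilon>)" .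
    qed
    also have "\<dots> = 8320577 * (2 ^ i) powr (1 - chi - 2 * \<epsilon>)" by (simp add: X_def)
    finally show ?thesis by (simp add: X_def)
  qed
  \<comment> \<open>A nonnegative exponent lets the bound of each block be replaced by the same
    power of N.\<close>
  have ex: "0 \<le> 1 - chi - 2 * \<epsilon>" using chi A by (simp add: \<epsilon>_def)
  define C where "C = K0 + 8320577"
  have C0: "0 \<le> K0" by (simp add: K0_def sum_nonneg)
  define K where "K = 4 / \<epsilon> * C"
  show ?thesis
  \<comment> \<open>chi' is a single \<epsilon>: each block saves chi + 2 \<epsilon>, and the number
    of blocks costs N^\<epsilon>.\<close>
  proof (rule exI[of _ \<epsilon>], rule conjI, rule \<epsilon>(1), rule exI[of _ K], intro allI impI)
    fix N :: nat and \<xi> :: real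
    assume N: "1 \<le> N" and "0 \<le> \<xi> \<and> \<xi> \<le> 1"
    \<comment> \<open>By minimality every block i < J starts at 2^i \<le> N, and 2^J \<le> 2 N
      bounds the number of blocks.\<close>
    define J where "J = (LEAST j. N < 2 ^ j)"
    have J: "N < 2 ^ J" unfolding J_def by (rule LeastI[of _ N]) simp
    have small: "2 ^ j \<le> N" if "j < J" for j using not_less_Least[of j "\<lambda>j. N < 2 ^ j"] that by (simp add: J_def)
    define FN where "FN = (\<lambda>n. if n \<le> N then F \<xi> n else 0)"
    let ?g = "\<lambda>p. complex_of_real (inverse (deriv_on {h x0..} \<phi> (real p)) * ln (real p)) * e2pi (\<xi> * real p)"
    let ?g' = "\<lambda>p. complex_of_real (ln (real p)) * e2pi (\<xi> * real p)"
    have s1: "(\<Sum>p | p \<in> primes_of x0 h \<and> p \<le> N \<and> [p = a] (mod q) \<and> h x0 \<le> real p. ?g p) =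
       (\<Sum>n\<in>{1..N}. if prime n \<and> [n = a] (mod q) \<and> n \<in> primes_of x0 h \<and> h x0 \<le> real n then ?g n else 0)"
      by (rule sum.mono_neutral_cong_left) (auto simp: primes_of_def prime_gt_0_nat Suc_le_eq)
    have s2: "(\<Sum>p | prime p \<and> p \<le> N \<and> [p = a] (mod q). ?g' p) =
       (\<Sum>n\<in>{1..N}. if prime n \<and> [n = a] (mod q) then ?g' n else 0)"
      by (rule sum.mono_neutral_cong_left) (auto simp: prime_gt_0_nat Suc_le_eq)
    have "(\<Sum>p | p \<in> primes_of x0 h \<and> p \<le> N \<and> [p = a] (mod q) \<and> h x0 \<le> real p. ?g p)
        - (\<Sum>p | prime p \<and> p \<le> N \<and> [p = a] (mod q). ?g' p) = (\<Sum>n\<in>{1..N}. F \<xi> n)"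
      unfolding s1 s2 sum_subtractf[symmetric]
      by (intro sum.cong refl) (auto simp: F_def D_def left_diff_distrib)
    also have "\<dots> = (\<Sum>n\<in>{1..<2 ^ J}. FN n)"
      using J by (intro sum.mono_neutral_cong_left) (auto simp: FN_def)
    also have "\<dots> = (\<Sum>i<J. \<Sum>n\<in>{2 ^ i..<2 ^ Suc i}. FN n)" by (rule sum_dyadic)
    finally have eq: "(\<Sum>p | p \<in> primes_of x0 h \<and> p \<le> N \<and> [p = a] (mod q) \<and> h x0 \<le> real p. ?g p)
        - (\<Sum>p | prime p \<and> p \<le> N \<and> [p = a] (mod q). ?g' p) = (\<Sum>i<J. \<Sum>n\<in>{2 ^ i..<2 ^ Suc i}. FN n)" .
    have N1: "1 \<le> real N powr (1 - chi - 2 * \<epsilon>)" using N ex by (intro ge_one_powr_ge_zero) auto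
    have "norm (\<Sum>i<J. \<Sum>n\<in>{2 ^ i..<2 ^ Suc i}. FN n) \<le> (\<Sum>i<J. C * real N powr (1 - chi - 2 * \<epsilon>))"
    proof (rule sum_norm_le)
      fix i assume i: "i \<in> {..<J}"
      show "norm (\<Sum>n\<in>{2 ^ i..<2 ^ Suc i}. FN n) \<le> C * real N powr (1 - chi - 2 * \<epsilon>)"
      proof (cases "i0 \<le> i")
        case False
        then have "(2::nat) ^ Suc i \<le> 2 ^ i0" by (intro power_increasing) auto
        then have sub: "{2 ^ i..<2 ^ Suc i} \<subseteq> {1..<2 ^ i0 :: nat}" by auto
        have "norm (\<Sum>n\<in>{2 ^ i..<2 ^ Suc i}. FN n) \<le> (\<Sum>n\<in>{2 ^ i..<2 ^ Suc i}. \<bar>D n\<bar>)"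
          by (rule sum_norm_le) (simp add: FN_def F_def norm_mult)
        also have "\<dots> \<le> K0" unfolding K0_def by (rule sum_mono2[OF _ sub]) auto
        also have "\<dots> \<le> C * 1" by (simp add: C_def)
        also have "\<dots> \<le> C * real N powr (1 - chi - 2 * \<epsilon>)" using N1 C0 by (intro mult_left_mono) (auto simp: C_def)
        finally show ?thesis .
      next
        case True
        have iN: "2 ^ i \<le> N" using small[of i] i by simp
        have "(\<Sum>n\<in>{2 ^ i..<2 ^ Suc i}. FN n) = (\<Sum>n\<in>{2 ^ i..<min (2 * 2 ^ i) (Suc N)}. F \<xi> n)"
          by (rule sum.mono_neutral_cong_right) (auto simp: FN_def)
        then have "norm (\<Sum>n\<in>{2 ^ i..<2 ^ Suc i}. FN n) \<le> 8320577 * (2 ^ i) powr (1 - chi - 2 * \<epsilon>)"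
          using block[OF True, of "min (2 * 2 ^ i) (Suc N)" \<xi>] by simp
        also have "\<dots> \<le> 8320577 * real N powr (1 - chi - 2 * \<epsilon>)"
        proof (intro mult_left_mono powr_mono2 ex)
          have "real (2 ^ i) \<le> real N" using iN by (simp only: of_nat_le_iff)
          then show "2 ^ i \<le> real N" by simp
        qed auto
        also have "\<dots> \<le> C * real N powr (1 - chi - 2 * \<epsilon>)" using C0 by (intro mult_right_mono) (auto simp: C_def)
        finally show ?thesis .
      qed
    qed
    also have "\<dots> = real J * (C * real N powr (1 - chi - 2 * \<epsilon>))" by simp
    also have "\<dots> \<le> (4 / \<epsilon> * real N powr \<epsilon>) * (C * real N powr (1 - chi - 2 * \<epsilon>))"
    proof (rule mult_right_mono)
      have "2 ^ J \<le> 2 * N" using small[of "J - 1"] N by (cases J) auto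
      then have "real (2 ^ J) \<le> real (2 * N)" by (simp only: of_nat_le_iff)
      then have "ln (2 ^ J) \<le> ln (2 * real N)" by (subst ln_le_cancel_iff) (use N in auto)
      then have J1: "real J * ln 2 \<le> ln (2 * real N)" by (simp add: ln_realpow)
      have "1/2 \<le> ln (2::real)" using ln_diff_le[of 1 "2::real"] by simp
      then have "real J * (1/2) \<le> real J * ln 2" by (rule mult_left_mono) simp
      also have "\<dots> \<le> ln (2 * real N)" by (rule J1)
      also have "\<dots> \<le> (2 * real N) powr \<epsilon> / \<epsilon>" using N \<epsilon> by (intro ln_powr_bound) auto
      also have "\<dots> = 2 powr \<epsilon> * real N powr \<epsilon> / \<epsilon>" by (simp add: powr_mult)
      also have "\<dots> \<le> 2 powr 1 * real N powr \<epsilon> / \<epsilon>" using \<epsilon> by (intro divide_right_mono mult_right_mono powr_mono) auto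
      finally show "real J \<le> 4 / \<epsilon> * real N powr \<epsilon>" by simp
    qed (use C0 in \<open>simp add: C_def\<close>)
    also have "\<dots> = K * (real N powr \<epsilon> * real N powr (1 - chi - 2 * \<epsilon>))" by (simp add: K_def)
    also have "\<dots> = K * real N powr (1 - chi - \<epsilon>)" unfolding powr_add[symmetric] by (simp add: algebra_simps)
    finally show "norm ((\<Sum>p | p \<in> primes_of x0 h \<and> p \<le> N \<and> [p = a] (mod q) \<and> h x0 \<le> real p. ?g p)
        - (\<Sum>p | prime p \<and> p \<le> N \<and> [p = a] (mod q). ?g' p)) \<le> K * real N powr (1 - chi - \<epsilon>)"
      by (simp only: eq)
  qed
qed

end
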